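(* Let $\mathbb{F}$ be a field and let $L$ be a nilpotent symplectic alternating algebra over $\mathbb{F}$ of dimension $10$ with an isotropic center of dimension $2$ that is of class $7$ and has the further properties that $L^{4}L^{3}\neq L^{7}$, $L^{5}L^{2}\leq L^{4}L^{3}$ and $UL^{2}$ is $2$-dimensional, where $U=U(L)$ is the characteristic ideal defined in the context. Then $L$ can be given by a presentation of the form $$\mathcal{P}_{10}^{(2,6)}(r):\ (x_{2}y_{3},y_{5})=r,\ (x_{3}y_{4},y_{5})=1,\ (x_{1}y_{2},y_{5})=1,\ (x_{1}y_{3},y_{4})=1,\ (y_{1}y_{2},y_{3})=1,$$ where $r\in\mathbb{F}$, $r\neq 0$. Furthermore, for $r,s\in\mathbb{F}^{*}$, two such presentations $\mathcal{P}_{10}^{(2,6)}(r)$ and $\mathcal{P}_{10}^{(2,6)}(s)$ describe the same algebra (up to isomorphism) if and only if $s/r\in(\mathbb{F}^{*})^{12}$. Conversely, any algebra with such a presentation has the properties stated.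
   Context: A symplectic alternating algebra (SAA) over a field $\mathbb{F}$ is a finite-dimensional $\mathbb{F}$-vector space $L$ with a non-degenerate alternating bilinear form $(\cdot,\cdot)$ and a bilinear alternating product $L\times L\to L$, $(x,y)\mapsto xy$ (so $xx=0$), such that $(xy,z)=(yz,x)$ for all $x,y,z\in L$. Consequently $(u,v,w)\mapsto (uv,w)$ is an alternating trilinear form, and by non-degeneracy it determines the product. An isomorphism of SAAs is a linear bijection preserving both the product and the form. For subspaces $A,B\le L$, $AB$ denotes the linear span of all products $ab$ with $a\in A$, $b\in B$. Put $L^{1}=L$, $L^{k+1}=L^{k}L$; $L$ is nilpotent if $L^{k+1}=0$ for some $k$, and the smallest such $k$ is its (nilpotence) class. The center is $Z(L)=\{z\in L: zx=0 \text{ for all } x\in L\}$. A subspace $A$ is isotropic if $(u,v)=0$ for all $u,v\in A$. $\mathbb{F}^{*}=\mathbb{F}\setminus\{0\}$ and $(\mathbb{F}^{*})^{m}=\{a^{m}:a\in\mathbb{F}^{*}\}$. A standard basis of a $10$-dimensional $L$ is a basis $x_{1},y_{1},\ldots,x_{5},y_{5}$ with $(x_i,x_j)=(y_i,y_j)=0$ and $(x_i,y_j)=\delta_{ij}$. A nilpotent presentation lists values of the triples $(x_iy_j,y_k)$ and $(y_iy_j,y_k)$ with $1\le i<j<k\le 5$ with respect to a standard basis. By convention, all triple values $(uv,w)$ of basis vectors $u,v,w$ which do not follow from the listed ones by the alternating property are $0$. Such a presentation determines an SAA up to isomorphism. Definition of $U$: let $L$ be a nilpotent SAA of dimension $10$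 and class $7$ with isotropic center of dimension $2$ (then $L^4L^3$ is a $2$-dimensional subspace of $L^6$). Put $I_{1}=L^{5}L^{2}$, $I_{2}=L^{7}$, $I_{3}=L^{6}$, and let $k$ be the smallest index such that $I_{k}\cap L^{4}L^{3}\neq\{0\}$. Then $U=\{x\in L^{4}: xL^{3}\leq I_{k}\}$, a characteristic ideal of dimension $5$. *)

theory Defs
  imports Complex_Main "HOL-Library.Product_Plus"
begin

(* The underlying set of the vector space is the whole type 'a. *)
record ('f, 'a) saa_struct =
  scale :: "'f \<Rightarrow> 'a \<Rightarrow> 'a"
  form  :: "'a \<Rightarrow> 'a \<Rightarrow> 'f"
  mult  :: "'a \<Rightarrow> 'a \<Rightarrow> 'a"

locale symplectic_alternating_algebra = vector_space "scale L"
  for L :: "('f::field, 'a::ab_group_add) saa_struct" +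
  assumes finite_dim: "\<exists>B. finite B \<and> module.span (scale L) B = UNIV"
    and form_linear_left: "Vector_Spaces.linear (scale L) (*) (\<lambda>u. form L u v)"
    and form_linear_right: "Vector_Spaces.linear (scale L) (*) (\<lambda>v. form L u v)"
    and form_alternating: "form L u u = 0"
    and form_nondegenerate: "(\<forall>v. form L u v = 0) \<Longrightarrow> u = 0"
    and mult_linear_left: "Vector_Spaces.linear (scale L) (scale L) (\<lambda>u. mult L u v)"
    and mult_linear_right: "Vector_Spaces.linear (scale L) (scale L) (\<lambda>v. mult L u v)"
    and mult_alternating: "mult L u u = 0"
    and form_mult_cyclic: "form L (mult L u v) w = form L (mult L v w) u"

definition saa_iso ::
  "('f::field, 'a::ab_group_add) saa_struct \<Rightarrow> ('f, 'b::ab_group_add) saa_struct \<Rightarrow> ('a \<Rightarrow> 'b) \<Rightarrow> bool"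
  where "saa_iso L M \<phi> \<longleftrightarrow>
    Vector_Spaces.linear (scale L) (scale M) \<phi> \<and> bij \<phi> \<and>
    (\<forall>u v. \<phi> (mult L u v) = mult M (\<phi> u) (\<phi> v)) \<and>
    (\<forall>u v. form M (\<phi> u) (\<phi> v) = form L u v)"

definition saa_isomorphic ::
  "('f::field, 'a::ab_group_add) saa_struct \<Rightarrow> ('f, 'b::ab_group_add) saa_struct \<Rightarrow> bool"
  where "saa_isomorphic L M \<longleftrightarrow> (\<exists>\<phi>. saa_iso L M \<phi>)"

definition set_mult ::
  "('f::field, 'a::ab_group_add) saa_struct \<Rightarrow> 'a set \<Rightarrow> 'a set \<Rightarrow> 'a set"
  where "set_mult L A B = module.span (scale L) {mult L a b | a b. a \<in> A \<and> b \<in> B}"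

(* lpow L k is L^k for k >= 1: L^1 = L and L^(k+1) = L^k L.  (The value at k = 0 is also L.) *)
definition lpow :: "('f::field, 'a::ab_group_add) saa_struct \<Rightarrow> nat \<Rightarrow> 'a set"
  where "lpow L k = ((\<lambda>A. set_mult L A UNIV) ^^ (k - 1)) UNIV"

definition saa_nilpotent :: "('f::field, 'a::ab_group_add) saa_struct \<Rightarrow> bool"
  where "saa_nilpotent L \<longleftrightarrow> (\<exists>k. lpow L (k + 1) = {0})"

definition nilpotence_class :: "('f::field, 'a::ab_group_add) saa_struct \<Rightarrow> nat"
  where "nilpotence_class L = (LEAST k. lpow L (k + 1) = {0})"

definition saa_center :: "('f::field, 'a::ab_group_add) saa_struct \<Rightarrow> 'a set"
  where "saa_center L = {z. \<forall>x. mult L z x = 0}"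

definition isotropic :: "('f::field, 'a::ab_group_add) saa_struct \<Rightarrow> 'a set \<Rightarrow> bool"
  where "isotropic L A \<longleftrightarrow> (\<forall>u\<in>A. \<forall>v\<in>A. form L u v = 0)"

(* The ideals I_1, I_2, I_3 entering the definition of U. *)
definition I_ideal :: "('f::field, 'a::ab_group_add) saa_struct \<Rightarrow> nat \<Rightarrow> 'a set"
  where "I_ideal L k =
    (if k = 1 then set_mult L (lpow L 5) (lpow L 2)
     else if k = 2 then lpow L 7
     else lpow L 6)"

definition U_index :: "('f::field, 'a::ab_group_add) saa_struct \<Rightarrow> nat"
  where "U_index L =
    (LEAST k. k \<in> {1, 2, 3} \<and> I_ideal L k \<inter> set_mult L (lpow L 4) (lpow L 3) \<noteq> {0})"

definition U_ideal :: "('f::field, 'a::ab_group_add) saa_struct \<Rightarrow> 'a set"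
  where "U_ideal L =
    {x \<in> lpow L 4. set_mult L {x} (lpow L 3) \<subseteq> I_ideal L (U_index L)}"

(* Distinctness of the ten vectors is implied by the values of the form. *)
definition standard_basis10 ::
  "('f::field, 'a::ab_group_add) saa_struct \<Rightarrow> (nat \<Rightarrow> 'a) \<Rightarrow> (nat \<Rightarrow> 'a) \<Rightarrow> bool"
  where "standard_basis10 L x y \<longleftrightarrow>
    \<not> module.dependent (scale L) (x ` {1..5} \<union> y ` {1..5}) \<and>
    module.span (scale L) (x ` {1..5} \<union> y ` {1..5}) = UNIV \<and>
    (\<forall>i\<in>{1..5}. \<forall>j\<in>{1..5}.
       form L (x i) (x j) = 0 \<and> form L (y i) (y j) = 0 \<and>
       form L (x i) (y j) = (if i = j then 1 else 0))"

(* A nilpotent presentation is a pair of functions p, q listing, for 1 <= i < j < k <= 5, the values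
     (x_i y_j, y_k) = p i j k   and   (y_i y_j, y_k) = q i j k.
   All triples that do not follow from these by the alternating property vanish.  Up to
   permutation these are (x_i x_j, x_k), (x_i x_j, y_k), and (x_i y_j, y_k) with j < k, j <= i. *)
definition has_nilpotent_presentation10 ::
  "('f::field, 'a::ab_group_add) saa_struct \<Rightarrow>
   (nat \<Rightarrow> nat \<Rightarrow> nat \<Rightarrow> 'f) \<Rightarrow> (nat \<Rightarrow> nat \<Rightarrow> nat \<Rightarrow> 'f) \<Rightarrow> bool"
  where "has_nilpotent_presentation10 L p q \<longleftrightarrow>
    (\<exists>x y. standard_basis10 L x y \<and>
      (\<forall>i\<in>{1..5}. \<forall>j\<in>{1..5}. \<forall>k\<in>{1..5}.
        form L (mult L (x i) (x j)) (x k) = 0 \<and>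
        form L (mult L (x i) (x j)) (y k) = 0 \<and>
        (j < k \<longrightarrow> form L (mult L (x i) (y j)) (y k) = (if i < j then p i j k else 0)) \<and>
        (i < j \<and> j < k \<longrightarrow> form L (mult L (y i) (y j)) (y k) = q i j k)))"

definition P26_xyy :: "'f::field \<Rightarrow> nat \<Rightarrow> nat \<Rightarrow> nat \<Rightarrow> 'f"
  where "P26_xyy r i j k =
    (if (i, j, k) = (2, 3, 5) then r
     else if (i, j, k) \<in> {(3, 4, 5), (1, 2, 5), (1, 3, 4)} then 1
     else 0)"

definition P26_yyy :: "nat \<Rightarrow> nat \<Rightarrow> nat \<Rightarrow> 'f::field"
  where "P26_yyy i j k = (if (i, j, k) = (1, 2, 3) then 1 else 0)"

definition has_presentation_P26 :: "('f::field, 'a::ab_group_add) saa_struct \<Rightarrow> 'f \<Rightarrow> bool"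
  where "has_presentation_P26 L r \<longleftrightarrow>
    symplectic_alternating_algebra L \<and> has_nilpotent_presentation10 L (P26_xyy r) P26_yyy"

definition P26_properties :: "('f::field, 'a::ab_group_add) saa_struct \<Rightarrow> bool"
  where "P26_properties L \<longleftrightarrow>
    symplectic_alternating_algebra L \<and>
    vector_space.dim (scale L) (UNIV :: 'a set) = 10 \<and>
    saa_nilpotent L \<and>
    nilpotence_class L = 7 \<and>
    isotropic L (saa_center L) \<and>
    vector_space.dim (scale L) (saa_center L) = 2 \<and>
    set_mult L (lpow L 4) (lpow L 3) \<noteq> lpow L 7 \<and>
    set_mult L (lpow L 5) (lpow L 2) \<subseteq> set_mult L (lpow L 4) (lpow L 3) \<and>
    vector_space.dim (scale L) (set_mult L (U_ideal L) (lpow L 2)) = 2"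

definition nonzero_powers :: "nat \<Rightarrow> 'f::field set"
  where "nonzero_powers m = {a ^ m | a. a \<noteq> 0}"

(* Every presentation P26 r is realised, on the space F^5 x F^5 with x-coordinates first. *)
type_synonym 'f pair5 = "('f \<times> 'f \<times> 'f \<times> 'f \<times> 'f) \<times> ('f \<times> 'f \<times> 'f \<times> 'f \<times> 'f)"

fun m_scale :: "'f::field \<Rightarrow> 'f pair5 \<Rightarrow> 'f pair5" where
  "m_scale c ((a1,a2,a3,a4,a5),(b1,b2,b3,b4,b5)) =
     ((c*a1,c*a2,c*a3,c*a4,c*a5),(c*b1,c*b2,c*b3,c*b4,c*b5))"

fun m_form :: "'f::field pair5 \<Rightarrow> 'f pair5 \<Rightarrow> 'f" where
  "m_form ((a1,a2,a3,a4,a5),(b1,b2,b3,b4,b5)) ((c1,c2,c3,c4,c5),(d1,d2,d3,d4,d5)) =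
     (a1*d1 - b1*c1) + (a2*d2 - b2*c2) + (a3*d3 - b3*c3) + (a4*d4 - b4*c4) + (a5*d5 - b5*c5)"

fun m_mult :: "'f::field \<Rightarrow> 'f pair5 \<Rightarrow> 'f pair5 \<Rightarrow> 'f pair5" where
  "m_mult r ((a1,a2,a3,a4,a5),(b1,b2,b3,b4,b5)) ((c1,c2,c3,c4,c5),(d1,d2,d3,d4,d5)) =
     ((b2*d3 - b3*d2,
       (b3*d1 - b1*d3) - (a1*d5 - b5*c1),
       (b1*d2 - b2*d1) - r*(a2*d5 - b5*c2) - (a1*d4 - b4*c1),
       (a1*d3 - b3*c1) - (a3*d5 - b5*c3),
       r*(a2*d3 - b3*c2) + (a3*d4 - b4*c3) + (a1*d2 - b2*c1)),
      (- (b2*d5 - b5*d2) - (b3*d4 - b4*d3),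
       - r*(b3*d5 - b5*d3),
       - (b4*d5 - b5*d4),
       0,
       0))"

definition P26_model :: "'f::field \<Rightarrow> ('f, 'f pair5) saa_struct" where
  "P26_model r = \<lparr>scale = m_scale, form = m_form, mult = m_mult r\<rparr>"

definition m_x :: "nat \<Rightarrow> 'f::field pair5" where
  "m_x i = ((of_bool (i=1), of_bool (i=2), of_bool (i=3), of_bool (i=4), of_bool (i=5)), 0)"

definition m_y :: "nat \<Rightarrow> 'f::field pair5" where
  "m_y i = (0, (of_bool (i=1), of_bool (i=2), of_bool (i=3), of_bool (i=4), of_bool (i=5)))"

lemma m_vector_space: "vector_space (m_scale :: 'f::field \<Rightarrow> _)"
  by unfold_locales (auto simp: algebra_simps)

lemma m_linear:
  "Vector_Spaces.linear m_scale (*) (\<lambda>u. m_form u (v :: 'f::field pair5))"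
  "Vector_Spaces.linear m_scale (*) (\<lambda>v. m_form (u :: 'f pair5) v)"
  "Vector_Spaces.linear m_scale m_scale (\<lambda>u. m_mult r u (v :: 'f pair5))"
  "Vector_Spaces.linear m_scale m_scale (\<lambda>v. m_mult r (u :: 'f pair5) v)"
proof -
  have "vector_space ((*) :: 'f \<Rightarrow> 'f \<Rightarrow> 'f)"
    by unfold_locales (auto simp: algebra_simps)
  then show
    "Vector_Spaces.linear m_scale (*) (\<lambda>u. m_form u (v :: 'f::field pair5))"
    "Vector_Spaces.linear m_scale (*) (\<lambda>v. m_form (u :: 'f pair5) v)"
    "Vector_Spaces.linear m_scale m_scale (\<lambda>u. m_mult r u (v :: 'f pair5))"
    "Vector_Spaces.linear m_scale m_scale (\<lambda>v. m_mult r (u :: 'f pair5) v)"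
    unfolding Vector_Spaces.linear_def module_hom_def module_hom_axioms_def
    using m_vector_space[where 'f='f]
    by (cases u; cases v; auto simp: algebra_simps module_iff_vector_space split_paired_all)+
qed

lemma m_indices: "i \<in> {1..5} \<longleftrightarrow> i \<in> {1, 2, 3, 4, 5::nat}"
  by auto

lemma m_basis_set:
  "m_x ` {1..5} \<union> m_y ` {1..5} =
   {((1,0,0,0,0),0), ((0,1,0,0,0),0), ((0,0,1,0,0),0), ((0,0,0,1,0),0), ((0,0,0,0,1),0),
    (0,(1,0,0,0,0)), (0,(0,1,0,0,0)), (0,(0,0,1,0,0)), (0,(0,0,0,1,0)), (0,(0,0,0,0,1 :: 'f::field))}"
proof -
  have "{1..5} = {1, 2, 3, 4, 5::nat}" by auto
  then show ?thesis by (simp add: m_x_def m_y_def zero_prod_def insert_commute)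
qed

lemma m_span: "module.span m_scale (m_x ` {1..5} \<union> m_y ` {1..5}) = (UNIV :: 'f::field pair5 set)"
proof -
  interpret vector_space "m_scale :: 'f \<Rightarrow> _" by (rule m_vector_space)
  have "v \<in> span (m_x ` {1..5} \<union> m_y ` {1..5})" (is "_ \<in> span ?B") for v :: "'f pair5"
  proof -
    obtain a1 a2 a3 a4 a5 b1 b2 b3 b4 b5 where v: "v = ((a1,a2,a3,a4,a5),(b1,b2,b3,b4,b5))"
      by (metis surj_pair)
    have eq: "v = m_scale a1 (m_x 1) + m_scale a2 (m_x 2) + m_scale a3 (m_x 3) + m_scale a4 (m_x 4)
       + m_scale a5 (m_x 5) + m_scale b1 (m_y 1) + m_scale b2 (m_y 2) + m_scale b3 (m_y 3)
       + m_scale b4 (m_y 4) + m_scale b5 (m_y 5)"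
      by (simp add: v m_x_def m_y_def zero_prod_def)
    show ?thesis
      unfolding eq by (intro span_add span_scale span_base) auto
  qed
  then show ?thesis by auto
qed

lemma m_independent:
  "\<not> module.dependent m_scale (m_x ` {1..5} \<union> m_y ` {1..5} :: 'f::field pair5 set)"
proof -
  interpret vector_space "m_scale :: 'f \<Rightarrow> _" by (rule m_vector_space)
  show ?thesis
    unfolding m_basis_set
    by (subst dependent_finite) (auto simp: zero_prod_def)
qed

lemma P26_model_saa: "symplectic_alternating_algebra (P26_model (r :: 'f::field))"
proof -
  interpret vector_space "m_scale :: 'f \<Rightarrow> _" by (rule m_vector_space)
  have nondeg: "u = 0" if "\<forall>v. m_form u v = 0" for u :: "'f pair5"
  proof -
    obtain a1 a2 a3 a4 a5 b1 b2 b3 b4 b5 where u: "u = ((a1,a2,a3,a4,a5),(b1,b2,b3,b4,b5))"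
      by (metis surj_pair)
    have "m_form u (m_x i) = 0" "m_form u (m_y i) = 0" for i using that by blast+
    from this[of 1] this[of 2] this[of 3] this[of 4] this[of 5] show ?thesis
      by (simp add: u m_x_def m_y_def zero_prod_def)
  qed
  have alt: "m_form u u = 0" "m_mult r u u = 0" for u :: "'f pair5"
    by (cases u; auto simp: zero_prod_def algebra_simps)+
  have cyc: "m_form (m_mult r u v) w = m_form (m_mult r v w) u" for u v w :: "'f pair5"
    by (cases u; cases v; cases w) (auto simp: algebra_simps)
  show ?thesis
    unfolding symplectic_alternating_algebra_def symplectic_alternating_algebra_axioms_def
    using m_vector_space m_linear alt cyc nondeg m_span
    by (auto simp: P26_model_def intro!: exI[of _ "m_x ` {1..5} \<union> m_y ` {1..5}"])
qed

lemma P26_model: "has_presentation_P26 (P26_model r) (r :: 'f::field)"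
proof -
  have basis: "standard_basis10 (P26_model r) m_x (m_y :: nat \<Rightarrow> 'f pair5)"
    unfolding standard_basis10_def
    using m_span[where 'f='f] m_independent[where 'f='f]
    by (auto simp: P26_model_def Ball_def m_indices m_x_def m_y_def zero_prod_def)
  have vals: "form (P26_model r) (mult (P26_model r) (m_x i) (m_x j)) (m_x k) = 0 \<and>
        form (P26_model r) (mult (P26_model r) (m_x i) (m_x j)) (m_y k) = 0 \<and>
        (j < k \<longrightarrow> form (P26_model r) (mult (P26_model r) (m_x i) (m_y j)) (m_y k)
           = (if i < j then P26_xyy r i j k else 0)) \<and>
        (i < j \<and> j < k \<longrightarrow> form (P26_model r) (mult (P26_model r) (m_y i) (m_y j)) (m_y k)
           = P26_yyy i j k)"
    if "i \<in> {1..5}" "j \<in> {1..5}" "k \<in> {1..5}" for i j k :: nat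
    using that unfolding m_indices
    by (simp add: P26_model_def m_x_def m_y_def zero_prod_def P26_xyy_def P26_yyy_def)
      (elim disjE; simp)
  show ?thesis
    unfolding has_presentation_P26_def has_nilpotent_presentation10_def
    using basis vals P26_model_saa by blast
qed

end

theory Submission
  imports Defs
begin

text \<open>
  In class 7 the subspaces \<open>L\<^sup>i\<close> and \<open>L\<^sup>j\<close> are orthogonal iff \<open>i + j \<ge> 9\<close>, and annihilate each other iff
  \<open>i + j \<ge> 8\<close>. This forces the dimensions 8, 7, 6, 4, 3, 2 of \<open>L\<^sup>2, \<dots>, L\<^sup>7\<close> and makes
  \<open>L\<^sup>5L\<^sup>2 < L\<^sup>7 < L\<^sup>6 < L\<^sup>5 < U < L\<^sup>4 < L\<^sup>3 < L\<^sup>2\<close> part of a self-dual flag. In a standard basis adapted to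
  the flag only 17 triples can be nonzero, five of them necessarily so; the five are used to clear the other
  twelve by symplectic changes of basis, and a diagonal rescaling turns all but one of them into 1.
  Conversely, the flag of a presented algebra can be read off, so an isomorphism between two presented
  algebras is triangular. Its diagonal entries \<open>a\<^sub>1, \<dots>, a\<^sub>5\<close> satisfy \<open>a\<^sub>3 = a\<^sub>4a\<^sub>5\<close>, \<open>a\<^sub>1 = a\<^sub>2a\<^sub>5 = a\<^sub>3a\<^sub>4\<close> and
  \<open>a\<^sub>1a\<^sub>2a\<^sub>3 = 1\<close>, hence \<open>a\<^sub>4\<^sup>5a\<^sub>5\<^sup>2 = 1\<close>, and \<open>s/r = a\<^sub>4/a\<^sub>5\<^sup>2 = (a\<^sub>4\<^sup>3a\<^sub>5)\<^sup>1\<^sup>2\<close>.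
\<close>

section \<open>Form, product and orthogonal complements\<close>

text \<open>One principle recurs: an alternating form that factors through a quotient of dimension
  one vanishes. The characteristic is arbitrary, so it is alternation and not mere skew-symmetry
  that is used. The principle settles the dimensions of the powers that orthogonality and strict
  descent leave open, and it puts L^5L^2 into L^7. The exponent 12 comes from the diagonal torus.
  With factors k_i on x_i and 1/k_i on y_i, requiring four of the five triples to stay fixed
  determines k1, k2, k3 from k4, k5 and leaves the equation k4^5 k5^2 = 1. As 5 and 2 are coprime,
  its solutions are k4 = t^2, k5 = t^-5 with t = k4^3 k5, and on them the fifth triple is multiplied
  by k4/k5^2 = t^12. Coprimality is also the reason that four triples can be normalized to 1 over
  every field, without extracting roots.\<close>

context symplectic_alternating_algebra
begin

abbreviation smult (infixr "\<cdot>" 75)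
  where "c \<cdot> v \<equiv> scale L c v"

abbreviation prod_mult (infixl "\<odot>" 76)
  where "u \<odot> v \<equiv> mult L u v"

abbreviation pairing ("\<langle>_, _\<rangle>")
  where "\<langle>u, v\<rangle> \<equiv> form L u v"

text \<open>By non-degeneracy this alternating form carries the whole product. Its symmetry moves a
  vector that annihilates much into any slot, which is how most vanishing statements are
  obtained.\<close>

definition tri
  where "tri u v w = \<langle>u \<odot> v, w\<rangle>"

lemma form_add [simp]:
  "\<langle>u + u', v\<rangle> = \<langle>u, v\<rangle> + \<langle>u', v\<rangle>"
  "\<langle>v, u + u'\<rangle> = \<langle>v, u\<rangle> + \<langle>v, u'\<rangle>"
  and form_scale [simp]:
  "\<langle>c \<cdot> u, v\<rangle> = c * \<langle>u, v\<rangle>"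
  "\<langle>v, c \<cdot> u\<rangle> = c * \<langle>v, u\<rangle>"
  using form_linear_left[of v] form_linear_right[of v] by (simp_all add: Vector_Spaces.linear_iff)

lemma mult_add [simp]:
  "(u + u') \<odot> v = u \<odot> v + u' \<odot> v"
  "v \<odot> (u + u') = v \<odot> u + v \<odot> u'"
  and mult_scale [simp]:
  "(c \<cdot> u) \<odot> v = c \<cdot> (u \<odot> v)"
  "v \<odot> (c \<cdot> u) = c \<cdot> (v \<odot> u)"
  using mult_linear_left[of v] mult_linear_right[of v] by (simp_all add: Vector_Spaces.linear_iff)

lemma form_zero [simp]: "\<langle>0, v\<rangle> = 0" "\<langle>v, 0\<rangle> = 0"
  using form_scale[where c = 0 and u = 0 and v = v] by simp_all

lemma mult_zero [simp]: "0 \<odot> v = 0" "v \<odot> 0 = 0"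
  using mult_scale[where c = 0 and u = 0 and v = v] by simp_all

lemma form_minus [simp]: "\<langle>- u, v\<rangle> = - \<langle>u, v\<rangle>" "\<langle>v, - u\<rangle> = - \<langle>v, u\<rangle>"
  using form_scale[where c = "-1"] by simp_all

lemma mult_minus [simp]: "(- u) \<odot> v = - (u \<odot> v)" "v \<odot> (- u) = - (v \<odot> u)"
  using mult_scale[where c = "-1"] by simp_all

lemma form_diff [simp]:
  "\<langle>u - u', v\<rangle> = \<langle>u, v\<rangle> - \<langle>u', v\<rangle>"
  "\<langle>v, u - u'\<rangle> = \<langle>v, u\<rangle> - \<langle>v, u'\<rangle>"
  by (simp_all only: diff_conv_add_uminus form_add form_minus)

lemma mult_diff [simp]:
  "(u - u') \<odot> v = u \<odot> v - u' \<odot> v"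
  "v \<odot> (u - u') = v \<odot> u - v \<odot> u'"
  by (simp_all only: diff_conv_add_uminus mult_add mult_minus)

lemma form_swap: "\<langle>u, v\<rangle> = - \<langle>v, u\<rangle>"
  using form_alternating[of "u + v"] form_alternating[of u] form_alternating[of v]
    by (simp add: eq_neg_iff_add_eq_0 add.commute)

lemma form_eq_0_swap: "\<langle>u, v\<rangle> = 0 \<longleftrightarrow> \<langle>v, u\<rangle> = 0"
  using form_swap[of u v] by simp

lemma mult_swap: "u \<odot> v = - (v \<odot> u)"
  using mult_alternating[of "u + v"] mult_alternating[of u] mult_alternating[of v]
    by (simp add: eq_neg_iff_add_eq_0 add.commute)

lemma tri_add [simp]:
  "tri (u + u') v w = tri u v w + tri u' v w"
  "tri v (u + u') w = tri v u w + tri v u' w"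
  "tri v w (u + u') = tri v w u + tri v w u'"
  and tri_diff [simp]:
  "tri (u - u') v w = tri u v w - tri u' v w"
  "tri v (u - u') w = tri v u w - tri v u' w"
  "tri v w (u - u') = tri v w u - tri v w u'"
  and tri_scale [simp]:
  "tri (c \<cdot> u) v w = c * tri u v w"
  "tri v (c \<cdot> u) w = c * tri v u w"
  "tri v w (c \<cdot> u) = c * tri v w u"
  and tri_minus [simp]:
  "tri (- u) v w = - tri u v w"
  "tri v (- u) w = - tri v u w"
  "tri v w (- u) = - tri v w u"
  by (simp_all add: tri_def)

lemma tri_cyclic: "tri u v w = tri v w u"
  unfolding tri_def by (rule form_mult_cyclic)

lemma tri_swap12: "tri u v w = - tri v u w"
  unfolding tri_def by (subst mult_swap) simp

lemma tri_swap23: "tri u v w = - tri u w v"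
  by (metis tri_cyclic tri_swap12)

lemma tri_swap13: "tri u v w = - tri w v u"
  by (metis tri_cyclic tri_swap12)

lemma tri_same [simp]: "tri u u w = 0" "tri u w u = 0" "tri w u u = 0"
proof -
  show "tri u u w = 0" for u w by (simp add: tri_def mult_alternating)
  then show "tri u w u = 0" "tri w u u = 0" by (metis tri_cyclic)+
qed

lemma mult_eq_0_iff: "u \<odot> v = 0 \<longleftrightarrow> (\<forall>w. tri u v w = 0)"
  unfolding tri_def using form_nondegenerate by auto

text \<open>The dimension theory is relative to a fixed finite basis, while
  \<open>finite_dim\<close> only gives a finite spanning set; hence the choice.\<close>

sublocale finite_dimensional_vector_space "scale L"
  "SOME B. finite B \<and> independent B \<and> span B = UNIV"
proof -
  obtain A where "finite A" "span A = UNIV" using finite_dim by blast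
  moreover obtain B where "B \<subseteq> A" "independent B" "span B = span A"
    using maximal_independent_subset[of A] span_mono span_subspace subspace_span
    by metis
  ultimately have "\<exists>B. finite B \<and> independent B \<and> span B = UNIV"
    by (metis finite_subset)
  then have "finite B \<and> independent B \<and> span B = UNIV"
    if "B = (SOME B. finite B \<and> independent B \<and> span B = UNIV)" for B
    using that by (metis (mono_tags, lifting) someI_ex)
  then show "finite_dimensional_vector_space (scale L)
      (SOME B. finite B \<and> independent B \<and> span B = UNIV)"
    by unfold_locales auto
qed

declare dim_UNIV [simp del]

definition perp :: "'a set \<Rightarrow> 'a set"
  where "perp W = {v. \<forall>w\<in>W. \<langle>w, v\<rangle> = 0}"

lemma subspace_perp: "subspace (perp W)"
  by (rule subspaceI) (auto simp: perp_def)

lemma perp_antimono: "A \<subseteq> B \<Longrightarrow> perp B \<subseteq> perp A"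
  by (auto simp: perp_def)

lemma perpD: "v \<in> perp W \<Longrightarrow> w \<in> W \<Longrightarrow> \<langle>w, v\<rangle> = 0" "v \<in> perp W \<Longrightarrow> w \<in> W \<Longrightarrow> \<langle>v, w\<rangle> = 0"
  unfolding perp_def by (blast, metis (mono_tags, lifting) mem_Collect_eq form_eq_0_swap)

lemma perp_span [simp]: "perp (span W) = perp W"
proof
  show "perp (span W) \<subseteq> perp W" by (intro perp_antimono span_superset)
next
  have "\<langle>w, v\<rangle> = 0" if "v \<in> perp W" "w \<in> span W" for v w
    using that(2) by (induction rule: span_induct_alt) (use that(1) in \<open>auto simp: perp_def\<close>)
  then show "perp W \<subseteq> perp (span W)" by (auto simp: perp_def)
qed

lemma subset_perp_perp: "W \<subseteq> perp (perp W)"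
  using form_eq_0_swap by (auto simp: perp_def)

text \<open>
  One more linear condition lowers the dimension by at most one. Adding a basis of \<open>W\<close> and then its
  completion to a basis of the whole space therefore gives both inequalities of \<open>dim_perp\<close>.
\<close>

lemma dim_perp_Un_le:
  assumes "finite C"
  shows "dim (perp B) \<le> dim (perp (B \<union> C)) + card C"
  using assms
proof (induction C)
  case (insert c C)
  let ?K = "perp (B \<union> C)" and ?K' = "perp (B \<union> insert c C)"
  have "dim ?K \<le> dim ?K' + 1"
  proof (cases "?K \<subseteq> ?K'")
    case True
    then show ?thesis by (meson dim_subset trans_le_add1)
  next
    case False
    then obtain a where a: "a \<in> ?K" "\<langle>c, a\<rangle> \<noteq> 0" by (auto simp: perp_def)
    have "?K \<subseteq> span (insert a ?K')"
    proof
      fix v assume v: "v \<in> ?K"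
      have "v - (\<langle>c, v\<rangle> / \<langle>c, a\<rangle>) \<cdot> a \<in> ?K'"
        using v a by (auto simp: perp_def)
      then show "v \<in> span (insert a ?K')" by (auto simp: span_insert intro: span_base)
    qed
    then have "dim ?K \<le> dim (insert a ?K')" by (rule dim_mono)
    also have "\<dots> \<le> dim ?K' + 1" by (simp add: dim_insert)
    finally show ?thesis .
  qed
  with insert show ?case by simp
qed simp

lemma perp_UNIV: "perp UNIV = {0}"
  using form_nondegenerate form_eq_0_swap by (auto simp: perp_def)

lemma dim_perp:
  assumes "subspace W"
  shows "dim W + dim (perp W) = dim UNIV"
proof -
  obtain B where B: "B \<subseteq> W" "independent B" "W \<subseteq> span B" "card B = dim W"
    using basis_exists by blast
  then have W: "span B = W" using assms span_minimal by blast
  obtain C where C: "B \<subseteq> C" "independent C" "span C = UNIV"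
    using maximal_independent_subset_extend[OF subset_UNIV B(2)] by (metis top.extremum_uniqueI)
  note fin = finiteI_independent[OF B(2)] finiteI_independent[OF C(2)]
  have "dim (UNIV :: 'a set) \<le> dim (perp W) + dim W"
    using dim_perp_Un_le[OF fin(1), of "{}"] B(4) W perp_span[of B] by (simp add: perp_def)
  moreover have "dim (perp W) + dim W \<le> dim (UNIV :: 'a set)"
  proof -
    have "dim (perp B) \<le> dim (perp (B \<union> (C - B))) + card (C - B)"
      by (rule dim_perp_Un_le) (use fin in auto)
    moreover have "perp (B \<union> (C - B)) = {0}"
      using perp_span[of C] C perp_UNIV by (simp add: Un_absorb1)
    moreover have "card (C - B) + card B = card C"
      using C(1) fin by (simp add: card_Diff_subset card_mono)
    moreover have "card C = dim (UNIV :: 'a set)"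
      using dim_span_eq_card_independent[OF C(2)] C(3) by simp
    ultimately show ?thesis using W perp_span[of B] B(4) by simp
  qed
  ultimately show ?thesis by simp
qed

lemma perp_perp:
  assumes "subspace W"
  shows "perp (perp W) = W"
  using dim_perp[OF assms] dim_perp[OF subspace_perp[of W]] subset_perp_perp[of W] assms
  by (metis add_left_cancel add.commute order_refl subspace_dim_equal subspace_perp)

lemma perp_eqI:
  assumes "subspace A" "subspace B" "A \<subseteq> perp B" "dim UNIV \<le> dim A + dim B"
  shows "perp B = A"
proof -
  have "dim (perp B) \<le> dim A" using dim_perp[OF assms(2)] assms(4) by simp
  then show ?thesis using subspace_dim_equal[OF assms(1) subspace_perp assms(3)] by simp
qed

section \<open>The lower central series\<close>

lemma subspace_set_mult [simp]: "subspace (set_mult L A B)"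
  by (simp add: set_mult_def)

lemma set_mult_mono: "A \<subseteq> A' \<Longrightarrow> B \<subseteq> B' \<Longrightarrow> set_mult L A B \<subseteq> set_mult L A' B'"
  unfolding set_mult_def by (intro span_mono) blast

lemma mult_in_set_mult: "a \<in> A \<Longrightarrow> b \<in> B \<Longrightarrow> a \<odot> b \<in> set_mult L A B"
  unfolding set_mult_def by (rule span_base) blast

lemma mult_in_set_mult': "a \<in> A \<Longrightarrow> b \<in> B \<Longrightarrow> b \<odot> a \<in> set_mult L A B"
  using mult_swap[of b a] subspace_neg[OF subspace_set_mult mult_in_set_mult] by metis

lemma set_mult_subset: "subspace V \<Longrightarrow> (\<And>a b. a \<in> A \<Longrightarrow> b \<in> B \<Longrightarrow> a \<odot> b \<in> V) \<Longrightarrow> set_mult L A B \<subseteq> V"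
  unfolding set_mult_def by (rule span_minimal) auto

lemma perp_set_mult: "v \<in> perp (set_mult L A B) \<longleftrightarrow> (\<forall>a\<in>A. \<forall>b\<in>B. tri a b v = 0)"
  unfolding set_mult_def perp_span by (auto simp: perp_def tri_def)

lemma lpow_1 [simp]: "lpow L (Suc 0) = UNIV"
  by (simp add: lpow_def)

lemma lpow_Suc: "lpow L (Suc (Suc k)) = set_mult L (lpow L (Suc k)) UNIV"
  by (simp add: lpow_def)

lemma subspace_lpow: "subspace (lpow L (Suc k))"
  by (cases k) (simp_all add: lpow_Suc)

lemma lpow_Suc_subset: "lpow L (Suc (Suc k)) \<subseteq> lpow L (Suc k)"
  by (induction k) (simp_all add: lpow_Suc set_mult_mono)

lemma lpow_antimono: "k \<le> l \<Longrightarrow> lpow L (Suc l) \<subseteq> lpow L (Suc k)"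
  by (induction rule: dec_induct) (use lpow_Suc_subset in blast)+

lemma subset_perp_iff: "A \<subseteq> perp B \<longleftrightarrow> (\<forall>a\<in>A. \<forall>b\<in>B. \<langle>b, a\<rangle> = 0)"
  by (auto simp: perp_def)

text \<open>Since (bc, a) = -(ac, b), one factor from L can be moved across an orthogonality
  relation.\<close>

lemma subset_perp_set_mult_UNIV: "A \<subseteq> perp (set_mult L B UNIV) \<longleftrightarrow> set_mult L A UNIV \<subseteq> perp B"
proof -
  have swap: "tri b c a = 0 \<longleftrightarrow> tri a c b = 0" for a b c
    using tri_swap13[of b c a] by simp
  have "A \<subseteq> perp (set_mult L B UNIV) \<longleftrightarrow> (\<forall>a\<in>A. \<forall>b\<in>B. \<forall>c. tri b c a = 0)"
    unfolding subset_iff perp_set_mult by auto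
  also have "\<dots> \<longleftrightarrow> (\<forall>b\<in>B. \<forall>a\<in>A. \<forall>c. tri a c b = 0)"
    using swap by (intro iffI ballI allI) (blast dest: swap[THEN iffD1], blast dest: swap[THEN iffD2])
  also have "\<dots> \<longleftrightarrow> B \<subseteq> perp (set_mult L A UNIV)"
    unfolding subset_iff perp_set_mult by auto
  also have "\<dots> \<longleftrightarrow> set_mult L A UNIV \<subseteq> perp B"
    unfolding subset_perp_iff using form_eq_0_swap by blast
  finally show ?thesis .
qed

text \<open>The preceding lemma moves the factors of L^(n+1) one at a time to the other side, until
  that side faces L itself, whose complement is 0.\<close>

lemma lpow_subset_perp_lpow:
  "lpow L (Suc m) \<subseteq> perp (lpow L (Suc n)) \<longleftrightarrow> lpow L (Suc (m + n)) = {0}"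
proof (induction n arbitrary: m)
  case 0
  then show ?case using subspace_0[OF subspace_lpow] by (auto simp: perp_UNIV)
next
  case (Suc n)
  show ?case using Suc[of "Suc m"] subset_perp_set_mult_UNIV by (simp add: lpow_Suc)
qed

text \<open>(uv, w) = -(uw, v), and uw lies in L^(m+2), which is orthogonal to L^(n+1) as soon as
  L^(m+n+2) = 0.\<close>

lemma lpow_mult_lpow_eq_0:
  assumes "lpow L (Suc (Suc (m + n))) = {0}" "u \<in> lpow L (Suc m)" "v \<in> lpow L (Suc n)"
  shows "u \<odot> v = 0"
proof -
  have "v \<in> perp (set_mult L (lpow L (Suc m)) UNIV)"
    using assms lpow_subset_perp_lpow[of n "Suc m"] by (auto simp: lpow_Suc add.commute)
  then have "tri u w v = 0" for w using assms(2) unfolding perp_set_mult by blast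
  then show ?thesis by (metis mult_eq_0_iff neg_equal_0_iff_equal tri_swap23)
qed

lemma lpow_stationary: "lpow L (Suc (Suc k)) = lpow L (Suc k) \<Longrightarrow> lpow L (Suc (k + j)) = lpow L (Suc k)"
  by (induction j) (simp_all add: lpow_Suc)

text \<open>Cyclicity: (zx, w) = (xw, z), so annihilating everything means being orthogonal to all
  products.\<close>

lemma center_eq_perp: "saa_center L = perp (lpow L 2)"
proof -
  have "z \<odot> x = 0 \<longleftrightarrow> (\<forall>w. tri x w z = 0)" for z x
    by (metis mult_eq_0_iff tri_cyclic)
  then show ?thesis
    unfolding saa_center_def numeral_2_eq_2 lpow_Suc by (auto simp: perp_set_mult)
qed

lemma subspace_lpow' [simp]: "0 < k \<Longrightarrow> subspace (lpow L k)"
  by (metis Suc_pred subspace_lpow)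

lemma lpow_mono: "0 < k \<Longrightarrow> k \<le> l \<Longrightarrow> lpow L l \<subseteq> lpow L k"
  using lpow_antimono[of "k - 1" "l - 1"] by simp

lemma lpow_mult:
  assumes "0 < k"
  shows "u \<in> lpow L k \<Longrightarrow> u \<odot> v \<in> lpow L (Suc k)" "u \<in> lpow L k \<Longrightarrow> v \<odot> u \<in> lpow L (Suc k)"
  using lpow_Suc[of "k - 1"] assms by (simp_all add: mult_in_set_mult mult_in_set_mult')

text \<open>Steps of dimension one in the flag are used in this form: modulo the smaller subspace
  only the multiples of one vector remain to be considered.\<close>

lemma subspace_eq_span_insert:
  assumes "subspace V" "subspace W" "V \<subseteq> W" "dim W \<le> dim V + 1" "w \<in> W" "w \<notin> V"
  shows "W = span (insert w V)"
proof -
  have sub: "span (insert w V) \<subseteq> W" using assms by (intro span_minimal) auto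
  have "dim (insert w V) = dim V + 1"
    using assms by (simp add: dim_insert span_eq_iff[THEN iffD2])
  then show ?thesis
    using subspace_dim_equal[OF subspace_span assms(2) sub] assms(4) by simp
qed

lemma obtain_not_in:
  assumes "subspace V" "dim V < dim W"
  obtains w where "w \<in> W" "w \<notin> V"
  using dim_subset[of W V] assms by force

end

section \<open>Dimensions of the lower central series in class 7\<close>

locale P26_algebra = symplectic_alternating_algebra +
  assumes properties: "P26_properties L"
begin

lemma dim_UNIV_10: "dim UNIV = 10"
  using properties by (simp add: P26_properties_def)

lemma lpow_8: "lpow L 8 = {0}" and lpow_7_nonzero: "lpow L 7 \<noteq> {0}"
proof -
  have nil: "\<exists>k. lpow L (k + 1) = {0}" and cl: "(LEAST k. lpow L (k + 1) = {0}) = 7"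
    using properties by (auto simp: P26_properties_def saa_nilpotent_def nilpotence_class_def)
  show "lpow L 8 = {0}" using LeastI_ex[OF nil] unfolding cl by simp
  show "lpow L 7 \<noteq> {0}" using not_less_Least[of 6 "\<lambda>k. lpow L (k + 1) = {0}"] unfolding cl by simp
qed

text \<open>Orthogonality of L^i and L^j amounts to L^(i+j-1) = 0, and the powers vanish from L^8 on
  and not before.\<close>

lemma lpow_orthogonal_iff:
  assumes "0 < i" "0 < j"
  shows "lpow L i \<subseteq> perp (lpow L j) \<longleftrightarrow> 9 \<le> i + j"
proof -
  have "lpow L i \<subseteq> perp (lpow L j) \<longleftrightarrow> lpow L (i + j - 1) = {0}"
    using lpow_subset_perp_lpow[of "i - 1" "j - 1"] assms by (cases i; cases j) simp_all
  also have "\<dots> \<longleftrightarrow> 9 \<le> i + j"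
  proof
    assume *: "lpow L (i + j - 1) = {0}"
    show "9 \<le> i + j"
    proof (rule ccontr)
      assume "\<not> 9 \<le> i + j"
      then have "lpow L 7 \<subseteq> {0}" using lpow_mono[of "i + j - 1" 7] * assms by simp
      then show False using lpow_7_nonzero subspace_0[of "lpow L 7"] by auto
    qed
  next
    assume "9 \<le> i + j"
    then have "lpow L (i + j - 1) \<subseteq> {0}" using lpow_mono[of 8 "i + j - 1"] lpow_8 by simp
    then show "lpow L (i + j - 1) = {0}"
      using subspace_0[of "lpow L (i + j - 1)"] assms by auto
  qed
  finally show ?thesis .
qed

lemma lpow_orthogonal:
  "0 < i \<Longrightarrow> 0 < j \<Longrightarrow> 9 \<le> i + j \<Longrightarrow> u \<in> lpow L i \<Longrightarrow> v \<in> lpow L j \<Longrightarrow> \<langle>u, v\<rangle> = 0"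
  using lpow_orthogonal_iff[of i j] perpD by blast

lemma lpow_mult_eq_0:
  assumes "0 < i" "0 < j" "8 \<le> i + j" "u \<in> lpow L i" "v \<in> lpow L j"
  shows "u \<odot> v = 0"
proof (rule lpow_mult_lpow_eq_0[of "i - 1" "j - 1"])
  have "lpow L (i + j) \<subseteq> {0}" using lpow_mono[of 8 "i + j"] lpow_8 assms by simp
  then show "lpow L (Suc (Suc (i - 1 + (j - 1)))) = {0}"
    using subspace_0[of "lpow L (i + j)"] assms by (cases i; cases j) auto
qed (use assms in auto)

text \<open>A repeated term would make the series constant from there on, and then L^8 = 0 would
  already give L^7 = 0.\<close>

lemma dim_lpow_strict:
  assumes "0 < k" "k < 8"
  shows "dim (lpow L (Suc k)) < dim (lpow L k)"
proof (rule ccontr)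
  assume "\<not> ?thesis"
  then have "lpow L (Suc k) = lpow L k"
    using assms by (intro subspace_dim_equal lpow_mono) auto
  then have "lpow L 8 = lpow L k"
    using lpow_stationary[of "k - 1" "8 - k"] assms by simp
  then have "lpow L 7 \<subseteq> {0}" using lpow_mono[of k 7] assms lpow_8 by simp
  then show False using lpow_7_nonzero subspace_0[of "lpow L 7"] by auto
qed

text \<open>The center is the complement of L^2, so dim L^2 = 8. Apart from L^3, the other
  dimensions are squeezed between strict descent and the orthogonality of L^i and L^(9-i). The two
  values left open by this, 1 for L^7 and 5 for L^4, would create an orthogonality with i + j <
  9.\<close>

lemma perp_lpow_2: "perp (lpow L 2) = lpow L 7"
  and dim_lpow: "dim (lpow L 7) = 2" "dim (lpow L 6) = 3" "dim (lpow L 5) = 4"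
    "dim (lpow L 4) = 6" "dim (lpow L 3) = 7" "dim (lpow L 2) = 8"
proof -
  note dp = dim_perp[OF subspace_lpow', unfolded dim_UNIV_10]
  have dZ: "dim (perp (lpow L 2)) = 2"
    using properties by (simp add: P26_properties_def center_eq_perp)
  then show d2: "dim (lpow L 2) = 8" using dp[of 2] by simp
  obtain a where a: "a \<notin> lpow L 2"
    using obtain_not_in[of "lpow L 2" UNIV] d2 dim_UNIV_10 by force
  have da: "dim (span (insert a (lpow L 2))) = 9"
    using a d2 by (simp add: dim_insert span_eq_iff[THEN iffD2])
  then obtain b where b: "b \<notin> span (insert a (lpow L 2))"
    using obtain_not_in[of "span (insert a (lpow L 2))" UNIV] dim_UNIV_10 by force
  have ab: "UNIV = span (insert b (span (insert a (lpow L 2))))"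
    by (rule subspace_eq_span_insert) (use b da dim_UNIV_10 in auto)
  have decomp: "\<exists>k l s. u = k \<cdot> a + l \<cdot> b + s \<and> s \<in> lpow L 2" for u
  proof -
    have "u \<in> span (insert b (span (insert a (lpow L 2))))" using ab by blast
    then obtain k l where "u - l \<cdot> b - k \<cdot> a \<in> lpow L 2"
      by (auto simp: span_breakdown_eq span_eq_iff[THEN iffD2])
    then show ?thesis by (intro exI[of _ k] exI[of _ l] exI[of _ "u - l \<cdot> b - k \<cdot> a"]) simp
  qed
  \<comment> \<open>Modulo L^3 the product is alternating on the two-dimensional space L/L^2, so its
    values are multiples of ab, and L^2/L^3 has dimension at most one.\<close>
  have "u \<odot> v \<in> span (insert (a \<odot> b) (lpow L 3))" for u v
  proof -
    obtain k l s where u: "u = k \<cdot> a + l \<cdot> b + s" "s \<in> lpow L 2" using decomp by blast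
    obtain k' l' s' where v: "v = k' \<cdot> a + l' \<cdot> b + s'" "s' \<in> lpow L 2" using decomp by blast
    have s: "s \<odot> w \<in> lpow L 3" "w \<odot> s' \<in> lpow L 3" for w
      using lpow_mult[of 2] u v by simp_all
    have "u \<odot> v = (k * l' - l * k') \<cdot> (a \<odot> b) + (s \<odot> v + (k \<cdot> a + l \<cdot> b) \<odot> s')"
      using mult_swap[of b a]
      by (simp add: u v mult_alternating algebra_simps)
    also have "\<dots> \<in> span (insert (a \<odot> b) (lpow L 3))"
    proof (intro span_add span_scale)
      show "s \<odot> v \<in> span (insert (a \<odot> b) (lpow L 3))"
        "(k \<cdot> a + l \<cdot> b) \<odot> s' \<in> span (insert (a \<odot> b) (lpow L 3))"
        using s by (blast intro: span_base)+
    qed (simp add: span_base)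
    finally show ?thesis .
  qed
  then have "lpow L 2 \<subseteq> span (insert (a \<odot> b) (lpow L 3))"
    unfolding numeral_2_eq_2 lpow_Suc by (intro set_mult_subset) auto
  then have "dim (lpow L 2) \<le> dim (insert (a \<odot> b) (lpow L 3))" by (rule dim_mono)
  then show d3: "dim (lpow L 3) = 7"
    using dim_lpow_strict[of 2] d2 dim_insert[of "a \<odot> b" "lpow L 3"] by (auto split: if_splits)
  have sub7: "lpow L 7 \<subseteq> perp (lpow L 2)" using lpow_orthogonal_iff by simp
  have "dim (lpow L 7) \<le> 2" using dim_subset[OF sub7] dZ by simp
  moreover have "dim (lpow L 7) > 0" using dim_lpow_strict[of 7] by simp
  \<comment> \<open>Otherwise the complement W of L^7 is a hyperplane. For z in L^6 the form (uv, z)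
    vanishes when u or v is in W, because zx lies in L^7; being alternating on the line L/W, it is
    0. So L^6 would be orthogonal to L^2, although 6 + 2 < 9.\<close>
  moreover have "dim (lpow L 7) \<noteq> 1"
  proof
    assume d7: "dim (lpow L 7) = 1"
    let ?W = "perp (lpow L 7)"
    have dW: "dim ?W = 9" using dp[of 7] d7 by simp
    then have "dim ?W < dim UNIV" using dim_UNIV_10 by simp
    then obtain c where c: "c \<notin> ?W" using obtain_not_in[OF subspace_perp] by blast
    have cW: "UNIV = span (insert c ?W)"
      by (rule subspace_eq_span_insert) (use c dW dim_UNIV_10 in \<open>auto simp: subspace_perp\<close>)
    have decomp: "\<exists>k w. u = k \<cdot> c + w \<and> w \<in> ?W" for u
    proof -
      have "u \<in> span (insert c ?W)" using cW by blast
      then obtain k where "u - k \<cdot> c \<in> ?W"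
        by (auto simp: span_breakdown_eq span_eq_iff[THEN iffD2] subspace_perp)
      then show ?thesis by (intro exI[of _ k] exI[of _ "u - k \<cdot> c"]) simp
    qed
    have "tri u v z = 0" if z: "z \<in> lpow L 6" for u v z
    proof -
      obtain k w where u: "u = k \<cdot> c + w" "w \<in> ?W" using decomp by blast
      obtain k' w' where v: "v = k' \<cdot> c + w'" "w' \<in> ?W" using decomp by blast
      have "tri z x w = 0" "tri x z w' = 0" for x
        using perpD(1)[OF u(2)] perpD(1)[OF v(2)] lpow_mult[of 6, OF _ z] by (simp_all add: tri_def)
      then have "tri w x z = 0" "tri x w' z = 0" for x
        using tri_swap13[of w x z] tri_cyclic[of z x w'] tri_swap23[of x w' z] by simp_all
      then show ?thesis by (simp add: u v)
    qed
    then have "lpow L 6 \<subseteq> perp (lpow L 2)"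
      unfolding numeral_2_eq_2 lpow_Suc by (auto simp: perp_set_mult)
    then show False using lpow_orthogonal_iff[of 6 2] by simp
  qed
  ultimately show d7: "dim (lpow L 7) = 2" by simp
  have "subspace (lpow L 7)" by simp
  from subspace_dim_equal[OF this subspace_perp sub7] show "perp (lpow L 2) = lpow L 7"
    using dZ d7 by simp
  have sub6: "lpow L 6 \<subseteq> perp (lpow L 3)" and sub5: "lpow L 5 \<subseteq> perp (lpow L 4)"
    using lpow_orthogonal_iff by simp_all
  \<comment> \<open>At most 3, the dimension of the complement of L^3, and more than dim L^7 =
    2.\<close>
  show d6: "dim (lpow L 6) = 3"
    using dim_subset[OF sub6] dp[of 3] d3 dim_lpow_strict[of 6] d7 by simp
  have d54: "dim (lpow L 5) + dim (lpow L 4) \<le> 10" using dim_subset[OF sub5] dp[of 4] by simp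
  have ge: "4 \<le> dim (lpow L 5)" "dim (lpow L 5) < dim (lpow L 4)" "dim (lpow L 4) \<le> 6"
    using dim_lpow_strict[of 5] dim_lpow_strict[of 4] dim_lpow_strict[of 3] d6 d3 by simp_all
  \<comment> \<open>Otherwise L^4/L^5 is a line. The form on L^4 descends to it, as L^5 is
    orthogonal to L^4, so L^4 would be isotropic, although 4 + 4 < 9.\<close>
  have "dim (lpow L 4) \<noteq> 5"
  proof
    assume d4: "dim (lpow L 4) = 5"
    then obtain v where v: "v \<in> lpow L 4" "v \<notin> lpow L 5"
      using obtain_not_in[of "lpow L 5" "lpow L 4"] ge by auto
    have L4: "lpow L 4 = span (insert v (lpow L 5))"
      by (rule subspace_eq_span_insert) (use v ge d4 lpow_mono[of 4 5] in auto)
    have "\<langle>u, w\<rangle> = 0" if u: "u \<in> lpow L 4" and w: "w \<in> lpow L 4" for u w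
    proof -
      have orth: "\<langle>p, q\<rangle> = 0" "\<langle>q, p\<rangle> = 0" if "p \<in> lpow L 4" "q \<in> lpow L 5" for p q
        using lpow_orthogonal[of 4 5] lpow_orthogonal[of 5 4] that by auto
      obtain k where k: "u - k \<cdot> v \<in> lpow L 5"
        using u unfolding L4 by (auto simp: span_breakdown_eq span_eq_iff[THEN iffD2])
      obtain l where l: "w - l \<cdot> v \<in> lpow L 5"
        using w unfolding L4 by (auto simp: span_breakdown_eq span_eq_iff[THEN iffD2])
      have "\<langle>u, w\<rangle> = \<langle>u - k \<cdot> v, w\<rangle> + k * \<langle>v, w - l \<cdot> v\<rangle>"
        by (simp add: form_alternating algebra_simps)
      then show ?thesis using orth(2)[OF w k] orth(1)[OF v(1) l] by simp
    qed
    then have "lpow L 4 \<subseteq> perp (lpow L 4)" by (auto simp: perp_def)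
    then show False using lpow_orthogonal_iff[of 4 4] by simp
  qed
  then show "dim (lpow L 4) = 6" "dim (lpow L 5) = 4" using d54 ge by auto
qed

lemma perp_lpow: "perp (lpow L 3) = lpow L 6" "perp (lpow L 4) = lpow L 5"
  by (rule perp_eqI; simp add: lpow_orthogonal_iff dim_lpow dim_UNIV_10)+

end

context symplectic_alternating_algebra
begin

section \<open>Hyperbolic bases\<close>

text \<open>Ten named vectors instead of two indexed families, so that a change of basis can replace
  single vectors and the simplifier can evaluate every triple. Reversed pairs follow by
  skew-symmetry; independence and, in dimension 10, spanning are derived below.\<close>

definition hyperbolic
  where "hyperbolic x1 x2 x3 x4 x5 y1 y2 y3 y4 y5 \<longleftrightarrow>
    \<langle>x1, x2\<rangle> = 0 \<and> \<langle>x1, x3\<rangle> = 0 \<and> \<langle>x1, x4\<rangle> = 0 \<and> \<langle>x1, x5\<rangle> = 0 \<and>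
    \<langle>y1, y2\<rangle> = 0 \<and> \<langle>y1, y3\<rangle> = 0 \<and> \<langle>y1, y4\<rangle> = 0 \<and> \<langle>y1, y5\<rangle> = 0 \<and>
    \<langle>x1, y1\<rangle> = 1 \<and> \<langle>x1, y2\<rangle> = 0 \<and> \<langle>x1, y3\<rangle> = 0 \<and> \<langle>x1, y4\<rangle> = 0 \<and> \<langle>x1, y5\<rangle> = 0 \<and>
    \<langle>x2, x3\<rangle> = 0 \<and> \<langle>x2, x4\<rangle> = 0 \<and> \<langle>x2, x5\<rangle> = 0 \<and>
    \<langle>y2, y3\<rangle> = 0 \<and> \<langle>y2, y4\<rangle> = 0 \<and> \<langle>y2, y5\<rangle> = 0 \<and>
    \<langle>x2, y1\<rangle> = 0 \<and> \<langle>x2, y2\<rangle> = 1 \<and> \<langle>x2, y3\<rangle> = 0 \<and> \<langle>x2, y4\<rangle> = 0 \<and> \<langle>x2, y5\<rangle> = 0 \<and>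
    \<langle>x3, x4\<rangle> = 0 \<and> \<langle>x3, x5\<rangle> = 0 \<and>
    \<langle>y3, y4\<rangle> = 0 \<and> \<langle>y3, y5\<rangle> = 0 \<and>
    \<langle>x3, y1\<rangle> = 0 \<and> \<langle>x3, y2\<rangle> = 0 \<and> \<langle>x3, y3\<rangle> = 1 \<and> \<langle>x3, y4\<rangle> = 0 \<and> \<langle>x3, y5\<rangle> = 0 \<and>
    \<langle>x4, x5\<rangle> = 0 \<and>
    \<langle>y4, y5\<rangle> = 0 \<and>
    \<langle>x4, y1\<rangle> = 0 \<and> \<langle>x4, y2\<rangle> = 0 \<and> \<langle>x4, y3\<rangle> = 0 \<and> \<langle>x4, y4\<rangle> = 1 \<and> \<langle>x4, y5\<rangle> = 0 \<and>
    \<langle>x5, y1\<rangle> = 0 \<and> \<langle>x5, y2\<rangle> = 0 \<and> \<langle>x5, y3\<rangle> = 0 \<and> \<langle>x5, y4\<rangle> = 0 \<and> \<langle>x5, y5\<rangle> = 1"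

lemma hyperbolic_values:
  assumes "hyperbolic x1 x2 x3 x4 x5 y1 y2 y3 y4 y5"
  shows
    "\<langle>x1, x2\<rangle> = 0" "\<langle>x1, x3\<rangle> = 0" "\<langle>x1, x4\<rangle> = 0"
    "\<langle>x1, x5\<rangle> = 0" "\<langle>y1, y2\<rangle> = 0" "\<langle>y1, y3\<rangle> = 0"
    "\<langle>y1, y4\<rangle> = 0" "\<langle>y1, y5\<rangle> = 0" "\<langle>x1, y1\<rangle> = 1"
    "\<langle>x1, y2\<rangle> = 0" "\<langle>x1, y3\<rangle> = 0" "\<langle>x1, y4\<rangle> = 0"
    "\<langle>x1, y5\<rangle> = 0" "\<langle>x2, x3\<rangle> = 0" "\<langle>x2, x4\<rangle> = 0"
    "\<langle>x2, x5\<rangle> = 0" "\<langle>y2, y3\<rangle> = 0" "\<langle>y2, y4\<rangle> = 0"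
    "\<langle>y2, y5\<rangle> = 0" "\<langle>x2, y1\<rangle> = 0" "\<langle>x2, y2\<rangle> = 1"
    "\<langle>x2, y3\<rangle> = 0" "\<langle>x2, y4\<rangle> = 0" "\<langle>x2, y5\<rangle> = 0"
    "\<langle>x3, x4\<rangle> = 0" "\<langle>x3, x5\<rangle> = 0" "\<langle>y3, y4\<rangle> = 0"
    "\<langle>y3, y5\<rangle> = 0" "\<langle>x3, y1\<rangle> = 0" "\<langle>x3, y2\<rangle> = 0"
    "\<langle>x3, y3\<rangle> = 1" "\<langle>x3, y4\<rangle> = 0" "\<langle>x3, y5\<rangle> = 0"
    "\<langle>x4, x5\<rangle> = 0" "\<langle>y4, y5\<rangle> = 0" "\<langle>x4, y1\<rangle> = 0"
    "\<langle>x4, y2\<rangle> = 0" "\<langle>x4, y3\<rangle> = 0" "\<langle>x4, y4\<rangle> = 1"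
    "\<langle>x4, y5\<rangle> = 0" "\<langle>x5, y1\<rangle> = 0" "\<langle>x5, y2\<rangle> = 0"
    "\<langle>x5, y3\<rangle> = 0" "\<langle>x5, y4\<rangle> = 0" "\<langle>x5, y5\<rangle> = 1"
    and
    "\<langle>x2, x1\<rangle> = 0" "\<langle>x3, x1\<rangle> = 0" "\<langle>x4, x1\<rangle> = 0"
    "\<langle>x5, x1\<rangle> = 0" "\<langle>y2, y1\<rangle> = 0" "\<langle>y3, y1\<rangle> = 0"
    "\<langle>y4, y1\<rangle> = 0" "\<langle>y5, y1\<rangle> = 0" "\<langle>y1, x1\<rangle> = - 1"
    "\<langle>y2, x1\<rangle> = 0" "\<langle>y3, x1\<rangle> = 0" "\<langle>y4, x1\<rangle> = 0"
    "\<langle>y5, x1\<rangle> = 0" "\<langle>x3, x2\<rangle> = 0" "\<langle>x4, x2\<rangle> = 0"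
    "\<langle>x5, x2\<rangle> = 0" "\<langle>y3, y2\<rangle> = 0" "\<langle>y4, y2\<rangle> = 0"
    "\<langle>y5, y2\<rangle> = 0" "\<langle>y1, x2\<rangle> = 0" "\<langle>y2, x2\<rangle> = - 1"
    "\<langle>y3, x2\<rangle> = 0" "\<langle>y4, x2\<rangle> = 0" "\<langle>y5, x2\<rangle> = 0"
    "\<langle>x4, x3\<rangle> = 0" "\<langle>x5, x3\<rangle> = 0" "\<langle>y4, y3\<rangle> = 0"
    "\<langle>y5, y3\<rangle> = 0" "\<langle>y1, x3\<rangle> = 0" "\<langle>y2, x3\<rangle> = 0"
    "\<langle>y3, x3\<rangle> = - 1" "\<langle>y4, x3\<rangle> = 0" "\<langle>y5, x3\<rangle> = 0"
    "\<langle>x5, x4\<rangle> = 0" "\<langle>y5, y4\<rangle> = 0" "\<langle>y1, x4\<rangle> = 0"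
    "\<langle>y2, x4\<rangle> = 0" "\<langle>y3, x4\<rangle> = 0" "\<langle>y4, x4\<rangle> = - 1"
    "\<langle>y5, x4\<rangle> = 0" "\<langle>y1, x5\<rangle> = 0" "\<langle>y2, x5\<rangle> = 0"
    "\<langle>y3, x5\<rangle> = 0" "\<langle>y4, x5\<rangle> = 0" "\<langle>y5, x5\<rangle> = - 1"
  using assms unfolding hyperbolic_def by (auto simp: form_alternating intro!: form_swap[THEN trans])

lemma not_in_span_if_form: "(\<And>a. a \<in> A \<Longrightarrow> \<langle>a, w\<rangle> = 0) \<Longrightarrow> \<langle>b, w\<rangle> \<noteq> 0 \<Longrightarrow> b \<notin> span A"
  using perp_span[of A] perpD(1)[of w "span A" b] by (auto simp: perp_def)

text \<open>Each new vector is separated from the earlier ones by pairing with its dual partner. The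
  cardinality rules out coincidences hidden by the set notation.\<close>

lemma hyperbolic_independent:
  assumes "hyperbolic x1 x2 x3 x4 x5 y1 y2 y3 y4 y5"
  shows "independent {x1, x2, x3, x4, x5, y1, y2, y3, y4, y5}"
    "card {x1, x2, x3, x4, x5, y1, y2, y3, y4, y5} = 10"
proof -
  note [simp] = hyperbolic_values[OF assms] form_alternating
  define ind where "ind A n \<longleftrightarrow> finite A \<and> independent A \<and> card A = n" for A n
  have step: "ind (insert b A) (Suc n)"
    if "ind A n" "\<forall>a\<in>A. \<langle>a, w\<rangle> = 0" "\<langle>b, w\<rangle> \<noteq> 0" for A b w n
  proof -
    have b: "b \<notin> span A" using that not_in_span_if_form by blast
    then have "b \<notin> A" using span_base by blast
    then show ?thesis using that(1) independent_insertI[OF b] by (simp add: ind_def)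
  qed
  have "ind {} 0" by (simp add: ind_def independent_empty)
  note step[OF this, where b = y5 and w = x5, simplified]
  note step[OF this, where b = y4 and w = x4, simplified]
  note step[OF this, where b = y3 and w = x3, simplified]
  note step[OF this, where b = y2 and w = x2, simplified]
  note step[OF this, where b = y1 and w = x1, simplified]
  note step[OF this, where b = x5 and w = y5, simplified]
  note step[OF this, where b = x4 and w = y4, simplified]
  note step[OF this, where b = x3 and w = y3, simplified]
  note step[OF this, where b = x2 and w = y2, simplified]
  note step[OF this, where b = x1 and w = y1, simplified]
  then show "independent {x1, x2, x3, x4, x5, y1, y2, y3, y4, y5}"
    "card {x1, x2, x3, x4, x5, y1, y2, y3, y4, y5} = 10"
    by (simp_all add: ind_def)
qed

lemma hyperbolic_span:
  assumes "hyperbolic x1 x2 x3 x4 x5 y1 y2 y3 y4 y5" "dim UNIV = 10"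
  shows "span {x1, x2, x3, x4, x5, y1, y2, y3, y4, y5} = UNIV"
  using card_ge_dim_independent[OF subset_UNIV hyperbolic_independent(1)[OF assms(1)]]
    hyperbolic_independent(2)[OF assms(1)] assms(2) by auto

lemma eqI_form_span:
  assumes "span B = UNIV" "\<And>b. b \<in> B \<Longrightarrow> \<langle>u, b\<rangle> = \<langle>v, b\<rangle>"
  shows "u = v"
proof -
  have "u - v \<in> perp B" using assms(2) form_eq_0_swap[of "u - v"] by (auto simp: perp_def)
  then have "u - v \<in> perp UNIV" using perp_span[of B] assms(1) by simp
  then show ?thesis by (simp add: perp_UNIV)
qed

text \<open>Coordinates are pairings with the dual partners, with the arguments ordered so that no
  signs occur.\<close>

lemma hyperbolic_expansion:
  assumes "hyperbolic x1 x2 x3 x4 x5 y1 y2 y3 y4 y5" "span {x1, x2, x3, x4, x5, y1, y2, y3, y4, y5} = UNIV"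
  shows "v = \<langle>v, y1\<rangle> \<cdot> x1 + \<langle>v, y2\<rangle> \<cdot> x2 + \<langle>v, y3\<rangle> \<cdot> x3 + \<langle>v, y4\<rangle> \<cdot> x4 + \<langle>v, y5\<rangle> \<cdot> x5 +
    \<langle>x1, v\<rangle> \<cdot> y1 + \<langle>x2, v\<rangle> \<cdot> y2 + \<langle>x3, v\<rangle> \<cdot> y3 + \<langle>x4, v\<rangle> \<cdot> y4 + \<langle>x5, v\<rangle> \<cdot> y5"
proof -
  have "\<langle>x, v\<rangle> = - \<langle>v, x\<rangle>" for x by (rule form_swap)
  then show ?thesis
    by (intro eqI_form_span[OF assms(2)])
      (auto simp: hyperbolic_values[OF assms(1)] form_alternating)
qed

text \<open>Applied with \<open>THEN\<close>, this turns one known triple into rewrite rules for all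
  six orders of its arguments.\<close>

lemma tri_perm:
  assumes "tri u v w = c"
  shows "tri u v w = c" "tri v w u = c" "tri w u v = c" "tri v u w = - c" "tri u w v = - c"
    "tri w v u = - c"
proof -
  show uvw: "tri u v w = c" "tri v w u = c" "tri w u v = c"
    using assms tri_cyclic[of u v w] tri_cyclic[of v w u] by simp_all
  show "tri v u w = - c" "tri u w v = - c" "tri w v u = - c"
    using uvw tri_swap12[of v u w] tri_swap12[of u w v] tri_swap12[of w v u] by simp_all
qed

end

context P26_algebra
begin

section \<open>Bases adapted to the flag\<close>

text \<open>This is \<open>I_1\<close> from the definition of U. It turns out to be a line inside
  L^7, the bottom of the flag.\<close>

definition N where "N = set_mult L (lpow L 5) (lpow L 2)"

lemma subspace_N [simp]: "subspace N"
  by (simp add: N_def)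

lemma N_subset: "N \<subseteq> set_mult L (lpow L 4) (lpow L 3)"
  using properties by (simp add: N_def P26_properties_def)

text \<open>L^5 = <a> + L^6 and L^2 = <b> + L^3, while L^6L^2 and L^5L^3 are 0; so ab spans N. If ab
  were 0, then L^5 would be orthogonal to L^2L = L^3, although 5 + 3 < 9.\<close>

lemma N_line: "\<exists>v. v \<noteq> 0 \<and> N = span {v}"
proof -
  obtain a where a: "a \<in> lpow L 5" "a \<notin> lpow L 6"
    using obtain_not_in[of "lpow L 6" "lpow L 5"] dim_lpow by auto
  obtain b where b: "b \<in> lpow L 2" "b \<notin> lpow L 3"
    using obtain_not_in[of "lpow L 3" "lpow L 2"] dim_lpow by auto
  have L5: "lpow L 5 = span (insert a (lpow L 6))"
    by (rule subspace_eq_span_insert) (use a dim_lpow lpow_mono[of 5 6] in auto)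
  have L2: "lpow L 2 = span (insert b (lpow L 3))"
    by (rule subspace_eq_span_insert) (use b dim_lpow lpow_mono[of 2 3] in auto)
  have prod: "u \<odot> v \<in> span {a \<odot> b}" if u: "u \<in> lpow L 5" and v: "v \<in> lpow L 2" for u v
  proof -
    obtain k where k: "u - k \<cdot> a \<in> lpow L 6"
      using u unfolding L5 by (auto simp: span_breakdown_eq span_eq_iff[THEN iffD2])
    obtain l where l: "v - l \<cdot> b \<in> lpow L 3"
      using v unfolding L2 by (auto simp: span_breakdown_eq span_eq_iff[THEN iffD2])
    have "(u - k \<cdot> a) \<odot> v = 0" "a \<odot> (v - l \<cdot> b) = 0"
      using lpow_mult_eq_0[OF _ _ _ k v] lpow_mult_eq_0[OF _ _ _ a(1) l] by simp_all
    then have "u \<odot> v = (k * l) \<cdot> (a \<odot> b)" by simp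
    then show ?thesis by (simp add: span_scale span_base)
  qed
  have "N \<subseteq> span {a \<odot> b}" unfolding N_def using prod by (intro set_mult_subset) auto
  moreover have "span {a \<odot> b} \<subseteq> N"
    unfolding N_def using a b by (intro span_minimal) (auto intro: mult_in_set_mult)
  moreover have "a \<odot> b \<noteq> 0"
  proof
    assume "a \<odot> b = 0"
    then have *: "u \<odot> v = 0" if "u \<in> lpow L 5" "v \<in> lpow L 2" for u v
      using prod[OF that] by simp
    have "lpow L 5 \<subseteq> perp (lpow L 3)"
    proof
      fix u assume u: "u \<in> lpow L 5"
      have "tri v w u = 0" if "v \<in> lpow L 2" for v w
        using *[OF u that] tri_cyclic[of v w u] tri_cyclic[of w u v] by (simp add: tri_def)
      moreover have "lpow L 3 = set_mult L (lpow L 2) UNIV"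
        using lpow_Suc[of 1] by (simp add: numeral_2_eq_2 numeral_3_eq_3)
      ultimately show "u \<in> perp (lpow L 3)" by (simp add: perp_set_mult)
    qed
    then show False using lpow_orthogonal_iff[of 5 3] by simp
  qed
  ultimately show ?thesis by blast
qed

lemma dim_N: "dim N = 1"
  using N_line dim_singleton by (metis dim_span)

text \<open>L^7 is the complement of L^2. For u in L^5 the form (uv, w) on L^2 factors through the
  line L^2/L^3, because L^5L^3 = 0, and it is alternating.\<close>

lemma N_subset_lpow_7: "N \<subseteq> lpow L 7"
proof -
  have "u \<odot> v \<in> perp (lpow L 2)" if u: "u \<in> lpow L 5" and v: "v \<in> lpow L 2" for u v
  proof -
    obtain b where b: "b \<in> lpow L 2" "b \<notin> lpow L 3"
      using obtain_not_in[of "lpow L 3" "lpow L 2"] dim_lpow by auto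
    have L2: "lpow L 2 = span (insert b (lpow L 3))"
      by (rule subspace_eq_span_insert) (use b dim_lpow lpow_mono[of 2 3] in auto)
    have "tri u v w = 0" if w: "w \<in> lpow L 2" for w
    proof -
      obtain k where k: "v - k \<cdot> b \<in> lpow L 3"
        using v unfolding L2 by (auto simp: span_breakdown_eq span_eq_iff[THEN iffD2])
      obtain l where l: "w - l \<cdot> b \<in> lpow L 3"
        using w unfolding L2 by (auto simp: span_breakdown_eq span_eq_iff[THEN iffD2])
      have zero: "tri u (v - k \<cdot> b) w = 0" "tri u (w - l \<cdot> b) b = 0"
        using lpow_mult_eq_0[OF _ _ _ u k] lpow_mult_eq_0[OF _ _ _ u l] by (simp_all add: tri_def)
      have "tri u v w = tri u (v - k \<cdot> b) w - k * tri u (w - l \<cdot> b) b"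
        using tri_swap23[of u b w] by simp
      then show ?thesis unfolding zero by simp
    qed
    then show ?thesis unfolding perp_def tri_def using form_eq_0_swap by blast
  qed
  then show ?thesis
    unfolding N_def perp_lpow_2[symmetric] by (intro set_mult_subset) (auto simp: subspace_perp)
qed

section \<open>The ideal U and bases adapted to the full flag\<close>

definition U where "U = U_ideal L"

text \<open>As N is nonzero and, by hypothesis, contained in L^4L^3, the index in the definition of
  U is 1.\<close>

lemma mem_U: "u \<in> U \<longleftrightarrow> u \<in> lpow L 4 \<and> (\<forall>w\<in>lpow L 3. u \<odot> w \<in> N)"
proof -
  have "I_ideal L 1 \<inter> set_mult L (lpow L 4) (lpow L 3) \<noteq> {0}"
    using N_subset N_line span_base by (fastforce simp: I_ideal_def N_def)
  then have "U_index L = 1"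
    unfolding U_index_def by (intro Least_equality) auto
  then have "U = {x \<in> lpow L 4. set_mult L {x} (lpow L 3) \<subseteq> N}"
    by (simp add: U_def U_ideal_def I_ideal_def N_def)
  moreover have "set_mult L {x} (lpow L 3) \<subseteq> N \<longleftrightarrow> (\<forall>w\<in>lpow L 3. x \<odot> w \<in> N)" for x
    using set_mult_subset[OF subspace_N, of "{x}" "lpow L 3"] mult_in_set_mult[of x "{x}" _ "lpow L 3"]
    by blast
  ultimately show ?thesis by simp
qed

lemma subspace_U [simp]: "subspace U"
  by (rule subspaceI)
    (auto simp: mem_U subspace_0 subspace_add[of "lpow L 4"] subspace_add[of N]
      subspace_scale[of "lpow L 4"] subspace_scale[of N])

lemma lpow_5_subset_U: "lpow L 5 \<subseteq> U"
  using lpow_mono[of 4 5] lpow_mult_eq_0[of 5 3] subspace_0[OF subspace_N] by (auto simp: mem_U)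

text \<open>L^3 = <y> + L^4 and L^4L^4 = 0, so on L^4 every w from L^3 acts as a multiple of y, with
  one factor for all u.\<close>

lemma mult_lpow_4_line:
  assumes y: "y \<in> lpow L 3" "y \<notin> lpow L 4" and w: "w \<in> lpow L 3"
  shows "\<exists>k. \<forall>u\<in>lpow L 4. u \<odot> w = k \<cdot> (u \<odot> y)"
proof -
  have L3: "lpow L 3 = span (insert y (lpow L 4))"
    by (rule subspace_eq_span_insert) (use y dim_lpow lpow_mono[of 3 4] in auto)
  obtain k where k: "w - k \<cdot> y \<in> lpow L 4"
    using w unfolding L3 by (auto simp: span_breakdown_eq span_eq_iff[THEN iffD2])
  have "u \<odot> w = k \<cdot> (u \<odot> y)" if "u \<in> lpow L 4" for u
    using lpow_mult_eq_0[OF _ _ _ that k] by simp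
  then show ?thesis by blast
qed

text \<open>Such a u annihilates all of L^3, hence is orthogonal to L^3L = L^4, whose complement is
  L^5.\<close>

lemma lpow_4_mult_inj:
  assumes y: "y \<in> lpow L 3" "y \<notin> lpow L 4" and u: "u \<in> lpow L 4" "u \<odot> y = 0"
  shows "u \<in> lpow L 5"
proof -
  have "tri w c u = 0" if w: "w \<in> lpow L 3" for w c
    using mult_lpow_4_line[OF y w] u tri_cyclic[of u w c] tri_cyclic[of c u w] tri_cyclic[of w c u]
    by (auto simp: tri_def)
  then have "u \<in> perp (set_mult L (lpow L 3) UNIV)" by (simp add: perp_set_mult)
  moreover have "set_mult L (lpow L 3) UNIV = lpow L 4"
    using lpow_Suc[of 2] by (simp add: eval_nat_numeral)
  ultimately show ?thesis using perp_lpow by simp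
qed

text \<open>Multiplication by an element y of L^3 outside L^4 embeds U/L^5 into the line N.\<close>

lemma U_eq_span:
  assumes "x \<in> U" "x \<notin> lpow L 5"
  shows "U = span (insert x (lpow L 5))"
proof
  obtain y where y: "y \<in> lpow L 3" "y \<notin> lpow L 4"
    using obtain_not_in[of "lpow L 4" "lpow L 3"] dim_lpow by auto
  obtain v where v: "N = span {v}" using N_line by blast
  have xN: "x \<odot> y \<in> N" "x \<in> lpow L 4" using assms y by (auto simp: mem_U)
  then obtain k where k: "x \<odot> y = k \<cdot> v" unfolding v span_singleton by blast
  have "k \<noteq> 0" using lpow_4_mult_inj[OF y xN(2)] assms k by auto
  show "U \<subseteq> span (insert x (lpow L 5))"
  proof
    fix u assume u: "u \<in> U"
    then have "u \<odot> y \<in> N" "u \<in> lpow L 4" using y by (auto simp: mem_U)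
    then obtain l where l: "u \<odot> y = l \<cdot> v" unfolding v span_singleton by blast
    have "u - (l / k) \<cdot> x \<in> lpow L 5"
      using lpow_4_mult_inj[OF y, of "u - (l / k) \<cdot> x"] k l \<open>k \<noteq> 0\<close> \<open>u \<in> lpow L 4\<close> xN(2)
      by (simp add: subspace_diff subspace_scale)
    then show "u \<in> span (insert x (lpow L 5))"
      unfolding span_breakdown_eq by (blast intro: span_base)
  qed
  show "span (insert x (lpow L 5)) \<subseteq> U"
    using lpow_5_subset_U assms by (intro span_minimal) auto
qed

text \<open>L^4L^3 is the image of L^4 under multiplication by a single y. As it contains N, some x
  in L^4 is sent to a generator of N. This x belongs to U, and not to L^5 because L^5L^3 =
  0.\<close>

lemma U_not_subset: "\<not> U \<subseteq> lpow L 5"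
proof -
  obtain y where y: "y \<in> lpow L 3" "y \<notin> lpow L 4"
    using obtain_not_in[of "lpow L 4" "lpow L 3"] dim_lpow by auto
  obtain v where v: "v \<noteq> 0" "N = span {v}" using N_line by blast
  let ?W = "(\<lambda>u. u \<odot> y) ` lpow L 4"
  have W: "subspace ?W"
  proof (rule subspaceI)
    show "0 \<in> ?W" by (rule image_eqI[of _ _ 0]) (simp_all add: subspace_0)
    show "p + q \<in> ?W" if pq: "p \<in> ?W" "q \<in> ?W" for p q
    proof -
      obtain a b where "a \<in> lpow L 4" "b \<in> lpow L 4" "p = a \<odot> y" "q = b \<odot> y" using pq by blast
      then show ?thesis by (intro image_eqI[of _ _ "a + b"]) (auto simp: subspace_add)
    qed
    show "c \<cdot> p \<in> ?W" if p: "p \<in> ?W" for c p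
    proof -
      obtain a where "a \<in> lpow L 4" "p = a \<odot> y" using p by blast
      then show ?thesis by (intro image_eqI[of _ _ "c \<cdot> a"]) (auto simp: subspace_scale)
    qed
  qed
  have "set_mult L (lpow L 4) (lpow L 3) \<subseteq> ?W"
  proof (rule set_mult_subset[OF W])
    fix a b assume ab: "a \<in> lpow L 4" "b \<in> lpow L 3"
    obtain k where "a \<odot> b = k \<cdot> (a \<odot> y)" using mult_lpow_4_line[OF y ab(2)] ab(1) by blast
    then show "a \<odot> b \<in> ?W" using ab(1) by (simp add: W subspace_scale)
  qed
  then have "v \<in> ?W" using v N_subset span_base[of v "{v}"] by auto
  then obtain x where x: "x \<in> lpow L 4" "v = x \<odot> y" by blast
  have "x \<in> U"
    unfolding mem_U
  proof (intro conjI ballI)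
    fix w assume "w \<in> lpow L 3"
    then obtain k where "x \<odot> w = k \<cdot> v" using mult_lpow_4_line[OF y] x by blast
    then show "x \<odot> w \<in> N" unfolding v(2) by (simp add: span_base span_scale)
  qed fact
  moreover have "x \<notin> lpow L 5" using lpow_mult_eq_0[of 5 3 x y] y(1) x v(1) by auto
  ultimately show ?thesis by blast
qed

text \<open>Each vector sits in its term of the self-dual flag. The terms for \<open>y4\<close> and
  \<open>y5\<close> are the complement of N and the whole space; membership there follows from the
  pairings once N is spanned by \<open>x5\<close>.\<close>

definition adapted
  where "adapted x1 x2 x3 x4 x5 y1 y2 y3 y4 y5 \<longleftrightarrow>
    hyperbolic x1 x2 x3 x4 x5 y1 y2 y3 y4 y5 \<and>
    x5 \<in> N \<and> x4 \<in> lpow L 7 \<and> x3 \<in> lpow L 6 \<and> x2 \<in> lpow L 5 \<and> x1 \<in> U \<and>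
    y1 \<in> lpow L 4 \<and> y2 \<in> lpow L 3 \<and> y3 \<in> lpow L 2"

lemma chain_mono:
  "v \<in> N \<Longrightarrow> v \<in> lpow L 7" "v \<in> lpow L 7 \<Longrightarrow> v \<in> lpow L 6" "v \<in> lpow L 6 \<Longrightarrow> v \<in> lpow L 5"
  "v \<in> lpow L 5 \<Longrightarrow> v \<in> U" "v \<in> U \<Longrightarrow> v \<in> lpow L 4" "v \<in> lpow L 4 \<Longrightarrow> v \<in> lpow L 3"
  "v \<in> lpow L 3 \<Longrightarrow> v \<in> lpow L 2"
  using N_subset_lpow_7 lpow_5_subset_U lpow_mono[of 6 7] lpow_mono[of 5 6] lpow_mono[of 3 4]
    lpow_mono[of 2 3] by (auto simp: mem_U)

lemma obtain_dual:
  assumes "subspace W" "x \<notin> perp W"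
  obtains v where "v \<in> W" "\<langle>x, v\<rangle> = 1"
proof -
  obtain w where w: "w \<in> W" "\<langle>x, w\<rangle> \<noteq> 0"
    using assms(2) form_eq_0_swap by (auto simp: perp_def)
  then show thesis using that[of "(1 / \<langle>x, w\<rangle>) \<cdot> w"] assms(1) by (simp add: subspace_scale)
qed

text \<open>The x_i are chosen along the lower half of the flag; their partners come from the dual
  terms of the upper half and are corrected by a symplectic Gram-Schmidt process. Orthogonality of
  y_i to the x_j with j > i is automatic from the flag.\<close>

lemma adapted_exists: "\<exists>x1 x2 x3 x4 x5 y1 y2 y3 y4 y5. adapted x1 x2 x3 x4 x5 y1 y2 y3 y4 y5"
proof -
  obtain x5 where x5: "x5 \<noteq> 0" "N = span {x5}" using N_line by blast
  obtain x4 where x4: "x4 \<in> lpow L 7" "x4 \<notin> N"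
    using obtain_not_in[of N "lpow L 7"] dim_lpow dim_N by auto
  obtain x3 where x3: "x3 \<in> lpow L 6" "x3 \<notin> lpow L 7"
    using obtain_not_in[of "lpow L 7" "lpow L 6"] dim_lpow by auto
  obtain x2 where x2: "x2 \<in> lpow L 5" "x2 \<notin> lpow L 6"
    using obtain_not_in[of "lpow L 6" "lpow L 5"] dim_lpow by auto
  obtain x1 where x1: "x1 \<in> U" "x1 \<notin> lpow L 5" using U_not_subset by blast
  have xN: "x5 \<in> N" using x5(2) span_base by blast
  have mem: "x1 \<in> lpow L 4" "x2 \<in> lpow L 5" "x3 \<in> lpow L 5" "x4 \<in> lpow L 5" "x5 \<in> lpow L 5"
    "x3 \<in> lpow L 6" "x4 \<in> lpow L 6" "x5 \<in> lpow L 6" "x4 \<in> lpow L 7" "x5 \<in> lpow L 7"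
    using x1 x2 x3 x4 xN chain_mono by meson+
  \<comment> \<open>The complements are L^5, L^6, L^7, N and 0, in each case the flag term just
    below the chosen vector.\<close>
  have "x1 \<notin> perp (lpow L 4)" "x2 \<notin> perp (lpow L 3)" "x3 \<notin> perp (lpow L 2)"
    "x4 \<notin> perp (perp N)" "x5 \<notin> perp UNIV"
    using x1(2) x2(2) x3(2) x4(2) x5(1) perp_perp[OF subspace_N]
    by (auto simp: perp_lpow perp_lpow_2 perp_UNIV)
  note dual = this
  have o54: "\<langle>u, v\<rangle> = 0" "\<langle>v, u\<rangle> = 0" if "u \<in> lpow L 5" "v \<in> lpow L 4" for u v
    using that lpow_orthogonal[of 5 4] lpow_orthogonal[of 4 5] by auto
  have o55: "\<langle>u, v\<rangle> = 0" if "u \<in> lpow L 5" "v \<in> lpow L 5" for u v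
    using that lpow_orthogonal[of 5 5] by auto
  have o63: "\<langle>u, v\<rangle> = 0" "\<langle>v, u\<rangle> = 0" if "u \<in> lpow L 6" "v \<in> lpow L 3" for u v
    using that lpow_orthogonal[of 6 3] lpow_orthogonal[of 3 6] by auto
  have o72: "\<langle>u, v\<rangle> = 0" "\<langle>v, u\<rangle> = 0" if "u \<in> lpow L 7" "v \<in> lpow L 2" for u v
    using that lpow_orthogonal[of 7 2] lpow_orthogonal[of 2 7] by auto
  note x_orth [simp] = o54[OF mem(2) mem(1)] o54[OF mem(3) mem(1)] o54[OF mem(4) mem(1)] o54[OF mem(5) mem(1)]
    o55[OF mem(2) mem(3)] o55[OF mem(2) mem(4)] o55[OF mem(2) mem(5)] o55[OF mem(3) mem(4)]
    o55[OF mem(3) mem(5)] o55[OF mem(4) mem(5)]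
    o55[OF mem(3) mem(2)] o55[OF mem(4) mem(2)] o55[OF mem(5) mem(2)] o55[OF mem(4) mem(3)]
    o55[OF mem(5) mem(3)] o55[OF mem(5) mem(4)] form_alternating
  obtain y1 where y1: "y1 \<in> lpow L 4" "\<langle>x1, y1\<rangle> = 1" using obtain_dual[OF _ dual(1)] by auto
  have y1_orth [simp]: "\<langle>x1, y1\<rangle> = 1" "\<langle>y1, x1\<rangle> = - 1"
    "\<langle>x2, y1\<rangle> = 0" "\<langle>x3, y1\<rangle> = 0" "\<langle>x4, y1\<rangle> = 0" "\<langle>x5, y1\<rangle> = 0"
    "\<langle>y1, x2\<rangle> = 0" "\<langle>y1, x3\<rangle> = 0" "\<langle>y1, x4\<rangle> = 0" "\<langle>y1, x5\<rangle> = 0"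
    using y1 mem o54 form_swap[of y1 x1] by auto
  obtain v2 where v2: "v2 \<in> lpow L 3" "\<langle>x2, v2\<rangle> = 1" using obtain_dual[OF _ dual(2)] by auto
  \<comment> \<open>As (x1, y1) = 1 and (y1, x1) = -1, these coefficients make y2 orthogonal to x1
    and y1. The correction uses vectors from L^4, so it does not leave L^3. The later y_i follow the
    same pattern.\<close>
  define y2 where "y2 = v2 - \<langle>x1, v2\<rangle> \<cdot> y1 + \<langle>y1, v2\<rangle> \<cdot> x1"
  have y2: "y2 \<in> lpow L 3"
    unfolding y2_def using v2 y1 mem chain_mono by (intro subspace_add subspace_diff subspace_scale) auto
  have "\<langle>x1, y2\<rangle> = 0" "\<langle>x2, y2\<rangle> = 1" "\<langle>y1, y2\<rangle> = 0"
    "\<langle>x3, y2\<rangle> = 0" "\<langle>x4, y2\<rangle> = 0" "\<langle>x5, y2\<rangle> = 0"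
    using v2 mem y2 o63 by (simp_all add: y2_def)
  note y2_orth [simp] = this form_swap[of y2 x1, unfolded this] form_swap[of y2 x2, unfolded this]
    form_swap[of y2 y1, unfolded this]
    form_swap[of y2 x3, unfolded this]
    form_swap[of y2 x4, unfolded this]
    form_swap[of y2 x5, unfolded this]
  obtain v3 where v3: "v3 \<in> lpow L 2" "\<langle>x3, v3\<rangle> = 1" using obtain_dual[OF _ dual(3)] by auto
  define y3 where "y3 = v3 - \<langle>x1, v3\<rangle> \<cdot> y1 + \<langle>y1, v3\<rangle> \<cdot> x1 - \<langle>x2, v3\<rangle> \<cdot> y2 + \<langle>y2, v3\<rangle> \<cdot> x2"
  have y3: "y3 \<in> lpow L 2"
    unfolding y3_def using v3 y1 y2 mem chain_mono
    by (intro subspace_add subspace_diff subspace_scale) auto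
  have "\<langle>x1, y3\<rangle> = 0" "\<langle>x2, y3\<rangle> = 0" "\<langle>x3, y3\<rangle> = 1" "\<langle>y1, y3\<rangle> = 0" "\<langle>y2, y3\<rangle> = 0"
    "\<langle>x4, y3\<rangle> = 0" "\<langle>x5, y3\<rangle> = 0"
    using v3 mem y3 o72 by (simp_all add: y3_def)
  note y3_orth [simp] = this form_swap[of y3 x1, unfolded this] form_swap[of y3 x2, unfolded this]
    form_swap[of y3 x3, unfolded this] form_swap[of y3 y1, unfolded this] form_swap[of y3 y2, unfolded this]
    form_swap[of y3 x4, unfolded this]
    form_swap[of y3 x5, unfolded this]
  obtain v4 where v4: "v4 \<in> perp N" "\<langle>x4, v4\<rangle> = 1"
    using obtain_dual[OF subspace_perp dual(4)] by auto
  define y4 where "y4 = v4 - \<langle>x1, v4\<rangle> \<cdot> y1 + \<langle>y1, v4\<rangle> \<cdot> x1 - \<langle>x2, v4\<rangle> \<cdot> y2 + \<langle>y2, v4\<rangle> \<cdot> x2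
    - \<langle>x3, v4\<rangle> \<cdot> y3 + \<langle>y3, v4\<rangle> \<cdot> x3"
  have "\<langle>x1, y4\<rangle> = 0" "\<langle>x2, y4\<rangle> = 0" "\<langle>x3, y4\<rangle> = 0" "\<langle>x4, y4\<rangle> = 1"
    "\<langle>y1, y4\<rangle> = 0" "\<langle>y2, y4\<rangle> = 0" "\<langle>y3, y4\<rangle> = 0" "\<langle>x5, y4\<rangle> = 0"
    using v4 perpD(1)[OF v4(1) xN] by (simp_all add: y4_def)
  note y4_orth [simp] = this form_swap[of y4 x1, unfolded this] form_swap[of y4 x2, unfolded this]
    form_swap[of y4 x3, unfolded this] form_swap[of y4 x4, unfolded this] form_swap[of y4 y1, unfolded this]
    form_swap[of y4 y2, unfolded this] form_swap[of y4 y3, unfolded this]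
    form_swap[of y4 x5, unfolded this]
  obtain v5 where v5: "\<langle>x5, v5\<rangle> = 1" using obtain_dual[OF subspace_UNIV dual(5)] by auto
  define y5 where "y5 = v5 - \<langle>x1, v5\<rangle> \<cdot> y1 + \<langle>y1, v5\<rangle> \<cdot> x1 - \<langle>x2, v5\<rangle> \<cdot> y2 + \<langle>y2, v5\<rangle> \<cdot> x2
    - \<langle>x3, v5\<rangle> \<cdot> y3 + \<langle>y3, v5\<rangle> \<cdot> x3 - \<langle>x4, v5\<rangle> \<cdot> y4 + \<langle>y4, v5\<rangle> \<cdot> x4"
  have "\<langle>x1, y5\<rangle> = 0" "\<langle>x2, y5\<rangle> = 0" "\<langle>x3, y5\<rangle> = 0" "\<langle>x4, y5\<rangle> = 0" "\<langle>x5, y5\<rangle> = 1"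
    "\<langle>y1, y5\<rangle> = 0" "\<langle>y2, y5\<rangle> = 0" "\<langle>y3, y5\<rangle> = 0" "\<langle>y4, y5\<rangle> = 0"
    using v5 by (simp_all add: y5_def)
  then have "hyperbolic x1 x2 x3 x4 x5 y1 y2 y3 y4 y5" by (simp add: hyperbolic_def)
  then show ?thesis
    unfolding adapted_def using xN mem x1(1) y1(1) y2 y3 by blast
qed

lemma N_eq_span: "v \<in> N \<Longrightarrow> v \<noteq> 0 \<Longrightarrow> N = span {v}"
  using subspace_dim_equal[OF subspace_span subspace_N, of "{v}"] dim_N span_minimal[of "{v}" N]
  by simp

lemma adapted_N_eq_span: "adapted x1 x2 x3 x4 x5 y1 y2 y3 y4 y5 \<Longrightarrow> N = span {x5}"
proof -
  assume "adapted x1 x2 x3 x4 x5 y1 y2 y3 y4 y5"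
  then have "\<langle>x5, y5\<rangle> = 1" and x5: "x5 \<in> N" by (simp_all add: adapted_def hyperbolic_def)
  then have "x5 \<noteq> 0" by auto
  with x5 show "N = span {x5}" by (rule N_eq_span)
qed

text \<open>Two sources: L^iL^j = 0 for i + j >= 8, and the products x2y3 and x1y2 lie in N = <x5>,
  which pairs nontrivially with y5 only among the basis vectors. Up to order, 17 triples
  survive.\<close>

lemma adapted_tri_0:
  assumes "adapted x1 x2 x3 x4 x5 y1 y2 y3 y4 y5"
  shows "tri x4 u v = 0" "tri x5 u v = 0"
    "tri x3 x1 v = 0" "tri x3 x2 v = 0" "tri x3 y1 v = 0" "tri x3 y2 v = 0" "tri x3 y3 v = 0"
    "tri x2 x1 v = 0" "tri x2 y1 v = 0" "tri x2 y2 v = 0" "tri x1 y1 v = 0"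
    "tri x2 y3 y4 = 0" "tri x1 y2 y3 = 0" "tri x1 y2 y4 = 0"
proof -
  have a: "hyperbolic x1 x2 x3 x4 x5 y1 y2 y3 y4 y5"
    "x5 \<in> N" "x4 \<in> lpow L 7" "x3 \<in> lpow L 6" "x2 \<in> lpow L 5" "x1 \<in> U"
    "y1 \<in> lpow L 4" "y2 \<in> lpow L 3" "y3 \<in> lpow L 2"
    using assms unfolding adapted_def by auto
  note form = hyperbolic_values[OF a(1)]
  have mem: "x1 \<in> lpow L 4" "x1 \<in> lpow L 3" "x1 \<in> lpow L 2" "x2 \<in> lpow L 2" "y1 \<in> lpow L 3"
    "y1 \<in> lpow L 2" "y2 \<in> lpow L 2" "x5 \<in> lpow L 7"
    using a(2-9) chain_mono by meson+
  show "tri x4 u v = 0" "tri x5 u v = 0"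
    using lpow_mult_eq_0[of 7 1] a(3) mem(8) by (simp_all add: tri_def)
  show "tri x3 x1 v = 0" "tri x3 x2 v = 0" "tri x3 y1 v = 0" "tri x3 y2 v = 0" "tri x3 y3 v = 0"
    using lpow_mult_eq_0[of 6 2] a mem by (simp_all add: tri_def)
  show "tri x2 x1 v = 0" "tri x2 y1 v = 0" "tri x2 y2 v = 0"
    using lpow_mult_eq_0[of 5 3] a mem by (simp_all add: tri_def)
  show "tri x1 y1 v = 0"
    using lpow_mult_eq_0[of 4 4] a mem by (simp_all add: tri_def)
  have N: "\<langle>u, y3\<rangle> = 0" "\<langle>u, y4\<rangle> = 0" if "u \<in> N" for u
    using that form adapted_N_eq_span[OF assms] by (auto simp: span_singleton)
  have "x2 \<odot> y3 \<in> N" unfolding N_def using a by (blast intro: mult_in_set_mult)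
  moreover have "x1 \<odot> y2 \<in> N" using a by (simp add: mem_U)
  ultimately show "tri x2 y3 y4 = 0" "tri x1 y2 y3 = 0" "tri x1 y2 y4 = 0"
    using N by (simp_all add: tri_def)
qed

lemma adapted_expansion:
  assumes "adapted x1 x2 x3 x4 x5 y1 y2 y3 y4 y5"
  shows "v = \<langle>v, y1\<rangle> \<cdot> x1 + \<langle>v, y2\<rangle> \<cdot> x2 + \<langle>v, y3\<rangle> \<cdot> x3 + \<langle>v, y4\<rangle> \<cdot> x4 + \<langle>v, y5\<rangle> \<cdot> x5 +
    \<langle>x1, v\<rangle> \<cdot> y1 + \<langle>x2, v\<rangle> \<cdot> y2 + \<langle>x3, v\<rangle> \<cdot> y3 + \<langle>x4, v\<rangle> \<cdot> y4 + \<langle>x5, v\<rangle> \<cdot> y5"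
  using assms hyperbolic_expansion hyperbolic_span dim_UNIV_10 unfolding adapted_def by metis

text \<open>If one of them vanished, this would, in the order of the statement, put x3 into L^7,
  kill N, put x1 into L^5, force UL^2 into N, or force L^4L^3 = L^7.\<close>

lemma adapted_tri_nonzero:
  assumes "adapted x1 x2 x3 x4 x5 y1 y2 y3 y4 y5"
  shows "tri x3 y4 y5 \<noteq> 0" "tri x2 y3 y5 \<noteq> 0" "tri x1 y2 y5 \<noteq> 0" "tri x1 y3 y4 \<noteq> 0" "tri y1 y2 y3 \<noteq> 0"
proof -
  have a: "hyperbolic x1 x2 x3 x4 x5 y1 y2 y3 y4 y5"
    "x5 \<in> N" "x4 \<in> lpow L 7" "x3 \<in> lpow L 6" "x2 \<in> lpow L 5" "x1 \<in> U"
    "y1 \<in> lpow L 4" "y2 \<in> lpow L 3" "y3 \<in> lpow L 2"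
    using assms unfolding adapted_def by auto
  note form = hyperbolic_values[OF a(1)]
  note zero = adapted_tri_0[OF assms]
  note zero' = zero zero[THEN tri_perm(2)] zero[THEN tri_perm(3)] zero[THEN tri_perm(4)]
    zero[THEN tri_perm(5)] zero[THEN tri_perm(6)]
  note expansion = adapted_expansion[OF assms]
  have mem: "x1 \<in> lpow L 4" "x5 \<in> lpow L 7" "x4 \<in> lpow L 5" "x5 \<in> lpow L 5" "x3 \<in> lpow L 5"
    using a(2-9) chain_mono by meson+
  have notin: "x3 \<notin> lpow L 7" "x1 \<notin> lpow L 5" "y1 \<notin> lpow L 5" "y2 \<notin> lpow L 4" "y3 \<notin> lpow L 3"
    "x2 \<notin> lpow L 6"
    using lpow_orthogonal[of 7 2 x3 y3] lpow_orthogonal[of 5 4 x1 y1] lpow_orthogonal[of 5 4 y1 x1]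
      lpow_orthogonal[of 5 4 x2 y2] lpow_orthogonal[of 6 3 x3 y3] lpow_orthogonal[of 6 3 x2 y2] a mem form
    by auto
  note N = adapted_N_eq_span[OF assms]
  have "\<langle>x5, y5\<rangle> = 1" using form by simp
  then have x5: "x5 \<noteq> 0" by auto
  have product: "u \<odot> v = tri u v y1 \<cdot> x1 + tri u v y2 \<cdot> x2 + tri u v y3 \<cdot> x3 + tri u v y4 \<cdot> x4 +
    tri u v y5 \<cdot> x5
      - tri u v x1 \<cdot> y1 - tri u v x2 \<cdot> y2 - tri u v x3 \<cdot> y3 - tri u v x4 \<cdot> y4 - tri u v x5 \<cdot> y5" for u v
    using expansion[of "u \<odot> v"] form_swap[of _ "u \<odot> v"] unfolding tri_def by simp
  show "tri x3 y4 y5 \<noteq> 0"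
  proof
    assume "tri x3 y4 y5 = 0"
    note p = this[THEN tri_perm(2)] this[THEN tri_perm(6)]
    have "tri u v x3 = 0" for u v
      by (subst expansion[of u], subst expansion[of v]) (simp add: zero' p)
    then have "x3 \<in> perp (lpow L 2)"
      using lpow_Suc[of 0] by (simp add: numeral_2_eq_2 perp_set_mult)
    then show False using notin by (simp add: perp_lpow_2)
  qed
  show "tri x1 y2 y5 \<noteq> 0"
  proof
    assume "tri x1 y2 y5 = 0"
    then have "x1 \<odot> y2 = 0" by (subst product) (simp add: zero')
    then show False using lpow_4_mult_inj[OF a(8) notin(4) mem(1)] notin by simp
  qed
  have L5: "lpow L 5 = span (insert x2 (lpow L 6))"
    by (rule subspace_eq_span_insert) (use a notin dim_lpow lpow_mono[of 5 6] in auto)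
  have L4: "lpow L 4 = span (insert y1 U)"
  proof (rule subspace_eq_span_insert)
    show "U \<subseteq> lpow L 4" using chain_mono by blast
    have "dim (insert x1 (lpow L 5)) = 5" using dim_lpow notin
      by (simp add: dim_insert span_eq_iff[THEN iffD2])
    then show "dim (lpow L 4) \<le> dim U + 1" using U_eq_span[OF a(6) notin(2)] dim_lpow by simp
    show "y1 \<notin> U"
    proof
      assume "y1 \<in> U"
      then obtain k where k: "y1 - k \<cdot> x1 \<in> lpow L 5"
        unfolding U_eq_span[OF a(6) notin(2)] by (auto simp: span_breakdown_eq span_eq_iff[THEN iffD2])
      then have "\<langle>y1 - k \<cdot> x1, x1\<rangle> = 0" using lpow_orthogonal[of 5 4 "y1 - k \<cdot> x1" x1] mem(1) by simp
      then show False using form by (simp add: form_alternating)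
    qed
  qed (use a in auto)
  have L2: "lpow L 2 = span (insert y3 (lpow L 3))"
    by (rule subspace_eq_span_insert) (use a notin dim_lpow lpow_mono[of 2 3] in auto)
  show "tri x2 y3 y5 \<noteq> 0"
  proof
    assume "tri x2 y3 y5 = 0"
    then have x2y3: "x2 \<odot> y3 = 0" by (subst product) (simp add: zero')
    have "u \<odot> v = 0" if u: "u \<in> lpow L 5" and v: "v \<in> lpow L 2" for u v
    proof -
      obtain k where k: "u - k \<cdot> x2 \<in> lpow L 6"
        using u unfolding L5 by (auto simp: span_breakdown_eq span_eq_iff[THEN iffD2])
      obtain l where l: "v - l \<cdot> y3 \<in> lpow L 3"
        using v unfolding L2 by (auto simp: span_breakdown_eq span_eq_iff[THEN iffD2])
      have "(u - k \<cdot> x2) \<odot> v = 0" "x2 \<odot> (v - l \<cdot> y3) = 0"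
        using lpow_mult_eq_0[OF _ _ _ k v] lpow_mult_eq_0[OF _ _ _ a(5) l] by simp_all
      then show "u \<odot> v = 0" using x2y3 by simp
    qed
    then have "N \<subseteq> {0}" unfolding N_def by (intro set_mult_subset) auto
    then show False using a(2) x5 by auto
  qed
  show "tri x1 y3 y4 \<noteq> 0"
  proof
    assume "tri x1 y3 y4 = 0"
    then have "x1 \<odot> y3 = tri x1 y3 y5 \<cdot> x5" by (subst product) (simp add: zero')
    then have x1y3: "x1 \<odot> y3 \<in> N" using a(2) by (simp add: subspace_scale)
    \<comment> \<open>U = <x1> + L^5 and L^2 = <y3> + L^3, and both L^5L^2 and UL^3 are in N anyway;
      so x1y3 decides.\<close>
    have "u \<odot> v \<in> N" if u: "u \<in> U" and v: "v \<in> lpow L 2" for u v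
    proof -
      obtain k where k: "u - k \<cdot> x1 \<in> lpow L 5"
        using u unfolding U_eq_span[OF a(6) notin(2)]
          by (auto simp: span_breakdown_eq span_eq_iff[THEN iffD2])
      obtain l where l: "v - l \<cdot> y3 \<in> lpow L 3"
        using v unfolding L2 by (auto simp: span_breakdown_eq span_eq_iff[THEN iffD2])
      have "(u - k \<cdot> x1) \<odot> v \<in> N" unfolding N_def using k v by (rule mult_in_set_mult)
      moreover have "x1 \<odot> (v - l \<cdot> y3) \<in> N" using a(6) l unfolding mem_U by blast
      moreover have "u \<odot> v = (u - k \<cdot> x1) \<odot> v + k \<cdot> (x1 \<odot> (v - l \<cdot> y3)) + (k * l) \<cdot> (x1 \<odot> y3)"
        by (simp add: scale_right_diff_distrib)
      ultimately show "u \<odot> v \<in> N" using x1y3 by (metis subspace_N subspace_add subspace_scale)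
    qed
    then have "set_mult L U (lpow L 2) \<subseteq> N" by (intro set_mult_subset) auto
    then have "dim (set_mult L U (lpow L 2)) \<le> 1" using dim_subset dim_N by metis
    then show False using properties by (simp add: P26_properties_def U_def)
  qed
  show "tri y1 y2 y3 \<noteq> 0"
  proof
    assume "tri y1 y2 y3 = 0"
    then have y12: "y1 \<odot> y2 = tri y1 y2 y4 \<cdot> x4 + tri y1 y2 y5 \<cdot> x5"
      by (subst product) (simp add: zero')
    then have y12': "y1 \<odot> y2 \<in> lpow L 7" using a(3) mem by (simp add: subspace_add subspace_scale)
    \<comment> \<open>Otherwise y2 annihilates some combination y1 - m x1, which then lies in L^5
      and is orthogonal to x1, contrary to (y1, x1) = -1.\<close>
    have "y1 \<odot> y2 \<notin> N"
    proof
      assume "y1 \<odot> y2 \<in> N"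
      then obtain l where l: "y1 \<odot> y2 = l \<cdot> x5" unfolding N span_singleton by blast
      have "x1 \<odot> y2 \<in> N" using a by (simp add: mem_U)
      then obtain k where k: "x1 \<odot> y2 = k \<cdot> x5" unfolding N span_singleton by blast
      have "k \<noteq> 0" using lpow_4_mult_inj[OF a(8) notin(4) mem(1)] notin k by auto
      then have "y1 - (l / k) \<cdot> x1 \<in> lpow L 5"
        using lpow_4_mult_inj[OF a(8) notin(4), of "y1 - (l / k) \<cdot> x1"] a mem l k
        by (simp add: subspace_diff subspace_scale)
      then have "\<langle>y1 - (l / k) \<cdot> x1, x1\<rangle> = 0"
        using lpow_orthogonal[of 5 4 "y1 - (l / k) \<cdot> x1" x1] mem(1) by simp
      then show False using form by (simp add: form_alternating)
    qed
    then have L7: "lpow L 7 = span (insert (y1 \<odot> y2) N)"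
      by (intro subspace_eq_span_insert) (use y12' dim_lpow dim_N N_subset_lpow_7 in auto)
    have "lpow L 7 \<subseteq> set_mult L (lpow L 4) (lpow L 3)"
      unfolding L7 using N_subset a by (intro span_minimal) (auto intro: mult_in_set_mult)
    moreover have "set_mult L (lpow L 4) (lpow L 3) \<subseteq> lpow L 7"
    proof (rule set_mult_subset)
      fix u v assume u: "u \<in> lpow L 4" and v: "v \<in> lpow L 3"
      obtain k where k: "u - k \<cdot> y1 \<in> U"
        using u unfolding L4 by (auto simp: span_breakdown_eq span_eq_iff[THEN iffD2])
      obtain l where l: "y1 \<odot> v = l \<cdot> (y1 \<odot> y2)" using mult_lpow_4_line[OF a(8) notin(4) v] a(7) by blast
      have "(u - k \<cdot> y1) \<odot> v \<in> lpow L 7" using k v N_subset_lpow_7 unfolding mem_U by blast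
      then have "(u - k \<cdot> y1) \<odot> v + (k * l) \<cdot> (y1 \<odot> y2) \<in> lpow L 7"
        using y12' by (intro subspace_add subspace_scale) auto
      then show "u \<odot> v \<in> lpow L 7" by (simp add: l)
    qed simp
    ultimately have "set_mult L (lpow L 4) (lpow L 3) = lpow L 7" by (rule subset_antisym[rotated])
    then show False using properties by (simp add: P26_properties_def)
  qed
qed

lemma adapted_mem:
  assumes "adapted x1 x2 x3 x4 x5 y1 y2 y3 y4 y5"
  shows "x5 \<in> N" "x5 \<in> lpow L 7" "x4 \<in> lpow L 7" "x3 \<in> lpow L 6" "x4 \<in> lpow L 6" "x5 \<in> lpow L 6"
    "x2 \<in> lpow L 5" "x3 \<in> lpow L 5" "x1 \<in> U" "x2 \<in> U" "x3 \<in> U" "x4 \<in> U" "y1 \<in> lpow L 4"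
    "x1 \<in> lpow L 4" "x2 \<in> lpow L 4" "x3 \<in> lpow L 4" "y2 \<in> lpow L 3" "y1 \<in> lpow L 3"
    "x1 \<in> lpow L 3" "x2 \<in> lpow L 3" "x3 \<in> lpow L 3" "y3 \<in> lpow L 2" "y1 \<in> lpow L 2"
    "y2 \<in> lpow L 2" "x1 \<in> lpow L 2" "x2 \<in> lpow L 2" "x3 \<in> lpow L 2"
  using assms chain_mono unfolding adapted_def by meson+

section \<open>Clearing twelve triples by elementary symplectic changes of basis\<close>

lemmas adapted_tri_0_perm = adapted_tri_0 adapted_tri_0[THEN tri_perm(2)] adapted_tri_0[THEN tri_perm(3)]
  adapted_tri_0[THEN tri_perm(4)] adapted_tri_0[THEN tri_perm(5)] adapted_tri_0[THEN tri_perm(6)]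

text \<open>
  The triples that are cleared one by one, in this order: the change of basis in step \<open>n\<close> may disturb
  the later triples but not the earlier ones.
\<close>

definition coefficients
  where "coefficients x1 x2 x3 x4 x5 y1 y2 y3 y4 y5 = [tri y1 y3 y4,
    tri y1 y2 y4,
    tri y1 y2 y5,
    tri x2 y4 y5,
    tri x1 y3 y5,
    tri x1 y4 y5,
    tri y1 y3 y5,
    tri y1 y4 y5,
    tri y2 y3 y4,
    tri y2 y3 y5,
    tri y2 y4 y5,
    tri y3 y4 y5]"

definition reduced
  where "reduced n x1 x2 x3 x4 x5 y1 y2 y3 y4 y5 \<longleftrightarrow>
    adapted x1 x2 x3 x4 x5 y1 y2 y3 y4 y5 \<and> (\<forall>c\<in>set (take n (coefficients x1 x2 x3 x4 x5 y1 y2 y3 y4 y5)). c = 0)"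

text \<open>Up to the sign of t, the twelve steps use three kinds of changes: y_i + t x_i alone; y_j
  + t y_i together with x_i - t x_j; y_i + t x_j together with y_j + t x_i. Each adds t times a
  pivot, one of the five nonzero triples, to the triple to be cleared. That the pivots stay nonzero
  follows from adaptedness alone.\<close>

lemma reduced_1:
  assumes "reduced 0 x1 x2 x3 x4 x5 y1 y2 y3 y4 y5"
  shows "\<exists>x1 x2 x3 x4 x5 y1 y2 y3 y4 y5. reduced 1 x1 x2 x3 x4 x5 y1 y2 y3 y4 y5"
proof -
  define t where "t = - tri y1 y3 y4 / tri x1 y3 y4"
  have a: "adapted x1 x2 x3 x4 x5 y1 y2 y3 y4 y5"
    and c: "\<forall>c\<in>set (take 0 (coefficients x1 x2 x3 x4 x5 y1 y2 y3 y4 y5)). c = 0"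
    using assms by (simp_all add: reduced_def)
  note self = refl[of "tri x3 y4 y5"] refl[of "tri x2 y3 y5"] refl[of "tri x1 y2 y5"]
    refl[of "tri x1 y3 y4"] refl[of "tri y1 y2 y3"]
  note perms = adapted_tri_0_perm[OF a] self[THEN tri_perm(2)] self[THEN tri_perm(3)]
    self[THEN tri_perm(4)] self[THEN tri_perm(5)] self[THEN tri_perm(6)]
  have "hyperbolic x1 x2 x3 x4 x5 y1 y2 y3 y4 y5" using a by (simp add: adapted_def)
  note form = hyperbolic_values[OF this] form_alternating
  have "adapted x1 x2 x3 x4 x5 (y1 + t \<cdot> x1) y2 y3 y4 y5"
    unfolding adapted_def hyperbolic_def
    by (simp add: form adapted_mem[OF a] subspace_add subspace_diff subspace_scale)
  moreover have "tri y1 y3 y4 = - t * tri x1 y3 y4"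
    using adapted_tri_nonzero[OF a] by (simp add: t_def)
  ultimately have "reduced 1 x1 x2 x3 x4 x5 (y1 + t \<cdot> x1) y2 y3 y4 y5"
    using c by (simp add: reduced_def coefficients_def perms)
  then show ?thesis by blast
qed

lemma reduced_2:
  assumes "reduced 1 x1 x2 x3 x4 x5 y1 y2 y3 y4 y5"
  shows "\<exists>x1 x2 x3 x4 x5 y1 y2 y3 y4 y5. reduced 2 x1 x2 x3 x4 x5 y1 y2 y3 y4 y5"
proof -
  define t where "t = - tri y1 y2 y4 / tri y1 y2 y3"
  have a: "adapted x1 x2 x3 x4 x5 y1 y2 y3 y4 y5"
    and c: "\<forall>c\<in>set (take 1 (coefficients x1 x2 x3 x4 x5 y1 y2 y3 y4 y5)). c = 0"
    using assms by (simp_all add: reduced_def)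
  note self = refl[of "tri x3 y4 y5"] refl[of "tri x2 y3 y5"] refl[of "tri x1 y2 y5"]
    refl[of "tri x1 y3 y4"] refl[of "tri y1 y2 y3"]
  note perms = adapted_tri_0_perm[OF a] self[THEN tri_perm(2)] self[THEN tri_perm(3)]
    self[THEN tri_perm(4)] self[THEN tri_perm(5)] self[THEN tri_perm(6)]
  have "hyperbolic x1 x2 x3 x4 x5 y1 y2 y3 y4 y5" using a by (simp add: adapted_def)
  note form = hyperbolic_values[OF this] form_alternating
  have "adapted x1 x2 (x3 - t \<cdot> x4) x4 x5 y1 y2 y3 (y4 + t \<cdot> y3) y5"
    unfolding adapted_def hyperbolic_def
    by (simp add: form adapted_mem[OF a] subspace_add subspace_diff subspace_scale)
  moreover have "tri y1 y2 y4 = - t * tri y1 y2 y3"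
    using adapted_tri_nonzero[OF a] by (simp add: t_def)
  ultimately have "reduced 2 x1 x2 (x3 - t \<cdot> x4) x4 x5 y1 y2 y3 (y4 + t \<cdot> y3) y5"
    using c by (simp add: reduced_def coefficients_def perms)
  then show ?thesis by blast
qed

lemma reduced_3:
  assumes "reduced 2 x1 x2 x3 x4 x5 y1 y2 y3 y4 y5"
  shows "\<exists>x1 x2 x3 x4 x5 y1 y2 y3 y4 y5. reduced 3 x1 x2 x3 x4 x5 y1 y2 y3 y4 y5"
proof -
  define t where "t = - tri y1 y2 y5 / tri y1 y2 y3"
  have a: "adapted x1 x2 x3 x4 x5 y1 y2 y3 y4 y5"
    and c: "\<forall>c\<in>set (take 2 (coefficients x1 x2 x3 x4 x5 y1 y2 y3 y4 y5)). c = 0"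
    using assms by (simp_all add: reduced_def)
  note self = refl[of "tri x3 y4 y5"] refl[of "tri x2 y3 y5"] refl[of "tri x1 y2 y5"]
    refl[of "tri x1 y3 y4"] refl[of "tri y1 y2 y3"]
  note perms = adapted_tri_0_perm[OF a] self[THEN tri_perm(2)] self[THEN tri_perm(3)]
    self[THEN tri_perm(4)] self[THEN tri_perm(5)] self[THEN tri_perm(6)]
  have "hyperbolic x1 x2 x3 x4 x5 y1 y2 y3 y4 y5" using a by (simp add: adapted_def)
  note form = hyperbolic_values[OF this] form_alternating
  have "adapted x1 x2 (x3 - t \<cdot> x5) x4 x5 y1 y2 y3 y4 (y5 + t \<cdot> y3)"
    unfolding adapted_def hyperbolic_def
    by (simp add: form adapted_mem[OF a] subspace_add subspace_diff subspace_scale)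
  moreover have "tri y1 y2 y5 = - t * tri y1 y2 y3"
    using adapted_tri_nonzero[OF a] by (simp add: t_def)
  ultimately have "reduced 3 x1 x2 (x3 - t \<cdot> x5) x4 x5 y1 y2 y3 y4 (y5 + t \<cdot> y3)"
    using c by (simp add: reduced_def coefficients_def perms)
  then show ?thesis by blast
qed

text \<open>The order matters here: y3 - t y2 changes (y1y3, y4) by -t (y1y2, y4), which is 0 since
  the second step.\<close>

lemma reduced_4:
  assumes "reduced 3 x1 x2 x3 x4 x5 y1 y2 y3 y4 y5"
  shows "\<exists>x1 x2 x3 x4 x5 y1 y2 y3 y4 y5. reduced 4 x1 x2 x3 x4 x5 y1 y2 y3 y4 y5"
proof -
  define t where "t = - tri x2 y4 y5 / tri x3 y4 y5"
  have a: "adapted x1 x2 x3 x4 x5 y1 y2 y3 y4 y5"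
    and c: "\<forall>c\<in>set (take 3 (coefficients x1 x2 x3 x4 x5 y1 y2 y3 y4 y5)). c = 0"
    using assms by (simp_all add: reduced_def)
  note self = refl[of "tri x3 y4 y5"] refl[of "tri x2 y3 y5"] refl[of "tri x1 y2 y5"]
    refl[of "tri x1 y3 y4"] refl[of "tri y1 y2 y3"]
  note perms = adapted_tri_0_perm[OF a] self[THEN tri_perm(2)] self[THEN tri_perm(3)]
    self[THEN tri_perm(4)] self[THEN tri_perm(5)] self[THEN tri_perm(6)]
  have "hyperbolic x1 x2 x3 x4 x5 y1 y2 y3 y4 y5" using a by (simp add: adapted_def)
  note form = hyperbolic_values[OF this] form_alternating
  have "adapted x1 (x2 + t \<cdot> x3) x3 x4 x5 y1 y2 (y3 - t \<cdot> y2) y4 y5"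
    unfolding adapted_def hyperbolic_def
    by (simp add: form adapted_mem[OF a] subspace_add subspace_diff subspace_scale)
  moreover have "tri x2 y4 y5 = - t * tri x3 y4 y5"
    using adapted_tri_nonzero[OF a] by (simp add: t_def)
  ultimately have "reduced 4 x1 (x2 + t \<cdot> x3) x3 x4 x5 y1 y2 (y3 - t \<cdot> y2) y4 y5"
    using c by (simp add: reduced_def coefficients_def perms)
  then show ?thesis by blast
qed

text \<open>Again the second step is used: (y1y2, y5) changes by t (y1y2, y4) = 0.\<close>

lemma reduced_5:
  assumes "reduced 4 x1 x2 x3 x4 x5 y1 y2 y3 y4 y5"
  shows "\<exists>x1 x2 x3 x4 x5 y1 y2 y3 y4 y5. reduced 5 x1 x2 x3 x4 x5 y1 y2 y3 y4 y5"
proof -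
  define t where "t = - tri x1 y3 y5 / tri x1 y3 y4"
  have a: "adapted x1 x2 x3 x4 x5 y1 y2 y3 y4 y5"
    and c: "\<forall>c\<in>set (take 4 (coefficients x1 x2 x3 x4 x5 y1 y2 y3 y4 y5)). c = 0"
    using assms by (simp_all add: reduced_def)
  note self = refl[of "tri x3 y4 y5"] refl[of "tri x2 y3 y5"] refl[of "tri x1 y2 y5"]
    refl[of "tri x1 y3 y4"] refl[of "tri y1 y2 y3"]
  note perms = adapted_tri_0_perm[OF a] self[THEN tri_perm(2)] self[THEN tri_perm(3)]
    self[THEN tri_perm(4)] self[THEN tri_perm(5)] self[THEN tri_perm(6)]
  have "hyperbolic x1 x2 x3 x4 x5 y1 y2 y3 y4 y5" using a by (simp add: adapted_def)
  note form = hyperbolic_values[OF this] form_alternating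
  have "adapted x1 x2 x3 (x4 - t \<cdot> x5) x5 y1 y2 y3 y4 (y5 + t \<cdot> y4)"
    unfolding adapted_def hyperbolic_def
    by (simp add: form adapted_mem[OF a] subspace_add subspace_diff subspace_scale)
  moreover have "tri x1 y3 y5 = - t * tri x1 y3 y4"
    using adapted_tri_nonzero[OF a] by (simp add: t_def)
  ultimately have "reduced 5 x1 x2 x3 (x4 - t \<cdot> x5) x5 y1 y2 y3 y4 (y5 + t \<cdot> y4)"
    using c by (simp add: reduced_def coefficients_def perms)
  then show ?thesis by blast
qed

lemma reduced_6:
  assumes "reduced 5 x1 x2 x3 x4 x5 y1 y2 y3 y4 y5"
  shows "\<exists>x1 x2 x3 x4 x5 y1 y2 y3 y4 y5. reduced 6 x1 x2 x3 x4 x5 y1 y2 y3 y4 y5"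
proof -
  define t where "t = - tri x1 y4 y5 / tri x3 y4 y5"
  have a: "adapted x1 x2 x3 x4 x5 y1 y2 y3 y4 y5"
    and c: "\<forall>c\<in>set (take 5 (coefficients x1 x2 x3 x4 x5 y1 y2 y3 y4 y5)). c = 0"
    using assms by (simp_all add: reduced_def)
  note self = refl[of "tri x3 y4 y5"] refl[of "tri x2 y3 y5"] refl[of "tri x1 y2 y5"]
    refl[of "tri x1 y3 y4"] refl[of "tri y1 y2 y3"]
  note perms = adapted_tri_0_perm[OF a] self[THEN tri_perm(2)] self[THEN tri_perm(3)]
    self[THEN tri_perm(4)] self[THEN tri_perm(5)] self[THEN tri_perm(6)]
  have "hyperbolic x1 x2 x3 x4 x5 y1 y2 y3 y4 y5" using a by (simp add: adapted_def)
  note form = hyperbolic_values[OF this] form_alternating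
  have "adapted (x1 + t \<cdot> x3) x2 x3 x4 x5 y1 y2 (y3 - t \<cdot> y1) y4 y5"
    unfolding adapted_def hyperbolic_def
    by (simp add: form adapted_mem[OF a] subspace_add subspace_diff subspace_scale)
  moreover have "tri x1 y4 y5 = - t * tri x3 y4 y5"
    using adapted_tri_nonzero[OF a] by (simp add: t_def)
  ultimately have "reduced 6 (x1 + t \<cdot> x3) x2 x3 x4 x5 y1 y2 (y3 - t \<cdot> y1) y4 y5"
    using c by (simp add: reduced_def coefficients_def perms)
  then show ?thesis by blast
qed

text \<open>The change of y2 restores (y1, y2) = 0. The cleared triples containing y1 and y2 survive
  because x2y2, y1x1 and x2x1 are 0.\<close>

lemma reduced_7:
  assumes "reduced 6 x1 x2 x3 x4 x5 y1 y2 y3 y4 y5"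
  shows "\<exists>x1 x2 x3 x4 x5 y1 y2 y3 y4 y5. reduced 7 x1 x2 x3 x4 x5 y1 y2 y3 y4 y5"
proof -
  define t where "t = - tri y1 y3 y5 / tri x2 y3 y5"
  have a: "adapted x1 x2 x3 x4 x5 y1 y2 y3 y4 y5"
    and c: "\<forall>c\<in>set (take 6 (coefficients x1 x2 x3 x4 x5 y1 y2 y3 y4 y5)). c = 0"
    using assms by (simp_all add: reduced_def)
  note self = refl[of "tri x3 y4 y5"] refl[of "tri x2 y3 y5"] refl[of "tri x1 y2 y5"]
    refl[of "tri x1 y3 y4"] refl[of "tri y1 y2 y3"]
  note perms = adapted_tri_0_perm[OF a] self[THEN tri_perm(2)] self[THEN tri_perm(3)]
    self[THEN tri_perm(4)] self[THEN tri_perm(5)] self[THEN tri_perm(6)]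
  have "hyperbolic x1 x2 x3 x4 x5 y1 y2 y3 y4 y5" using a by (simp add: adapted_def)
  note form = hyperbolic_values[OF this] form_alternating
  have "adapted x1 x2 x3 x4 x5 (y1 + t \<cdot> x2) (y2 + t \<cdot> x1) y3 y4 y5"
    unfolding adapted_def hyperbolic_def
    by (simp add: form adapted_mem[OF a] subspace_add subspace_diff subspace_scale)
  moreover have "tri y1 y3 y5 = - t * tri x2 y3 y5"
    using adapted_tri_nonzero[OF a] by (simp add: t_def)
  ultimately have "reduced 7 x1 x2 x3 x4 x5 (y1 + t \<cdot> x2) (y2 + t \<cdot> x1) y3 y4 y5"
    using c by (simp add: reduced_def coefficients_def perms)
  then show ?thesis by blast
qed

lemma reduced_8:
  assumes "reduced 7 x1 x2 x3 x4 x5 y1 y2 y3 y4 y5"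
  shows "\<exists>x1 x2 x3 x4 x5 y1 y2 y3 y4 y5. reduced 8 x1 x2 x3 x4 x5 y1 y2 y3 y4 y5"
proof -
  define t where "t = - tri y1 y4 y5 / tri x3 y4 y5"
  have a: "adapted x1 x2 x3 x4 x5 y1 y2 y3 y4 y5"
    and c: "\<forall>c\<in>set (take 7 (coefficients x1 x2 x3 x4 x5 y1 y2 y3 y4 y5)). c = 0"
    using assms by (simp_all add: reduced_def)
  note self = refl[of "tri x3 y4 y5"] refl[of "tri x2 y3 y5"] refl[of "tri x1 y2 y5"]
    refl[of "tri x1 y3 y4"] refl[of "tri y1 y2 y3"]
  note perms = adapted_tri_0_perm[OF a] self[THEN tri_perm(2)] self[THEN tri_perm(3)]
    self[THEN tri_perm(4)] self[THEN tri_perm(5)] self[THEN tri_perm(6)]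
  have "hyperbolic x1 x2 x3 x4 x5 y1 y2 y3 y4 y5" using a by (simp add: adapted_def)
  note form = hyperbolic_values[OF this] form_alternating
  have "adapted x1 x2 x3 x4 x5 (y1 + t \<cdot> x3) y2 (y3 + t \<cdot> x1) y4 y5"
    unfolding adapted_def hyperbolic_def
    by (simp add: form adapted_mem[OF a] subspace_add subspace_diff subspace_scale)
  moreover have "tri y1 y4 y5 = - t * tri x3 y4 y5"
    using adapted_tri_nonzero[OF a] by (simp add: t_def)
  ultimately have "reduced 8 x1 x2 x3 x4 x5 (y1 + t \<cdot> x3) y2 (y3 + t \<cdot> x1) y4 y5"
    using c by (simp add: reduced_def coefficients_def perms)
  then show ?thesis by blast
qed

text \<open>The pivot (y1y2, y3) is reached cyclically, as (y2y3, y1). The cleared (x1y4, y5) and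
  (x2y4, y5) survive because x1 and x2 annihilate y1.\<close>

lemma reduced_9:
  assumes "reduced 8 x1 x2 x3 x4 x5 y1 y2 y3 y4 y5"
  shows "\<exists>x1 x2 x3 x4 x5 y1 y2 y3 y4 y5. reduced 9 x1 x2 x3 x4 x5 y1 y2 y3 y4 y5"
proof -
  define t where "t = - tri y2 y3 y4 / tri y1 y2 y3"
  have a: "adapted x1 x2 x3 x4 x5 y1 y2 y3 y4 y5"
    and c: "\<forall>c\<in>set (take 8 (coefficients x1 x2 x3 x4 x5 y1 y2 y3 y4 y5)). c = 0"
    using assms by (simp_all add: reduced_def)
  note self = refl[of "tri x3 y4 y5"] refl[of "tri x2 y3 y5"] refl[of "tri x1 y2 y5"]
    refl[of "tri x1 y3 y4"] refl[of "tri y1 y2 y3"]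
  note perms = adapted_tri_0_perm[OF a] self[THEN tri_perm(2)] self[THEN tri_perm(3)]
    self[THEN tri_perm(4)] self[THEN tri_perm(5)] self[THEN tri_perm(6)]
  have "hyperbolic x1 x2 x3 x4 x5 y1 y2 y3 y4 y5" using a by (simp add: adapted_def)
  note form = hyperbolic_values[OF this] form_alternating
  have "adapted (x1 - t \<cdot> x4) x2 x3 x4 x5 y1 y2 y3 (y4 + t \<cdot> y1) y5"
    unfolding adapted_def hyperbolic_def
    by (simp add: form adapted_mem[OF a] subspace_add subspace_diff subspace_scale)
  moreover have "tri y2 y3 y4 = - t * tri y1 y2 y3"
    using adapted_tri_nonzero[OF a] by (simp add: t_def)
  ultimately have "reduced 9 (x1 - t \<cdot> x4) x2 x3 x4 x5 y1 y2 y3 (y4 + t \<cdot> y1) y5"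
    using c by (simp add: reduced_def coefficients_def perms)
  then show ?thesis by blast
qed

lemma reduced_10:
  assumes "reduced 9 x1 x2 x3 x4 x5 y1 y2 y3 y4 y5"
  shows "\<exists>x1 x2 x3 x4 x5 y1 y2 y3 y4 y5. reduced 10 x1 x2 x3 x4 x5 y1 y2 y3 y4 y5"
proof -
  define t where "t = - tri y2 y3 y5 / tri x2 y3 y5"
  have a: "adapted x1 x2 x3 x4 x5 y1 y2 y3 y4 y5"
    and c: "\<forall>c\<in>set (take 9 (coefficients x1 x2 x3 x4 x5 y1 y2 y3 y4 y5)). c = 0"
    using assms by (simp_all add: reduced_def)
  note self = refl[of "tri x3 y4 y5"] refl[of "tri x2 y3 y5"] refl[of "tri x1 y2 y5"]
    refl[of "tri x1 y3 y4"] refl[of "tri y1 y2 y3"]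
  note perms = adapted_tri_0_perm[OF a] self[THEN tri_perm(2)] self[THEN tri_perm(3)]
    self[THEN tri_perm(4)] self[THEN tri_perm(5)] self[THEN tri_perm(6)]
  have "hyperbolic x1 x2 x3 x4 x5 y1 y2 y3 y4 y5" using a by (simp add: adapted_def)
  note form = hyperbolic_values[OF this] form_alternating
  have "adapted x1 x2 x3 x4 x5 y1 (y2 + t \<cdot> x2) y3 y4 y5"
    unfolding adapted_def hyperbolic_def
    by (simp add: form adapted_mem[OF a] subspace_add subspace_diff subspace_scale)
  moreover have "tri y2 y3 y5 = - t * tri x2 y3 y5"
    using adapted_tri_nonzero[OF a] by (simp add: t_def)
  ultimately have "reduced 10 x1 x2 x3 x4 x5 y1 (y2 + t \<cdot> x2) y3 y4 y5"
    using c by (simp add: reduced_def coefficients_def perms)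
  then show ?thesis by blast
qed

lemma reduced_11:
  assumes "reduced 10 x1 x2 x3 x4 x5 y1 y2 y3 y4 y5"
  shows "\<exists>x1 x2 x3 x4 x5 y1 y2 y3 y4 y5. reduced 11 x1 x2 x3 x4 x5 y1 y2 y3 y4 y5"
proof -
  define t where "t = - tri y2 y4 y5 / tri x3 y4 y5"
  have a: "adapted x1 x2 x3 x4 x5 y1 y2 y3 y4 y5"
    and c: "\<forall>c\<in>set (take 10 (coefficients x1 x2 x3 x4 x5 y1 y2 y3 y4 y5)). c = 0"
    using assms by (simp_all add: reduced_def)
  note self = refl[of "tri x3 y4 y5"] refl[of "tri x2 y3 y5"] refl[of "tri x1 y2 y5"]
    refl[of "tri x1 y3 y4"] refl[of "tri y1 y2 y3"]
  note perms = adapted_tri_0_perm[OF a] self[THEN tri_perm(2)] self[THEN tri_perm(3)]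
    self[THEN tri_perm(4)] self[THEN tri_perm(5)] self[THEN tri_perm(6)]
  have "hyperbolic x1 x2 x3 x4 x5 y1 y2 y3 y4 y5" using a by (simp add: adapted_def)
  note form = hyperbolic_values[OF this] form_alternating
  have "adapted x1 x2 x3 x4 x5 y1 (y2 + t \<cdot> x3) (y3 + t \<cdot> x2) y4 y5"
    unfolding adapted_def hyperbolic_def
    by (simp add: form adapted_mem[OF a] subspace_add subspace_diff subspace_scale)
  moreover have "tri y2 y4 y5 = - t * tri x3 y4 y5"
    using adapted_tri_nonzero[OF a] by (simp add: t_def)
  ultimately have "reduced 11 x1 x2 x3 x4 x5 y1 (y2 + t \<cdot> x3) (y3 + t \<cdot> x2) y4 y5"
    using c by (simp add: reduced_def coefficients_def perms)
  then show ?thesis by blast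
qed

lemma reduced_12:
  assumes "reduced 11 x1 x2 x3 x4 x5 y1 y2 y3 y4 y5"
  shows "\<exists>x1 x2 x3 x4 x5 y1 y2 y3 y4 y5. reduced 12 x1 x2 x3 x4 x5 y1 y2 y3 y4 y5"
proof -
  define t where "t = - tri y3 y4 y5 / tri x3 y4 y5"
  have a: "adapted x1 x2 x3 x4 x5 y1 y2 y3 y4 y5"
    and c: "\<forall>c\<in>set (take 11 (coefficients x1 x2 x3 x4 x5 y1 y2 y3 y4 y5)). c = 0"
    using assms by (simp_all add: reduced_def)
  note self = refl[of "tri x3 y4 y5"] refl[of "tri x2 y3 y5"] refl[of "tri x1 y2 y5"]
    refl[of "tri x1 y3 y4"] refl[of "tri y1 y2 y3"]
  note perms = adapted_tri_0_perm[OF a] self[THEN tri_perm(2)] self[THEN tri_perm(3)]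
    self[THEN tri_perm(4)] self[THEN tri_perm(5)] self[THEN tri_perm(6)]
  have "hyperbolic x1 x2 x3 x4 x5 y1 y2 y3 y4 y5" using a by (simp add: adapted_def)
  note form = hyperbolic_values[OF this] form_alternating
  have "adapted x1 x2 x3 x4 x5 y1 y2 (y3 + t \<cdot> x3) y4 y5"
    unfolding adapted_def hyperbolic_def
    by (simp add: form adapted_mem[OF a] subspace_add subspace_diff subspace_scale)
  moreover have "tri y3 y4 y5 = - t * tri x3 y4 y5"
    using adapted_tri_nonzero[OF a] by (simp add: t_def)
  ultimately have "reduced 12 x1 x2 x3 x4 x5 y1 y2 (y3 + t \<cdot> x3) y4 y5"
    using c by (simp add: reduced_def coefficients_def perms)
  then show ?thesis by blast
qed

end

context symplectic_alternating_algebra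
begin

section \<open>Algebras with a presentation\<close>

text \<open>
  The vanishing of \<open>tri\<close> required here leaves only five essentially different nonzero triples, with
  values \<open>a, b, c, d, e\<close>; the presentation of the theorem is the case \<open>1, r, 1, 1, 1\<close>.
\<close>

definition presentation_basis
  where "presentation_basis a b c d e x1 x2 x3 x4 x5 y1 y2 y3 y4 y5 \<longleftrightarrow>
    dim UNIV = 10 \<and> hyperbolic x1 x2 x3 x4 x5 y1 y2 y3 y4 y5 \<and>
    (\<forall>u v. tri x4 u v = 0 \<and> tri x5 u v = 0) \<and>
    (\<forall>v. tri x3 x1 v = 0 \<and> tri x3 x2 v = 0 \<and> tri x3 y1 v = 0 \<and> tri x3 y2 v = 0 \<and> tri x3 y3 v = 0 \<and>
      tri x2 x1 v = 0 \<and> tri x2 y1 v = 0 \<and> tri x2 y2 v = 0 \<and> tri x1 y1 v = 0) \<and>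
    tri x2 y3 y4 = 0 \<and> tri x1 y2 y3 = 0 \<and> tri x1 y2 y4 = 0 \<and>
    tri y1 y3 y4 = 0 \<and> tri y1 y2 y4 = 0 \<and> tri y1 y2 y5 = 0 \<and> tri x2 y4 y5 = 0 \<and>
    tri x1 y3 y5 = 0 \<and> tri x1 y4 y5 = 0 \<and> tri y1 y3 y5 = 0 \<and> tri y1 y4 y5 = 0 \<and>
    tri y2 y3 y4 = 0 \<and> tri y2 y3 y5 = 0 \<and> tri y2 y4 y5 = 0 \<and> tri y3 y4 y5 = 0 \<and>
    tri x3 y4 y5 = a \<and> tri x2 y3 y5 = b \<and> tri x1 y2 y5 = c \<and> tri x1 y3 y4 = d \<and> tri y1 y2 y3 = e"

lemma presentation_basis_tri:
  assumes "presentation_basis a b c d e x1 x2 x3 x4 x5 y1 y2 y3 y4 y5"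
  shows "tri x4 u v = 0" "tri x5 u v = 0"
    "tri x3 x1 v = 0" "tri x3 x2 v = 0" "tri x3 y1 v = 0" "tri x3 y2 v = 0" "tri x3 y3 v = 0"
    "tri x2 x1 v = 0" "tri x2 y1 v = 0" "tri x2 y2 v = 0" "tri x1 y1 v = 0"
    "tri x2 y3 y4 = 0" "tri x1 y2 y3 = 0" "tri x1 y2 y4 = 0"
    "tri y1 y3 y4 = 0" "tri y1 y2 y4 = 0" "tri y1 y2 y5 = 0" "tri x2 y4 y5 = 0" "tri x1 y3 y5 = 0"
    "tri x1 y4 y5 = 0" "tri y1 y3 y5 = 0" "tri y1 y4 y5 = 0" "tri y2 y3 y4 = 0" "tri y2 y3 y5 = 0"
    "tri y2 y4 y5 = 0" "tri y3 y4 y5 = 0"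
    "tri x3 y4 y5 = a" "tri x2 y3 y5 = b" "tri x1 y2 y5 = c" "tri x1 y3 y4 = d" "tri y1 y2 y3 = e"
  using assms unfolding presentation_basis_def by simp_all

lemmas presentation_basis_tri_perm = presentation_basis_tri
  presentation_basis_tri[THEN tri_perm(2)] presentation_basis_tri[THEN tri_perm(3)]
  presentation_basis_tri[THEN tri_perm(4)] presentation_basis_tri[THEN tri_perm(5)]
  presentation_basis_tri[THEN tri_perm(6)]

text \<open>The change of basis is a diagonal symplectic matrix, and every triple is multiplied by a
  character of this torus.\<close>

lemma presentation_basis_rescale:
  assumes "presentation_basis a b c d e x1 x2 x3 x4 x5 y1 y2 y3 y4 y5" "k1 \<noteq> 0" "k2 \<noteq> 0" "k3 \<noteq> 0" "k4 \<noteq> 0"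
    "k5 \<noteq> 0"
  shows "presentation_basis (k3 / (k4 * k5) * a) (k2 / (k3 * k5) * b) (k1 / (k2 * k5) * c)
    (k1 / (k3 * k4) * d) (1 / (k1 * k2 * k3) * e)
    (k1 \<cdot> x1) (k2 \<cdot> x2) (k3 \<cdot> x3) (k4 \<cdot> x4) (k5 \<cdot> x5)
    ((1 / k1) \<cdot> y1) ((1 / k2) \<cdot> y2) ((1 / k3) \<cdot> y3) ((1 / k4) \<cdot> y4) ((1 / k5) \<cdot> y5)"
  using assms by (simp add: presentation_basis_def hyperbolic_def)

lemma presentation_basis_expansion:
  assumes "presentation_basis a b c d e x1 x2 x3 x4 x5 y1 y2 y3 y4 y5"
  shows "v = \<langle>v, y1\<rangle> \<cdot> x1 + \<langle>v, y2\<rangle> \<cdot> x2 + \<langle>v, y3\<rangle> \<cdot> x3 + \<langle>v, y4\<rangle> \<cdot> x4 + \<langle>v, y5\<rangle> \<cdot> x5 +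
    \<langle>x1, v\<rangle> \<cdot> y1 + \<langle>x2, v\<rangle> \<cdot> y2 + \<langle>x3, v\<rangle> \<cdot> y3 + \<langle>x4, v\<rangle> \<cdot> y4 + \<langle>x5, v\<rangle> \<cdot> y5"
  using assms hyperbolic_expansion[OF _ hyperbolic_span] unfolding presentation_basis_def by blast

abbreviation "P26_basis r \<equiv> presentation_basis 1 r 1 1 1"

text \<open>By bilinearity each value is a sum of 2 x 2 minors of the coordinates of u and v, one
  for every nonzero triple that contains the third vector.\<close>

lemma P26_basis_tri_formula:
  assumes "P26_basis r x1 x2 x3 x4 x5 y1 y2 y3 y4 y5"
  shows
    "tri u v y1 = (\<langle>x2, u\<rangle> * \<langle>x3, v\<rangle> - \<langle>x3, u\<rangle> * \<langle>x2, v\<rangle>)"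
    "tri u v y2 = (- (\<langle>x1, u\<rangle> * \<langle>x3, v\<rangle> - \<langle>x3, u\<rangle> * \<langle>x1, v\<rangle>) - (\<langle>u, y1\<rangle> * \<langle>x5, v\<rangle> - \<langle>x5, u\<rangle> * \<langle>v, y1\<rangle>))"
    "tri u v y3 = ((\<langle>x1, u\<rangle> * \<langle>x2, v\<rangle> - \<langle>x2, u\<rangle> * \<langle>x1, v\<rangle>) - r * (\<langle>u, y2\<rangle> * \<langle>x5, v\<rangle> - \<langle>x5, u\<rangle> * \<langle>v, y2\<rangle>) -
    (\<langle>u, y1\<rangle> * \<langle>x4, v\<rangle> - \<langle>x4, u\<rangle> * \<langle>v, y1\<rangle>))"
    "tri u v y4 = ((\<langle>u, y1\<rangle> * \<langle>x3, v\<rangle> - \<langle>x3, u\<rangle> * \<langle>v, y1\<rangle>) - (\<langle>u, y3\<rangle> * \<langle>x5, v\<rangle> - \<langle>x5, u\<rangle> * \<langle>v, y3\<rangle>))"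
    "tri u v y5 = (r * (\<langle>u, y2\<rangle> * \<langle>x3, v\<rangle> - \<langle>x3, u\<rangle> * \<langle>v, y2\<rangle>) + (\<langle>u, y3\<rangle> * \<langle>x4, v\<rangle> - \<langle>x4, u\<rangle> * \<langle>v, y3\<rangle>) +
    (\<langle>u, y1\<rangle> * \<langle>x2, v\<rangle> - \<langle>x2, u\<rangle> * \<langle>v, y1\<rangle>))"
    "tri u v x1 = (\<langle>x2, u\<rangle> * \<langle>x5, v\<rangle> - \<langle>x5, u\<rangle> * \<langle>x2, v\<rangle>) + (\<langle>x3, u\<rangle> * \<langle>x4, v\<rangle> - \<langle>x4, u\<rangle> * \<langle>x3, v\<rangle>)"
    "tri u v x2 = r * (\<langle>x3, u\<rangle> * \<langle>x5, v\<rangle> - \<langle>x5, u\<rangle> * \<langle>x3, v\<rangle>)"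
    "tri u v x3 = (\<langle>x4, u\<rangle> * \<langle>x5, v\<rangle> - \<langle>x5, u\<rangle> * \<langle>x4, v\<rangle>)"
    "tri u v x4 = 0"
    "tri u v x5 = 0"
proof -
  note expansion = presentation_basis_expansion[OF assms]
  note tri = presentation_basis_tri_perm[OF assms]
  show
    "tri u v y1 = (\<langle>x2, u\<rangle> * \<langle>x3, v\<rangle> - \<langle>x3, u\<rangle> * \<langle>x2, v\<rangle>)"
    "tri u v y2 = (- (\<langle>x1, u\<rangle> * \<langle>x3, v\<rangle> - \<langle>x3, u\<rangle> * \<langle>x1, v\<rangle>) - (\<langle>u, y1\<rangle> * \<langle>x5, v\<rangle> - \<langle>x5, u\<rangle> * \<langle>v, y1\<rangle>))"
    "tri u v y3 = ((\<langle>x1, u\<rangle> * \<langle>x2, v\<rangle> - \<langle>x2, u\<rangle> * \<langle>x1, v\<rangle>) - r * (\<langle>u, y2\<rangle> * \<langle>x5, v\<rangle> - \<langle>x5, u\<rangle> * \<langle>v, y2\<rangle>) -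
    (\<langle>u, y1\<rangle> * \<langle>x4, v\<rangle> - \<langle>x4, u\<rangle> * \<langle>v, y1\<rangle>))"
    "tri u v y4 = ((\<langle>u, y1\<rangle> * \<langle>x3, v\<rangle> - \<langle>x3, u\<rangle> * \<langle>v, y1\<rangle>) - (\<langle>u, y3\<rangle> * \<langle>x5, v\<rangle> - \<langle>x5, u\<rangle> * \<langle>v, y3\<rangle>))"
    "tri u v y5 = (r * (\<langle>u, y2\<rangle> * \<langle>x3, v\<rangle> - \<langle>x3, u\<rangle> * \<langle>v, y2\<rangle>) + (\<langle>u, y3\<rangle> * \<langle>x4, v\<rangle> - \<langle>x4, u\<rangle> * \<langle>v, y3\<rangle>) +
    (\<langle>u, y1\<rangle> * \<langle>x2, v\<rangle> - \<langle>x2, u\<rangle> * \<langle>v, y1\<rangle>))"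
    "tri u v x1 = (\<langle>x2, u\<rangle> * \<langle>x5, v\<rangle> - \<langle>x5, u\<rangle> * \<langle>x2, v\<rangle>) + (\<langle>x3, u\<rangle> * \<langle>x4, v\<rangle> - \<langle>x4, u\<rangle> * \<langle>x3, v\<rangle>)"
    "tri u v x2 = r * (\<langle>x3, u\<rangle> * \<langle>x5, v\<rangle> - \<langle>x5, u\<rangle> * \<langle>x3, v\<rangle>)"
    "tri u v x3 = (\<langle>x4, u\<rangle> * \<langle>x5, v\<rangle> - \<langle>x5, u\<rangle> * \<langle>x4, v\<rangle>)"
    "tri u v x4 = 0"
    "tri u v x5 = 0"
    by ((subst expansion[of u], subst expansion[of v]), simp add: tri algebra_simps)+
qed

lemma P26_basis_mult:
  assumes "P26_basis r x1 x2 x3 x4 x5 y1 y2 y3 y4 y5"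
  shows "u \<odot> v =
    (\<langle>x2, u\<rangle> * \<langle>x3, v\<rangle> - \<langle>x3, u\<rangle> * \<langle>x2, v\<rangle>) \<cdot> x1 +
    (- (\<langle>x1, u\<rangle> * \<langle>x3, v\<rangle> - \<langle>x3, u\<rangle> * \<langle>x1, v\<rangle>) - (\<langle>u, y1\<rangle> * \<langle>x5, v\<rangle> - \<langle>x5, u\<rangle> * \<langle>v, y1\<rangle>)) \<cdot> x2 +
    ((\<langle>x1, u\<rangle> * \<langle>x2, v\<rangle> - \<langle>x2, u\<rangle> * \<langle>x1, v\<rangle>) - r * (\<langle>u, y2\<rangle> * \<langle>x5, v\<rangle> - \<langle>x5, u\<rangle> * \<langle>v, y2\<rangle>) - (\<langle>u, y1\<rangle> * \<langle>x4, v\<rangle> - \<langle>x4, u\<rangle> * \<langle>v, y1\<rangle>)) \<cdot> x3 +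
    ((\<langle>u, y1\<rangle> * \<langle>x3, v\<rangle> - \<langle>x3, u\<rangle> * \<langle>v, y1\<rangle>) - (\<langle>u, y3\<rangle> * \<langle>x5, v\<rangle> - \<langle>x5, u\<rangle> * \<langle>v, y3\<rangle>)) \<cdot> x4 +
    (r * (\<langle>u, y2\<rangle> * \<langle>x3, v\<rangle> - \<langle>x3, u\<rangle> * \<langle>v, y2\<rangle>) + (\<langle>u, y3\<rangle> * \<langle>x4, v\<rangle> - \<langle>x4, u\<rangle> * \<langle>v, y3\<rangle>) + (\<langle>u, y1\<rangle> * \<langle>x2, v\<rangle> - \<langle>x2, u\<rangle> * \<langle>v, y1\<rangle>)) \<cdot> x5 +
    (- (\<langle>x2, u\<rangle> * \<langle>x5, v\<rangle> - \<langle>x5, u\<rangle> * \<langle>x2, v\<rangle>) - (\<langle>x3, u\<rangle> * \<langle>x4, v\<rangle> - \<langle>x4, u\<rangle> * \<langle>x3, v\<rangle>)) \<cdot> y1 +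
    (- r * (\<langle>x3, u\<rangle> * \<langle>x5, v\<rangle> - \<langle>x5, u\<rangle> * \<langle>x3, v\<rangle>)) \<cdot> y2 +
    (- (\<langle>x4, u\<rangle> * \<langle>x5, v\<rangle> - \<langle>x5, u\<rangle> * \<langle>x4, v\<rangle>)) \<cdot> y3"
proof -
  have swap: "\<langle>x, u \<odot> v\<rangle> = - tri u v x" for x unfolding tri_def by (rule form_swap)
  show ?thesis
    by (subst presentation_basis_expansion[OF assms])
      (simp add: swap P26_basis_tri_formula[OF assms] tri_def[symmetric])
qed

lemma presentation_basis_form:
  assumes "presentation_basis a b c d e x1 x2 x3 x4 x5 y1 y2 y3 y4 y5"
  shows "\<langle>u, v\<rangle> = \<langle>u, y1\<rangle> * \<langle>x1, v\<rangle> + \<langle>u, y2\<rangle> * \<langle>x2, v\<rangle> + \<langle>u, y3\<rangle> * \<langle>x3, v\<rangle> + \<langle>u, y4\<rangle> * \<langle>x4, v\<rangle> +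
    \<langle>u, y5\<rangle> * \<langle>x5, v\<rangle>
    - (\<langle>x1, u\<rangle> * \<langle>v, y1\<rangle> + \<langle>x2, u\<rangle> * \<langle>v, y2\<rangle> + \<langle>x3, u\<rangle> * \<langle>v, y3\<rangle> + \<langle>x4, u\<rangle> * \<langle>v, y4\<rangle> + \<langle>x5, u\<rangle> * \<langle>v, y5\<rangle>)"
proof -
  have swap: "\<langle>x, v\<rangle> = - \<langle>v, x\<rangle>" for x by (rule form_swap)
  show ?thesis
    by (subst presentation_basis_expansion[OF assms, of u])
      (simp add: swap[of y1] swap[of y2] swap[of y3] swap[of y4] swap[of y5])
qed

end

section \<open>Reading off the flag of a presented algebra\<close>

locale P26_presented = symplectic_alternating_algebra +
  fixes r x1 x2 x3 x4 x5 y1 y2 y3 y4 y5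
  assumes basis: "P26_basis r x1 x2 x3 x4 x5 y1 y2 y3 y4 y5"
    and r_nonzero: "r \<noteq> 0"
begin

lemma hyp: "hyperbolic x1 x2 x3 x4 x5 y1 y2 y3 y4 y5" and dim_10: "dim UNIV = 10"
  using basis by (simp_all add: presentation_basis_def)

lemmas form_values [simp] = hyperbolic_values[OF hyp] form_alternating

lemmas mult = P26_basis_mult[OF basis]

lemmas expansion = presentation_basis_expansion[OF basis]

text \<open>These products generate all other basis vectors from \<open>y4\<close> and
  \<open>y5\<close>, which yields lower bounds for the powers of L.\<close>

lemma basis_products:
  "y4 \<odot> y5 = - y3" "y3 \<odot> y5 = - r \<cdot> y2" "y2 \<odot> y5 = - y1" "y2 \<odot> y3 = x1" "y1 \<odot> y3 = - x2"
  "y1 \<odot> y2 = x3" "x2 \<odot> y5 = - r \<cdot> x3" "x2 \<odot> y3 = r \<cdot> x5" "x3 \<odot> y5 = - x4" "x3 \<odot> y4 = x5"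
  "x1 \<odot> y2 = x5" "x1 \<odot> y3 = x4"
  by (subst mult; simp)+

lemma basis_mem_lpow:
  shows "y3 \<in> lpow L 2" "y2 \<in> lpow L 3" "y1 \<in> lpow L 4" "x1 \<in> lpow L 4" "x2 \<in> lpow L 5" "x3 \<in> lpow L 6"
    "x4 \<in> lpow L 7" "x5 \<in> lpow L 7"
proof -
  have neg: "v \<in> lpow L (Suc k)" if "u \<odot> w = - c \<cdot> v" "c \<noteq> 0" "u \<in> lpow L k" "0 < k" for u v w c k
  proof -
    have "(- (1 / c)) \<cdot> (u \<odot> w) \<in> lpow L (Suc k)"
      using lpow_mult(1)[OF that(4,3)] by (intro subspace_scale) auto
    then show ?thesis using that(1,2) by simp
  qed
  have "y3 \<in> lpow L (Suc 1)" by (rule neg[of y4 y5 1]) (simp_all add: basis_products)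
  then show y3: "y3 \<in> lpow L 2" by (simp add: numeral_2_eq_2)
  show y2: "y2 \<in> lpow L 3" using neg[of y3 y5 r y2 2] y3 r_nonzero by (simp add: basis_products)
  show "y1 \<in> lpow L 4" using neg[of y2 y5 1 y1 3] y2 by (simp add: basis_products)
  then have y1: "y1 \<in> lpow L 4" .
  show "x1 \<in> lpow L 4" using lpow_mult(1)[of 3 y2 y3] y2 by (simp add: basis_products)
  show x2: "x2 \<in> lpow L 5" using neg[of y1 y3 1 x2 4] y1 by (simp add: basis_products)
  \<comment> \<open>The product of y1 and y2 would only place x3 in L^5. The better bound comes from
    x2y5 = -r x3 and relies on r \<noteq> 0.\<close>
  show x3: "x3 \<in> lpow L 6" using neg[of x2 y5 r x3 5] x2 r_nonzero by (simp add: basis_products)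
  show "x4 \<in> lpow L 7" using neg[of x3 y5 1 x4 6] x3 by (simp add: basis_products)
  show "x5 \<in> lpow L 7" using lpow_mult(1)[of 6 x3 y4] x3 by (simp add: basis_products)
qed

lemma basis_mem_lpow':
  "x1 \<in> lpow L 2" "x2 \<in> lpow L 2" "x3 \<in> lpow L 2" "x4 \<in> lpow L 2" "x5 \<in> lpow L 2" "y1 \<in> lpow L 2"
  "y2 \<in> lpow L 2" "x1 \<in> lpow L 3" "x2 \<in> lpow L 3" "x3 \<in> lpow L 3" "x4 \<in> lpow L 3" "x5 \<in> lpow L 3"
  "y1 \<in> lpow L 3" "x2 \<in> lpow L 4" "x3 \<in> lpow L 4" "x4 \<in> lpow L 4" "x5 \<in> lpow L 4"
  "x3 \<in> lpow L 5" "x4 \<in> lpow L 5" "x5 \<in> lpow L 5" "x4 \<in> lpow L 6" "x5 \<in> lpow L 6"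
  by ((rule lpow_mono[THEN subsetD, rotated 2], rule basis_mem_lpow); simp)+

lemma lpow_step:
  assumes "0 < k" "lpow L k \<subseteq> W" "subspace V" "\<And>u v. u \<in> W \<Longrightarrow> u \<odot> v \<in> V"
  shows "lpow L (Suc k) \<subseteq> V"
  using assms(1,2,4) lpow_Suc[of "k - 1"] set_mult_subset[OF assms(3), of "lpow L k" UNIV] by auto

text \<open>Each bound follows from the previous one by the coordinate formula \<open>mult\<close>;
  \<open>basis_mem_lpow\<close> then shows that the bounds are sharp.\<close>

lemma lpow_upper:
  "lpow L 2 \<subseteq> {v. \<langle>x4, v\<rangle> = 0 \<and> \<langle>x5, v\<rangle> = 0}"
  "lpow L 3 \<subseteq> {v. \<langle>x3, v\<rangle> = 0 \<and> \<langle>x4, v\<rangle> = 0 \<and> \<langle>x5, v\<rangle> = 0}"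
  "lpow L 4 \<subseteq> {v. \<langle>x2, v\<rangle> = 0 \<and> \<langle>x3, v\<rangle> = 0 \<and> \<langle>x4, v\<rangle> = 0 \<and> \<langle>x5, v\<rangle> = 0}"
  "lpow L 5 \<subseteq> {v. \<langle>v, y1\<rangle> = 0 \<and> \<langle>x1, v\<rangle> = 0 \<and> \<langle>x2, v\<rangle> = 0 \<and> \<langle>x3, v\<rangle> = 0 \<and> \<langle>x4, v\<rangle> = 0 \<and> \<langle>x5, v\<rangle> = 0}"
  "lpow L 6 \<subseteq> {v. \<langle>v, y1\<rangle> = 0 \<and> \<langle>v, y2\<rangle> = 0 \<and>
     \<langle>x1, v\<rangle> = 0 \<and> \<langle>x2, v\<rangle> = 0 \<and> \<langle>x3, v\<rangle> = 0 \<and> \<langle>x4, v\<rangle> = 0 \<and> \<langle>x5, v\<rangle> = 0}"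
  "lpow L 7 \<subseteq> {v. \<langle>v, y1\<rangle> = 0 \<and> \<langle>v, y2\<rangle> = 0 \<and> \<langle>v, y3\<rangle> = 0 \<and>
     \<langle>x1, v\<rangle> = 0 \<and> \<langle>x2, v\<rangle> = 0 \<and> \<langle>x3, v\<rangle> = 0 \<and> \<langle>x4, v\<rangle> = 0 \<and> \<langle>x5, v\<rangle> = 0}"
  "lpow L 8 \<subseteq> {0}"
proof -
  have "lpow L 1 \<subseteq> UNIV" by simp
  from lpow_step[OF _ this, of "{v. \<langle>x4, v\<rangle> = 0 \<and> \<langle>x5, v\<rangle> = 0}"]
  show 2: "lpow L 2 \<subseteq> {v. \<langle>x4, v\<rangle> = 0 \<and> \<langle>x5, v\<rangle> = 0}"
    by (simp add: numeral_2_eq_2 mult subspace_def)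
  from lpow_step[OF _ 2, of "{v. \<langle>x3, v\<rangle> = 0 \<and> \<langle>x4, v\<rangle> = 0 \<and> \<langle>x5, v\<rangle> = 0}"]
  show 3: "lpow L 3 \<subseteq> {v. \<langle>x3, v\<rangle> = 0 \<and> \<langle>x4, v\<rangle> = 0 \<and> \<langle>x5, v\<rangle> = 0}"
    by (simp add: mult subspace_def)
  from lpow_step[OF _ 3, of "{v. \<langle>x2, v\<rangle> = 0 \<and> \<langle>x3, v\<rangle> = 0 \<and> \<langle>x4, v\<rangle> = 0 \<and> \<langle>x5, v\<rangle> = 0}"]
  show 4: "lpow L 4 \<subseteq> {v. \<langle>x2, v\<rangle> = 0 \<and> \<langle>x3, v\<rangle> = 0 \<and> \<langle>x4, v\<rangle> = 0 \<and> \<langle>x5, v\<rangle> = 0}"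
    by (simp add: mult subspace_def)
  from lpow_step[OF _ 4, of "{v. \<langle>v, y1\<rangle> = 0 \<and> \<langle>x1, v\<rangle> = 0 \<and> \<langle>x2, v\<rangle> = 0 \<and> \<langle>x3, v\<rangle> = 0 \<and> \<langle>x4, v\<rangle> = 0 \<and>
    \<langle>x5, v\<rangle> = 0}"]
  show 5: "lpow L 5 \<subseteq> {v. \<langle>v, y1\<rangle> = 0 \<and> \<langle>x1, v\<rangle> = 0 \<and> \<langle>x2, v\<rangle> = 0 \<and> \<langle>x3, v\<rangle> = 0 \<and> \<langle>x4, v\<rangle> = 0 \<and> \<langle>x5, v\<rangle> =
    0}"
    by (simp add: mult subspace_def)
  from lpow_step[OF _ 5, of "{v. \<langle>v, y1\<rangle> = 0 \<and> \<langle>v, y2\<rangle> = 0 \<and>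
     \<langle>x1, v\<rangle> = 0 \<and> \<langle>x2, v\<rangle> = 0 \<and> \<langle>x3, v\<rangle> = 0 \<and> \<langle>x4, v\<rangle> = 0 \<and> \<langle>x5, v\<rangle> = 0}"]
  show 6: "lpow L 6 \<subseteq> {v. \<langle>v, y1\<rangle> = 0 \<and> \<langle>v, y2\<rangle> = 0 \<and>
     \<langle>x1, v\<rangle> = 0 \<and> \<langle>x2, v\<rangle> = 0 \<and> \<langle>x3, v\<rangle> = 0 \<and> \<langle>x4, v\<rangle> = 0 \<and> \<langle>x5, v\<rangle> = 0}"
    by (simp add: mult subspace_def)
  from lpow_step[OF _ 6, of "{v. \<langle>v, y1\<rangle> = 0 \<and> \<langle>v, y2\<rangle> = 0 \<and> \<langle>v, y3\<rangle> = 0 \<and>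
     \<langle>x1, v\<rangle> = 0 \<and> \<langle>x2, v\<rangle> = 0 \<and> \<langle>x3, v\<rangle> = 0 \<and> \<langle>x4, v\<rangle> = 0 \<and> \<langle>x5, v\<rangle> = 0}"]
  show 7: "lpow L 7 \<subseteq> {v. \<langle>v, y1\<rangle> = 0 \<and> \<langle>v, y2\<rangle> = 0 \<and> \<langle>v, y3\<rangle> = 0 \<and>
     \<langle>x1, v\<rangle> = 0 \<and> \<langle>x2, v\<rangle> = 0 \<and> \<langle>x3, v\<rangle> = 0 \<and> \<langle>x4, v\<rangle> = 0 \<and> \<langle>x5, v\<rangle> = 0}"
    by (simp add: mult subspace_def)
  from lpow_step[OF _ 7, of "{0}"] show "lpow L 8 \<subseteq> {0}"
    by (simp add: mult subspace_def)
qed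

lemma mem_lpow:
  "v \<in> lpow L 2 \<longleftrightarrow> \<langle>x4, v\<rangle> = 0 \<and> \<langle>x5, v\<rangle> = 0"
  "v \<in> lpow L 3 \<longleftrightarrow> \<langle>x3, v\<rangle> = 0 \<and> \<langle>x4, v\<rangle> = 0 \<and> \<langle>x5, v\<rangle> = 0"
  "v \<in> lpow L 4 \<longleftrightarrow> \<langle>x2, v\<rangle> = 0 \<and> \<langle>x3, v\<rangle> = 0 \<and> \<langle>x4, v\<rangle> = 0 \<and> \<langle>x5, v\<rangle> = 0"
  "v \<in> lpow L 5 \<longleftrightarrow> \<langle>v, y1\<rangle> = 0 \<and> \<langle>x1, v\<rangle> = 0 \<and> \<langle>x2, v\<rangle> = 0 \<and> \<langle>x3, v\<rangle> = 0 \<and> \<langle>x4, v\<rangle> = 0 \<and> \<langle>x5, v\<rangle> = 0"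
  "v \<in> lpow L 6 \<longleftrightarrow> \<langle>v, y1\<rangle> = 0 \<and> \<langle>v, y2\<rangle> = 0 \<and>
     \<langle>x1, v\<rangle> = 0 \<and> \<langle>x2, v\<rangle> = 0 \<and> \<langle>x3, v\<rangle> = 0 \<and> \<langle>x4, v\<rangle> = 0 \<and> \<langle>x5, v\<rangle> = 0"
  "v \<in> lpow L 7 \<longleftrightarrow> \<langle>v, y1\<rangle> = 0 \<and> \<langle>v, y2\<rangle> = 0 \<and> \<langle>v, y3\<rangle> = 0 \<and>
     \<langle>x1, v\<rangle> = 0 \<and> \<langle>x2, v\<rangle> = 0 \<and> \<langle>x3, v\<rangle> = 0 \<and> \<langle>x4, v\<rangle> = 0 \<and> \<langle>x5, v\<rangle> = 0"
proof -
  have mem: "v \<in> V" if "subspace V"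
    "\<langle>v, y1\<rangle> \<cdot> x1 \<in> V" "\<langle>v, y2\<rangle> \<cdot> x2 \<in> V" "\<langle>v, y3\<rangle> \<cdot> x3 \<in> V" "\<langle>v, y4\<rangle> \<cdot> x4 \<in> V" "\<langle>v, y5\<rangle> \<cdot> x5 \<in> V"
    "\<langle>x1, v\<rangle> \<cdot> y1 \<in> V" "\<langle>x2, v\<rangle> \<cdot> y2 \<in> V" "\<langle>x3, v\<rangle> \<cdot> y3 \<in> V" "\<langle>x4, v\<rangle> \<cdot> y4 \<in> V" "\<langle>x5, v\<rangle> \<cdot> y5 \<in> V" for V
    by (subst expansion[of v]) (intro subspace_add that)
  show "v \<in> lpow L 2 \<longleftrightarrow> \<langle>x4, v\<rangle> = 0 \<and> \<langle>x5, v\<rangle> = 0"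
    using lpow_upper(1) by (auto intro!: mem simp: subspace_0 subspace_scale basis_mem_lpow basis_mem_lpow')
  show "v \<in> lpow L 3 \<longleftrightarrow> \<langle>x3, v\<rangle> = 0 \<and> \<langle>x4, v\<rangle> = 0 \<and> \<langle>x5, v\<rangle> = 0"
    using lpow_upper(2) by (auto intro!: mem simp: subspace_0 subspace_scale basis_mem_lpow basis_mem_lpow')
  show "v \<in> lpow L 4 \<longleftrightarrow> \<langle>x2, v\<rangle> = 0 \<and> \<langle>x3, v\<rangle> = 0 \<and> \<langle>x4, v\<rangle> = 0 \<and> \<langle>x5, v\<rangle> = 0"
    using lpow_upper(3) by (auto intro!: mem simp: subspace_0 subspace_scale basis_mem_lpow basis_mem_lpow')
  show "v \<in> lpow L 5 \<longleftrightarrow> \<langle>v, y1\<rangle> = 0 \<and> \<langle>x1, v\<rangle> = 0 \<and> \<langle>x2, v\<rangle> = 0 \<and> \<langle>x3, v\<rangle> = 0 \<and> \<langle>x4, v\<rangle> = 0 \<and> \<langle>x5, v\<rangle> = 0"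
    using lpow_upper(4) by (auto intro!: mem simp: subspace_0 subspace_scale basis_mem_lpow basis_mem_lpow')
  show "v \<in> lpow L 6 \<longleftrightarrow> \<langle>v, y1\<rangle> = 0 \<and> \<langle>v, y2\<rangle> = 0 \<and>
     \<langle>x1, v\<rangle> = 0 \<and> \<langle>x2, v\<rangle> = 0 \<and> \<langle>x3, v\<rangle> = 0 \<and> \<langle>x4, v\<rangle> = 0 \<and> \<langle>x5, v\<rangle> = 0"
    using lpow_upper(5) by (auto intro!: mem simp: subspace_0 subspace_scale basis_mem_lpow basis_mem_lpow')
  show "v \<in> lpow L 7 \<longleftrightarrow> \<langle>v, y1\<rangle> = 0 \<and> \<langle>v, y2\<rangle> = 0 \<and> \<langle>v, y3\<rangle> = 0 \<and>
     \<langle>x1, v\<rangle> = 0 \<and> \<langle>x2, v\<rangle> = 0 \<and> \<langle>x3, v\<rangle> = 0 \<and> \<langle>x4, v\<rangle> = 0 \<and> \<langle>x5, v\<rangle> = 0"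
    using lpow_upper(6) by (auto intro!: mem simp: subspace_0 subspace_scale basis_mem_lpow basis_mem_lpow')
qed

lemma x4_x5_line:
  assumes "\<langle>v, y1\<rangle> = 0" "\<langle>v, y2\<rangle> = 0" "\<langle>v, y3\<rangle> = 0" "\<langle>x1, v\<rangle> = 0" "\<langle>x2, v\<rangle> = 0" "\<langle>x3, v\<rangle> = 0" "\<langle>x4, v\<rangle> = 0"
    "\<langle>x5, v\<rangle> = 0"
  shows "v = \<langle>v, y4\<rangle> \<cdot> x4 + \<langle>v, y5\<rangle> \<cdot> x5"
  by (subst expansion[of v]) (simp add: assms)

lemma lpow_5_mult_lpow_2: "set_mult L (lpow L 5) (lpow L 2) = span {x5}"
proof
  have "u \<odot> v = (r * (\<langle>u, y2\<rangle> * \<langle>x3, v\<rangle>)) \<cdot> x5" if "u \<in> lpow L 5" "v \<in> lpow L 2" for u v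
    using that by (subst mult) (simp add: mem_lpow)
  then show "set_mult L (lpow L 5) (lpow L 2) \<subseteq> span {x5}"
    by (intro set_mult_subset) (auto simp: span_scale span_base)
  have "(1 / r) \<cdot> (x2 \<odot> y3) \<in> set_mult L (lpow L 5) (lpow L 2)"
    by (intro subspace_scale subspace_set_mult mult_in_set_mult basis_mem_lpow)
  then show "span {x5} \<subseteq> set_mult L (lpow L 5) (lpow L 2)"
    using r_nonzero by (intro span_minimal) (auto simp: basis_products)
qed

lemma x5_in_lpow_4_mult_lpow_3: "x5 \<in> set_mult L (lpow L 4) (lpow L 3)"
  using mult_in_set_mult[of x1 "lpow L 4" y2 "lpow L 3"] basis_mem_lpow by (simp add: basis_products)

lemma basis_nonzero: "x4 \<noteq> 0" "x5 \<noteq> 0" "x4 \<noteq> x5"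
proof -
  have "\<langle>x4, y4\<rangle> \<noteq> \<langle>0, y4\<rangle>" "\<langle>x5, y5\<rangle> \<noteq> \<langle>0, y5\<rangle>" "\<langle>x4, y4\<rangle> \<noteq> \<langle>x5, y4\<rangle>" by simp_all
  then show "x4 \<noteq> 0" "x5 \<noteq> 0" "x4 \<noteq> x5" by metis+
qed

text \<open>For v in L^4 the only obstruction is (x1, v): it is the coefficient of x3 in the product
  of v and y2, which has to be a multiple of x5.\<close>

lemma mem_U_ideal:
  "v \<in> U_ideal L \<longleftrightarrow> \<langle>x1, v\<rangle> = 0 \<and> \<langle>x2, v\<rangle> = 0 \<and> \<langle>x3, v\<rangle> = 0 \<and> \<langle>x4, v\<rangle> = 0 \<and> \<langle>x5, v\<rangle> = 0"
proof -
  have "x5 \<in> I_ideal L 1 \<inter> set_mult L (lpow L 4) (lpow L 3)"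
    using x5_in_lpow_4_mult_lpow_3 by (simp add: I_ideal_def lpow_5_mult_lpow_2 span_base)
  then have "I_ideal L 1 \<inter> set_mult L (lpow L 4) (lpow L 3) \<noteq> {0}"
    using basis_nonzero by blast
  then have "U_index L = 1"
    unfolding U_index_def by (intro Least_equality) auto
  then have U: "v \<in> U_ideal L \<longleftrightarrow> v \<in> lpow L 4 \<and> set_mult L {v} (lpow L 3) \<subseteq> span {x5}"
    by (simp add: U_ideal_def I_ideal_def lpow_5_mult_lpow_2)
  show ?thesis
  proof
    assume "v \<in> U_ideal L"
    then have v: "v \<in> lpow L 4" "v \<odot> y2 \<in> span {x5}"
      using U mult_in_set_mult[of v "{v}" y2 "lpow L 3"] basis_mem_lpow by auto
    have "\<langle>v \<odot> y2, y3\<rangle> = 0" using v(2) by (auto simp: span_singleton)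
    then show "\<langle>x1, v\<rangle> = 0 \<and> \<langle>x2, v\<rangle> = 0 \<and> \<langle>x3, v\<rangle> = 0 \<and> \<langle>x4, v\<rangle> = 0 \<and> \<langle>x5, v\<rangle> = 0"
      using v(1) by (simp add: mult mem_lpow)
  next
    assume v: "\<langle>x1, v\<rangle> = 0 \<and> \<langle>x2, v\<rangle> = 0 \<and> \<langle>x3, v\<rangle> = 0 \<and> \<langle>x4, v\<rangle> = 0 \<and> \<langle>x5, v\<rangle> = 0"
    have "v \<odot> w = (\<langle>v, y1\<rangle> * \<langle>x2, w\<rangle>) \<cdot> x5" if "w \<in> lpow L 3" for w
      using that v by (subst mult) (simp add: mem_lpow)
    then have "set_mult L {v} (lpow L 3) \<subseteq> span {x5}"
      by (intro set_mult_subset) (auto simp: span_scale span_base)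
    then show "v \<in> U_ideal L" using U v by (simp add: mem_lpow)
  qed
qed

lemma lpow_7_eq_span: "lpow L 7 = span {x4, x5}"
proof
  show "lpow L 7 \<subseteq> span {x4, x5}"
  proof
    fix v assume "v \<in> lpow L 7"
    then have "v = \<langle>v, y4\<rangle> \<cdot> x4 + \<langle>v, y5\<rangle> \<cdot> x5" by (intro x4_x5_line) (simp_all add: mem_lpow)
    also have "\<dots> \<in> span {x4, x5}" by (intro span_add span_scale span_base) auto
    finally show "v \<in> span {x4, x5}" .
  qed
  show "span {x4, x5} \<subseteq> lpow L 7" using basis_mem_lpow by (intro span_minimal) auto
qed

lemma dim_lpow_7: "dim (lpow L 7) = 2"
proof -
  have "independent {x4, x5}"
    by (rule independent_mono[OF hyperbolic_independent(1)[OF hyp]]) auto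
  then show ?thesis using basis_nonzero by (simp add: lpow_7_eq_span dim_eq_card_independent)
qed

lemma P26_properties: "P26_properties L"
proof -
  have sub0: "0 \<in> lpow L k" if "0 < k" for k using that subspace_0 subspace_lpow' by blast
  have lpow_8: "lpow L 8 = {0}" using lpow_upper(7) sub0[of 8] by auto
  have cl: "(LEAST k. lpow L (k + 1) = {0}) = 7"
  proof (rule Least_equality)
    show "7 \<le> k" if "lpow L (k + 1) = {0}" for k
    proof (rule ccontr)
      assume "\<not> 7 \<le> k"
      then have "x4 \<in> lpow L (k + 1)" using lpow_mono[of "k + 1" 7] basis_mem_lpow by auto
      then show False using that basis_nonzero by simp
    qed
  qed (simp add: lpow_8)
  have center: "saa_center L = lpow L 7"
  proof
    show "saa_center L \<subseteq> lpow L 7"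
    proof
      fix z assume "z \<in> saa_center L"
      then have "z \<in> perp (lpow L 2)" by (simp add: center_eq_perp)
      then have z: "\<langle>w, z\<rangle> = 0" "\<langle>z, w\<rangle> = 0" if "w \<in> lpow L 2" for w using perpD that by blast+
      show "z \<in> lpow L 7" using z basis_mem_lpow basis_mem_lpow' by (simp add: mem_lpow)
    qed
    show "lpow L 7 \<subseteq> saa_center L"
      using lpow_mult(1)[of 7] lpow_8 by (auto simp: saa_center_def)
  qed
  have UL2: "set_mult L (U_ideal L) (lpow L 2) = lpow L 7"
  proof
    show "set_mult L (U_ideal L) (lpow L 2) \<subseteq> lpow L 7"
      by (intro set_mult_subset) (simp_all add: mem_lpow mem_U_ideal mult)
    \<comment> \<open>These two products are x4 and x5, which span L^7.\<close>
    have "x1 \<odot> y3 \<in> set_mult L (U_ideal L) (lpow L 2)" "x1 \<odot> y2 \<in> set_mult L (U_ideal L) (lpow L 2)"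
      by (intro mult_in_set_mult; simp add: mem_U_ideal mem_lpow)+
    then show "lpow L 7 \<subseteq> set_mult L (U_ideal L) (lpow L 2)"
      unfolding lpow_7_eq_span by (intro span_minimal) (auto simp: basis_products)
  qed
  \<comment> \<open>This product is x3, a vector outside L^7.\<close>
  have "y1 \<odot> y2 \<in> set_mult L (lpow L 4) (lpow L 3)"
    by (intro mult_in_set_mult basis_mem_lpow)
  moreover have "y1 \<odot> y2 \<notin> lpow L 7" by (simp add: basis_products mem_lpow)
  ultimately have ne: "set_mult L (lpow L 4) (lpow L 3) \<noteq> lpow L 7" by blast
  have sub: "set_mult L (lpow L 5) (lpow L 2) \<subseteq> set_mult L (lpow L 4) (lpow L 3)"
    unfolding lpow_5_mult_lpow_2 using x5_in_lpow_4_mult_lpow_3 by (intro span_minimal) auto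
  have "isotropic L (lpow L 7)"
    unfolding isotropic_def
    by (intro ballI, subst presentation_basis_form[OF basis]) (simp add: mem_lpow)
  with lpow_8 cl center UL2 ne sub dim_10 dim_lpow_7 symplectic_alternating_algebra_axioms show ?thesis
    unfolding P26_properties_def saa_nilpotent_def nilpotence_class_def
    by (auto intro: exI[of _ 7])
qed

text \<open>N, U and the powers of L do not depend on a basis, so their coordinate descriptions hold
  for both bases at once; this makes the transition matrix triangular.\<close>

lemma ratio_nonzero_power:
  assumes "P26_basis s x1' x2' x3' x4' x5' y1' y2' y3' y4' y5'" "s \<noteq> 0"
  shows "s / r \<in> nonzero_powers 12"
proof -
  interpret other: P26_presented L s x1' x2' x3' x4' x5' y1' y2' y3' y4' y5'
    using assms by unfold_locales
  note tri' = presentation_basis_tri[OF assms(1)]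
  have orth: "\<langle>x1, x1'\<rangle> = 0 \<and> \<langle>x2, x1'\<rangle> = 0 \<and> \<langle>x3, x1'\<rangle> = 0 \<and> \<langle>x4, x1'\<rangle> = 0 \<and> \<langle>x5, x1'\<rangle> = 0"
    using other.mem_U_ideal[of x1'] mem_U_ideal[of x1'] by simp
  note coords = orth other.basis_mem_lpow[unfolded mem_lpow]
  have "x5' \<in> span {x5}"
    using lpow_5_mult_lpow_2 other.lpow_5_mult_lpow_2 span_base[of x5' "{x5'}"] by simp
  then obtain k where k: "x5' = k \<cdot> x5" by (auto simp: span_singleton)
  have k0: "k \<noteq> 0" using k other.basis_nonzero by auto
  \<comment> \<open>As x5 and x5' are proportional, y4 and y4' are both orthogonal to both of
    them.\<close>
  have "\<langle>x5', y4'\<rangle> = 0" by simp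
  then have y4: "\<langle>x5, y4'\<rangle> = 0" "\<langle>x5', y4\<rangle> = 0" using k k0 by simp_all
  note form = presentation_basis_form[OF basis]
  define c1 where "c1 = \<langle>x1, y1'\<rangle>"
  define c2 where "c2 = \<langle>x2, y2'\<rangle>"
  define c3 where "c3 = \<langle>x3, y3'\<rangle>"
  define c4 where "c4 = \<langle>x4, y4'\<rangle>"
  define c5 where "c5 = \<langle>x5, y5'\<rangle>"
  define a1 where "a1 = \<langle>x1', y1\<rangle>"
  define a2 where "a2 = \<langle>x2', y2\<rangle>"
  define a3 where "a3 = \<langle>x3', y3\<rangle>"
  define a4 where "a4 = \<langle>x4', y4\<rangle>"
  define a5 where "a5 = \<langle>x5', y5\<rangle>"
  note cs = a1_def a2_def a3_def a4_def a5_def c1_def c2_def c3_def c4_def c5_def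
  \<comment> \<open>Triangularity leaves only the diagonal terms, here and in the five triples
    below; so each c_i is the inverse of a_i.\<close>
  have "\<langle>x1', y1'\<rangle> = a1 * c1" "\<langle>x2', y2'\<rangle> = a2 * c2" "\<langle>x3', y3'\<rangle> = a3 * c3"
    "\<langle>x4', y4'\<rangle> = a4 * c4" "\<langle>x5', y5'\<rangle> = a5 * c5"
    by (subst form; simp add: coords y4 cs)+
  then have ac: "a1 * c1 = 1" "a2 * c2 = 1" "a3 * c3 = 1" "a4 * c4 = 1" "a5 * c5 = 1" by simp_all
  have "tri x3' y4' y5' = a3 * c4 * c5" "tri x2' y3' y5' = r * (a2 * c3 * c5)"
    "tri x1' y2' y5' = a1 * c2 * c5" "tri x1' y3' y4' = a1 * c3 * c4" "tri y1' y2' y3' = c1 * c2 * c3"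
    unfolding tri_def by (subst mult; simp add: coords y4 cs)+
  then have eqs: "a3 * c4 * c5 = 1" "r * (a2 * c3 * c5) = s" "a1 * c2 * c5 = 1" "a1 * c3 * c4 = 1"
    "c1 * c2 * c3 = 1"
    using tri' by simp_all
  have nz: "a1 \<noteq> 0" "a2 \<noteq> 0" "a3 \<noteq> 0" "a4 \<noteq> 0" "a5 \<noteq> 0" using ac by auto
  have c: "c1 = 1 / a1" "c2 = 1 / a2" "c3 = 1 / a3" "c4 = 1 / a4" "c5 = 1 / a5"
    using ac nz by (simp_all add: field_simps)
  have e: "a3 = a4 * a5" "a1 = a2 * a5" "a1 = a3 * a4" "a1 * a2 * a3 = 1"
    using eqs nz by (simp_all add: c field_simps)
  have a2: "a2 = a4 ^ 2" using e(1-3) nz by (simp add: power2_eq_square)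
  then have K: "a4 ^ 5 * a5 ^ 2 = 1" using e by (simp add: power2_eq_square eval_nat_numeral mult_ac)
  have "s / r = a2 / (a3 * a5)" using eqs(2) r_nonzero by (auto simp: c)
  also have "\<dots> = a4 / a5 ^ 2" using nz by (simp add: a2 e(1) power2_eq_square)
  \<comment> \<open>The seventh power of this 1 turns the exponents (1, -2) of (a4, a5) into (36,
    12) = 12 (3, 1).\<close>
  also have "\<dots> = (a4 ^ 5 * a5 ^ 2) ^ 7 * (a4 / a5 ^ 2)" using K by simp
  also have "\<dots> = (a4 ^ 3 * a5) ^ 12"
    using nz by (simp add: field_simps power_Suc[symmetric] del: power_Suc)
  finally show ?thesis using nz unfolding nonzero_powers_def by auto
qed

end

section \<open>Normalizing the five remaining triples\<close>

context P26_algebra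
begin

lemma P26_basis_exists: "\<exists>r x1 x2 x3 x4 x5 y1 y2 y3 y4 y5. r \<noteq> 0 \<and>
  P26_basis r x1 x2 x3 x4 x5 y1 y2 y3 y4 y5"
proof -
  have "\<exists>x1 x2 x3 x4 x5 y1 y2 y3 y4 y5. reduced 0 x1 x2 x3 x4 x5 y1 y2 y3 y4 y5"
    using adapted_exists by (simp add: reduced_def)
  then have "\<exists>x1 x2 x3 x4 x5 y1 y2 y3 y4 y5. reduced 12 x1 x2 x3 x4 x5 y1 y2 y3 y4 y5"
    by (elim exE) ((drule reduced_1 reduced_2 reduced_3 reduced_4 reduced_5 reduced_6 reduced_7 reduced_8
      reduced_9 reduced_10 reduced_11 reduced_12, (elim exE)?)+, intro exI)
  then obtain x1 x2 x3 x4 x5 y1 y2 y3 y4 y5 where red: "reduced 12 x1 x2 x3 x4 x5 y1 y2 y3 y4 y5" by blast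
  then have ad: "adapted x1 x2 x3 x4 x5 y1 y2 y3 y4 y5" by (simp add: reduced_def)
  define a where "a = tri x3 y4 y5"
  define b where "b = tri x2 y3 y5"
  define c where "c = tri x1 y2 y5"
  define d where "d = tri x1 y3 y4"
  define e where "e = tri y1 y2 y3"
  note defs = a_def b_def c_def d_def e_def
  have nz: "a \<noteq> 0" "b \<noteq> 0" "c \<noteq> 0" "d \<noteq> 0" "e \<noteq> 0"
    using adapted_tri_nonzero[OF ad] by (simp_all add: defs)
  have pb: "presentation_basis a b c d e x1 x2 x3 x4 x5 y1 y2 y3 y4 y5"
    using red adapted_tri_0[OF ad]
    by (simp add: presentation_basis_def reduced_def coefficients_def adapted_def dim_UNIV_10 defs)
  txt \<open>
    Three of the normalizations express the other factors through \<open>k = k4\<close> and \<open>k5\<close>; the last one becomes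
    \<open>k4 ^ 5 * k5 ^ 2 = e * a ^ 3 * d ^ 2 / c\<close>, which is solved by this \<open>k4\<close> and \<open>k5 = 1 / k4 ^ 2\<close>.
  \<close>
  define k where "k = e * a ^ 3 * d ^ 2 / c"
  have k: "k \<noteq> 0" using nz by (simp add: k_def)
  define k1 where "k1 = 1 / (a * d)"
  define k2 where "k2 = c * k ^ 2 / (a * d)"
  define k3 where "k3 = 1 / (k * a)"
  define k5 where "k5 = 1 / k ^ 2"
  have k_nz: "k1 \<noteq> 0" "k2 \<noteq> 0" "k3 \<noteq> 0" "k5 \<noteq> 0"
    using nz k by (simp_all add: k1_def k2_def k3_def k5_def)
  have "k3 / (k * k5) * a = 1" "k1 / (k2 * k5) * c = 1" "k1 / (k3 * k) * d = 1"
    using nz k by (simp_all add: k1_def k2_def k3_def k5_def field_simps power2_eq_square)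
  moreover have "1 / (k1 * k2 * k3) * e = 1"
    using nz by (simp add: k1_def k2_def k3_def k_def field_simps eval_nat_numeral)
  moreover note presentation_basis_rescale[OF pb k_nz(1,2,3) k k_nz(4)]
  ultimately have "\<exists>x1 x2 x3 x4 x5 y1 y2 y3 y4 y5. P26_basis (k2 / (k3 * k5) * b) x1 x2 x3 x4 x5 y1 y2 y3 y4 y5"
    by (simp only:) blast
  moreover have "k2 / (k3 * k5) * b \<noteq> 0" using nz k_nz by simp
  ultimately show ?thesis by blast
qed

end

context symplectic_alternating_algebra
begin

section \<open>Presentations and isomorphisms\<close>

text \<open>A presentation prescribes each triple in one order only; \<open>xyx\<close> and
  \<open>xyy'\<close> supply the permuted values that occur when the free vectors in
  \<open>presentation_basis\<close> are expanded in the basis.\<close>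

lemma P26_basis_of_presentation:
  assumes "has_nilpotent_presentation10 L (P26_xyy r) P26_yyy"
  shows "\<exists>x1 x2 x3 x4 x5 y1 y2 y3 y4 y5. P26_basis r x1 x2 x3 x4 x5 y1 y2 y3 y4 y5"
proof -
  obtain x y where std: "standard_basis10 L x y"
    and "\<forall>i\<in>{1..5}. \<forall>j\<in>{1..5}. \<forall>k\<in>{1..5}.
      tri (x i) (x j) (x k) = 0 \<and> tri (x i) (x j) (y k) = 0 \<and>
      (j < k \<longrightarrow> tri (x i) (y j) (y k) = (if i < j then P26_xyy r i j k else 0)) \<and>
      (i < j \<and> j < k \<longrightarrow> tri (y i) (y j) (y k) = P26_yyy i j k)"
    using assms unfolding has_nilpotent_presentation10_def tri_def by blast
  then have xxx: "tri (x i) (x j) (x k) = 0" and xxy: "tri (x i) (x j) (y k) = 0"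
    and xyy: "j < k \<Longrightarrow> tri (x i) (y j) (y k) = (if i < j then P26_xyy r i j k else 0)"
    and yyy: "i < j \<Longrightarrow> j < k \<Longrightarrow> tri (y i) (y j) (y k) = P26_yyy i j k"
    if "i \<in> {1..5}" "j \<in> {1..5}" "k \<in> {1..5}" for i j k
    using that by blast+
  have xyx: "tri (x i) (y j) (x k) = 0" if "i \<in> {1..5}" "j \<in> {1..5}" "k \<in> {1..5}" for i j k
    using tri_swap23[of "x i" "y j" "x k"] xxy[OF that(1,3,2)] by simp
  have xyy': "tri (x i) (y j) (y k) = - (if i < k then P26_xyy r i k j else 0)"
    if "i \<in> {1..5}" "j \<in> {1..5}" "k \<in> {1..5}" "k < j" for i j k
    using tri_swap23[of "x i" "y j" "y k"] xyy[OF that(1,3,2,4)] by simp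
  note tri = xxx xxy xyx xyy xyy' yyy
  have hyp: "hyperbolic (x 1) (x 2) (x 3) (x 4) (x 5) (y 1) (y 2) (y 3) (y 4) (y 5)"
    using std unfolding standard_basis10_def hyperbolic_def by simp
  have "{1..5} = {1, 2, 3, 4, 5::nat}" by auto
  then have set: "x ` {1..5} \<union> y ` {1..5} = {x 1, x 2, x 3, x 4, x 5, y 1, y 2, y 3, y 4, y 5}"
    by (simp add: insert_commute)
  then have span: "span {x 1, x 2, x 3, x 4, x 5, y 1, y 2, y 3, y 4, y 5} = UNIV"
    using std unfolding standard_basis10_def by simp
  have dim: "dim UNIV = 10"
    using hyperbolic_independent[OF hyp] dim_span_eq_card_independent[OF hyperbolic_independent(1)[OF hyp]]
    unfolding span by simp
  note expansion = hyperbolic_expansion[OF hyp span]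
  have "tri (x 4) u v = 0 \<and> tri (x 5) u v = 0" for u v
    by (subst (1 2) expansion[of u], subst (1 2) expansion[of v]) (simp add: tri P26_xyy_def)
  moreover have "tri (x 3) (x 1) v = 0" "tri (x 3) (x 2) v = 0" "tri (x 3) (y 1) v = 0"
    "tri (x 3) (y 2) v = 0"
    "tri (x 3) (y 3) v = 0" "tri (x 2) (x 1) v = 0" "tri (x 2) (y 1) v = 0" "tri (x 2) (y 2) v = 0"
    "tri (x 1) (y 1) v = 0" for v
    by ((subst expansion[of v]), simp add: tri P26_xyy_def)+
  ultimately have "P26_basis r (x 1) (x 2) (x 3) (x 4) (x 5) (y 1) (y 2) (y 3) (y 4) (y 5)"
    unfolding presentation_basis_def using hyp dim
    by (simp add: tri P26_xyy_def P26_yyy_def)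
  then show ?thesis by blast
qed

lemma presentation_of_P26_basis:
  assumes "P26_basis r x1 x2 x3 x4 x5 y1 y2 y3 y4 y5"
  shows "has_nilpotent_presentation10 L (P26_xyy r) P26_yyy"
proof -
  define x where "x i = (if i = 1 then x1 else if i = 2 then x2 else if i = 3 then x3 else if i =
    4 then x4 else x5)" for i :: nat
  define y where "y i = (if i = 1 then y1 else if i = 2 then y2 else if i = 3 then y3 else if i =
    4 then y4 else y5)" for i :: nat
  have x: "x (Suc 0) = x1" "x 2 = x2" "x 3 = x3" "x 4 = x4" "x 5 = x5"
    and y: "y (Suc 0) = y1" "y 2 = y2" "y 3 = y3" "y 4 = y4" "y 5 = y5"
    by (simp_all add: x_def y_def)
  have hyp: "hyperbolic x1 x2 x3 x4 x5 y1 y2 y3 y4 y5" and dim: "dim UNIV = 10"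
    using assms by (simp_all add: presentation_basis_def)
  have indices: "{1..5} = {Suc 0, 2, 3, 4, 5}" by auto
  have set: "x ` {1..5} \<union> y ` {1..5} = {x1, x2, x3, x4, x5, y1, y2, y3, y4, y5}"
    unfolding indices by (simp add: x y insert_commute)
  have "standard_basis10 L x y"
    unfolding standard_basis10_def set unfolding indices
    using hyperbolic_independent(1)[OF hyp] hyperbolic_span[OF hyp dim]
    by (simp add: x y hyperbolic_values[OF hyp] form_alternating)
  moreover have "\<forall>i\<in>{1..5}. \<forall>j\<in>{1..5}. \<forall>k\<in>{1..5}.
      tri (x i) (x j) (x k) = 0 \<and> tri (x i) (x j) (y k) = 0 \<and>
      (j < k \<longrightarrow> tri (x i) (y j) (y k) = (if i < j then P26_xyy r i j k else 0)) \<and>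
      (i < j \<and> j < k \<longrightarrow> tri (y i) (y j) (y k) = P26_yyy i j k)"
    unfolding indices by (simp add: x y presentation_basis_tri_perm[OF assms] P26_xyy_def P26_yyy_def)
  ultimately show ?thesis
    unfolding has_nilpotent_presentation10_def tri_def by blast
qed

end

lemma has_presentation_P26_iff:
  "has_presentation_P26 L r \<longleftrightarrow> symplectic_alternating_algebra L \<and>
    (\<exists>x1 x2 x3 x4 x5 y1 y2 y3 y4 y5.
      symplectic_alternating_algebra.presentation_basis L 1 r 1 1 1 x1 x2 x3 x4 x5 y1 y2 y3 y4 y5)"
  unfolding has_presentation_P26_def
  using symplectic_alternating_algebra.P26_basis_of_presentation
    symplectic_alternating_algebra.presentation_of_P26_basis by blast

text \<open>This carries a basis of M over to L, so that two presentations can be compared inside a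
  single algebra although L and M may have different types.\<close>

lemma presentation_basis_pullback:
  assumes "symplectic_alternating_algebra L" "symplectic_alternating_algebra M" "saa_iso L M \<phi>"
    and "vector_space.dim (scale L) UNIV = 10"
    and "symplectic_alternating_algebra.presentation_basis M a b c d e
      (\<phi> x1) (\<phi> x2) (\<phi> x3) (\<phi> x4) (\<phi> x5) (\<phi> y1) (\<phi> y2) (\<phi> y3) (\<phi> y4) (\<phi> y5)"
  shows "symplectic_alternating_algebra.presentation_basis L a b c d e x1 x2 x3 x4 x5 y1 y2 y3 y4 y5"
proof -
  interpret L: symplectic_alternating_algebra L by fact
  interpret M: symplectic_alternating_algebra M by fact
  have form: "form L u v = form M (\<phi> u) (\<phi> v)" and mult: "\<phi> (mult L u v) = mult M (\<phi> u) (\<phi> v)" for u v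
    using assms(3) by (simp_all add: saa_iso_def)
  have "L.tri u v w = M.tri (\<phi> u) (\<phi> v) (\<phi> w)" for u v w
    by (simp add: L.tri_def M.tri_def form mult)
  then show ?thesis
    using assms(4,5) by (simp add: L.presentation_basis_def M.presentation_basis_def
      L.hyperbolic_def M.hyperbolic_def form)
qed

text \<open>Form and product are given by formulas in the coordinates that involve only r, so the
  map \<open>\<phi>\<close> that keeps the coordinates is an isomorphism, with inverse
  \<open>\<psi>\<close>.\<close>

lemma saa_isomorphic_if_P26_basis:
  assumes "symplectic_alternating_algebra L" "symplectic_alternating_algebra M"
    and bL: "symplectic_alternating_algebra.presentation_basis L 1 r 1 1 1 x1 x2 x3 x4 x5 y1 y2 y3 y4 y5"
    and bM: "symplectic_alternating_algebra.presentation_basis M 1 r 1 1 1 x1' x2' x3' x4' x5' y1' y2' y3' y4' y5'"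
  shows "saa_isomorphic L M"
proof -
  interpret L: symplectic_alternating_algebra L by fact
  interpret M: symplectic_alternating_algebra M by fact
  define \<phi> where "\<phi> v = scale M (form L v y1) x1' + scale M (form L v y2) x2' + scale M (form L v y3) x3' +
    scale M (form L v y4) x4' + scale M (form L v y5) x5' +
    scale M (form L x1 v) y1' + scale M (form L x2 v) y2' + scale M (form L x3 v) y3' + scale M (form L x4 v) y4' + scale M (form L x5 v) y5'" for v
  define \<psi> where "\<psi> v = scale L (form M v y1') x1 + scale L (form M v y2') x2 + scale L (form M v y3') x3 +
    scale L (form M v y4') x4 + scale L (form M v y5') x5 +
    scale L (form M x1' v) y1 + scale L (form M x2' v) y2 + scale L (form M x3' v) y3 + scale L (form M x4' v) y4 + scale L (form M x5' v) y5" for v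
  have hL: "L.hyperbolic x1 x2 x3 x4 x5 y1 y2 y3 y4 y5"
    and hM: "M.hyperbolic x1' x2' x3' x4' x5' y1' y2' y3' y4' y5'"
    using bL bM by (simp_all add: L.presentation_basis_def M.presentation_basis_def)
  note vL [simp] = L.hyperbolic_values[OF hL] L.form_alternating
  note vM [simp] = M.hyperbolic_values[OF hM] M.form_alternating
  have coords: "form M (\<phi> v) y1' = form L v y1" "form M (\<phi> v) y2' = form L v y2"
    "form M (\<phi> v) y3' = form L v y3" "form M (\<phi> v) y4' = form L v y4" "form M (\<phi> v) y5' = form L v y5"
    "form M x1' (\<phi> v) = form L x1 v" "form M x2' (\<phi> v) = form L x2 v" "form M x3' (\<phi> v) = form L x3 v"
    "form M x4' (\<phi> v) = form L x4 v" "form M x5' (\<phi> v) = form L x5 v" for v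
    by (simp_all add: \<phi>_def)
  have coords': "form L (\<psi> v) y1 = form M v y1'" "form L (\<psi> v) y2 = form M v y2'"
    "form L (\<psi> v) y3 = form M v y3'" "form L (\<psi> v) y4 = form M v y4'" "form L (\<psi> v) y5 = form M v y5'"
    "form L x1 (\<psi> v) = form M x1' v" "form L x2 (\<psi> v) = form M x2' v" "form L x3 (\<psi> v) = form M x3' v"
    "form L x4 (\<psi> v) = form M x4' v" "form L x5 (\<psi> v) = form M x5' v" for v
    by (simp_all add: \<psi>_def)
  have "\<psi> (\<phi> v) = v" for v
    unfolding \<psi>_def coords by (rule L.presentation_basis_expansion[OF bL, symmetric])
  moreover have "\<phi> (\<psi> v) = v" for v
    unfolding \<phi>_def coords' by (rule M.presentation_basis_expansion[OF bM, symmetric])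
  ultimately have bij: "bij \<phi>" by (intro o_bij[of \<psi>]) auto
  have linear: "Vector_Spaces.linear (scale L) (scale M) \<phi>"
    using L.vector_space_axioms M.vector_space_axioms
    by (simp add: Vector_Spaces.linear_iff \<phi>_def M.scale_left_distrib M.scale_right_distrib algebra_simps)
  have "form M (\<phi> u) (\<phi> v) = form L u v" for u v
    by (subst M.presentation_basis_form[OF bM], subst L.presentation_basis_form[OF bL]) (simp only: coords)
  moreover have "\<phi> (mult L u v) = mult M (\<phi> u) (\<phi> v)" for u v
    by (subst M.P26_basis_mult[OF bM], subst L.P26_basis_mult[OF bL]) (simp add: coords, simp add: \<phi>_def)
  ultimately show ?thesis
    using bij linear unfolding saa_isomorphic_def saa_iso_def by blast
qed

theorem proposition3p6:
  shows
    "(\<forall>L :: ('f::field, 'a::ab_group_add) saa_struct.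
        P26_properties L \<longrightarrow> (\<exists>r. r \<noteq> 0 \<and> has_presentation_P26 L r)) \<and>
     (\<forall>(r::'f) s (L :: ('f, 'a) saa_struct) (M :: ('f, 'b::ab_group_add) saa_struct).
        r \<noteq> 0 \<longrightarrow> s \<noteq> 0 \<longrightarrow> has_presentation_P26 L r \<longrightarrow> has_presentation_P26 M s \<longrightarrow>
        (saa_isomorphic L M \<longleftrightarrow> s / r \<in> nonzero_powers 12)) \<and>
     (\<forall>(L :: ('f, 'a) saa_struct) r.
        r \<noteq> 0 \<longrightarrow> has_presentation_P26 L r \<longrightarrow> P26_properties L)"
proof (intro conjI allI impI)
  fix L :: "('f, 'a) saa_struct"
  assume properties: "P26_properties L"
  then interpret P26_algebra L
    by (simp add: P26_algebra_def P26_algebra_axioms_def P26_properties_def)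
  show "\<exists>r. r \<noteq> 0 \<and> has_presentation_P26 L r"
    using P26_basis_exists symplectic_alternating_algebra_axioms has_presentation_P26_iff by blast
next
  fix L :: "('f, 'a) saa_struct" and r
  assume r: "r \<noteq> 0" and "has_presentation_P26 L r"
  then obtain x1 x2 x3 x4 x5 y1 y2 y3 y4 y5 where L: "symplectic_alternating_algebra L"
    "symplectic_alternating_algebra.presentation_basis L 1 r 1 1 1 x1 x2 x3 x4 x5 y1 y2 y3 y4 y5"
    unfolding has_presentation_P26_iff by blast
  interpret symplectic_alternating_algebra L by fact
  interpret P26_presented L r x1 x2 x3 x4 x5 y1 y2 y3 y4 y5 by unfold_locales (fact L r)+
  show "P26_properties L" by (rule P26_properties)
next
  fix r s :: 'f and L :: "('f, 'a) saa_struct" and M :: "('f, 'b) saa_struct"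
  assume r: "r \<noteq> 0" and s: "s \<noteq> 0" and "has_presentation_P26 L r" "has_presentation_P26 M s"
  then obtain x1 x2 x3 x4 x5 y1 y2 y3 y4 y5 x1' x2' x3' x4' x5' y1' y2' y3' y4' y5'
    where L: "symplectic_alternating_algebra L"
      "symplectic_alternating_algebra.presentation_basis L 1 r 1 1 1 x1 x2 x3 x4 x5 y1 y2 y3 y4 y5"
    and M: "symplectic_alternating_algebra M"
      "symplectic_alternating_algebra.presentation_basis M 1 s 1 1 1 x1' x2' x3' x4' x5' y1' y2' y3' y4' y5'"
    unfolding has_presentation_P26_iff by blast
  interpret symplectic_alternating_algebra L by fact
  interpret P26_presented L r x1 x2 x3 x4 x5 y1 y2 y3 y4 y5 by unfold_locales (fact L r)+
  show "saa_isomorphic L M \<longleftrightarrow> s / r \<in> nonzero_powers 12"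
  proof
    assume "saa_isomorphic L M"
    then obtain \<phi> where iso: "saa_iso L M \<phi>" by (auto simp: saa_isomorphic_def)
    then have "surj \<phi>" by (simp add: saa_iso_def bij_is_surj)
    then have inv: "\<phi> (inv \<phi> v) = v" for v by (rule surj_f_inv_f)
    \<comment> \<open>Both bases now belong to L, which is the setting of
      \<open>ratio_nonzero_power\<close>.\<close>
    have "P26_basis s
        (inv \<phi> x1') (inv \<phi> x2') (inv \<phi> x3') (inv \<phi> x4') (inv \<phi> x5')
        (inv \<phi> y1') (inv \<phi> y2') (inv \<phi> y3') (inv \<phi> y4') (inv \<phi> y5')"
      by (rule presentation_basis_pullback[OF L(1) M(1) iso dim_10]) (unfold inv, rule M(2))
    then show "s / r \<in> nonzero_powers 12" using s by (rule ratio_nonzero_power)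
  next
    assume "s / r \<in> nonzero_powers 12"
    then obtain t where t: "t \<noteq> 0" "s / r = t ^ 12" by (auto simp: nonzero_powers_def)
    \<comment> \<open>The solution k4 = t^2, k5 = t^-5 of k4^5 k5^2 = 1, with k3 = k4 k5, k1 = k3 k4
      and k2 = k1 / k5. It multiplies r by k2 / (k3 k5) = t^12.\<close>
    define k1 where "k1 = 1 / t"
    define k2 where "k2 = t ^ 4"
    define k3 where "k3 = 1 / t ^ 3"
    define k4 where "k4 = t ^ 2"
    define k5 where "k5 = 1 / t ^ 5"
    note k_defs = k1_def k2_def k3_def k4_def k5_def
    have k: "k1 \<noteq> 0" "k2 \<noteq> 0" "k3 \<noteq> 0" "k4 \<noteq> 0" "k5 \<noteq> 0" using t by (simp_all add: k_defs)
    have "k3 / (k4 * k5) * 1 = 1" "k1 / (k2 * k5) * 1 = 1" "k1 / (k3 * k4) * 1 = 1"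
      "1 / (k1 * k2 * k3) * 1 = 1"
      using t(1) by (simp_all add: k_defs field_simps power_Suc[symmetric] del: power_Suc)
    moreover have "k2 / (k3 * k5) * r = s"
      using t r by (simp add: k_defs field_simps power_Suc[symmetric] del: power_Suc)
    moreover note presentation_basis_rescale[OF basis k]
    ultimately have "\<exists>x1 x2 x3 x4 x5 y1 y2 y3 y4 y5. P26_basis s x1 x2 x3 x4 x5 y1 y2 y3 y4 y5"
      by (simp only:) blast
    then obtain x1'' x2'' x3'' x4'' x5'' y1'' y2'' y3'' y4'' y5''
      where "P26_basis s x1'' x2'' x3'' x4'' x5'' y1'' y2'' y3'' y4'' y5''" by blast
    then show "saa_isomorphic L M" by (rule saa_isomorphic_if_P26_basis[OF L(1) M(1) _ M(2)])
  qed
qed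

end
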